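(* The prop $\mathbf{QuadRel}$ is presented by Graphical Quadratic Algebra $\mathbf{GQA}$; that is, the interpretation prop morphism from $\mathbf{GQA}$ to $\mathbf{QuadRel}$ described below is an isomorphism of props.
   Context: For a linear equation $\phi$, write $[\phi]$ for the weight $0$ if $\phi$ holds and $+\infty$ otherwise. $\mathbf{QuadRel}$ is the prop whose morphisms $m\to n$ are nonnegative partial quadratic functions $F:\mathbb R^m\times\mathbb R^n\to[0,\infty]$ (functions of the form $\langle x,\Sigma x\rangle+\langle b,x\rangle+c+[x\in M]$ with $M$ an affine subspace, $\Sigma$ symmetric), with identity $[x=y]$, composition $(F;G)(x,z)=\inf_y\{F(x,y)+G(y,z)\}$, and monoidal product given by adding the functions on disjoint variables. $\mathbf{GQA}$ is the prop freely generated by copy, discard, addition, zero, scalars $k\in\mathbb R$, constant one, a generator $\nu:0\to1$, and the mirror images of copy, discard, addition and zero, modulo the axioms of Graphical Affine Algebra (which present affine relations) plus three quadratic axioms: discarding $\nu$ gives the empty diagram (D), conditioning $\nu$ to be zero (composing with the mirrored zero) gives the empty diagram (Z), and rotation invariance of two parallel copies of $\nu$ under rotation by any angle $\varphi$ (RI). The interpretation sends copy to $[x=x_1=x_2]$, discard to $0$, addition to $[y=x_1+x_2]$, zero to $[x=0]$, scalar $k$ to $[y=kx]$, constant one to $[x=1]$, mirrored generators to the symmetric relations, and $\nu$ to $x\mapsto\tfrac12x^2$. *)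

theory Defs
  imports
    "Jordan_Normal_Form.Matrix"
    "HOL-Library.Extended_Nonnegative_Real"
    "HOL-Library.FuncSet"
    Complex_Main
begin

section \<open>Props\<close>

text \<open>
  A prop is a strict symmetric monoidal category whose objects are the natural numbers and whose
  tensor product on objects is addition. The operations are indexed by the objects involved:
  \<open>p_comp P l m n f g\<close> is the composite, in diagrammatic order, of \<open>f : l \<rightarrow> m\<close> and
  \<open>g : m \<rightarrow> n\<close>; \<open>p_tens P m n m' n' f g\<close> is the monoidal product of \<open>f : m \<rightarrow> n\<close> and
  \<open>g : m' \<rightarrow> n'\<close>; and \<open>p_sym P m n : m + n \<rightarrow> n + m\<close> is the symmetry.
\<close>

record 'a prop_struct =
  p_hom :: "nat \<Rightarrow> nat \<Rightarrow> 'a set"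
  p_id :: "nat \<Rightarrow> 'a"
  p_comp :: "nat \<Rightarrow> nat \<Rightarrow> nat \<Rightarrow> 'a \<Rightarrow> 'a \<Rightarrow> 'a"
  p_tens :: "nat \<Rightarrow> nat \<Rightarrow> nat \<Rightarrow> nat \<Rightarrow> 'a \<Rightarrow> 'a \<Rightarrow> 'a"
  p_sym :: "nat \<Rightarrow> nat \<Rightarrow> 'a"

locale prop_cat =
  fixes P :: "'a prop_struct"
  assumes id_closed: "p_id P n \<in> p_hom P n n"
    and comp_closed: "f \<in> p_hom P l m \<Longrightarrow> g \<in> p_hom P m n \<Longrightarrow> p_comp P l m n f g \<in> p_hom P l n"
    and tens_closed: "f \<in> p_hom P m n \<Longrightarrow> g \<in> p_hom P m' n' \<Longrightarrow>
          p_tens P m n m' n' f g \<in> p_hom P (m + m') (n + n')"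
    and sym_closed: "p_sym P m n \<in> p_hom P (m + n) (n + m)"
    and id_left: "f \<in> p_hom P m n \<Longrightarrow> p_comp P m m n (p_id P m) f = f"
    and id_right: "f \<in> p_hom P m n \<Longrightarrow> p_comp P m n n f (p_id P n) = f"
    and comp_assoc: "f \<in> p_hom P k l \<Longrightarrow> g \<in> p_hom P l m \<Longrightarrow> h \<in> p_hom P m n \<Longrightarrow>
          p_comp P k m n (p_comp P k l m f g) h = p_comp P k l n f (p_comp P l m n g h)"
    and tens_id: "p_tens P m m n n (p_id P m) (p_id P n) = p_id P (m + n)"
    and interchange:
          "f \<in> p_hom P l m \<Longrightarrow> g \<in> p_hom P m n \<Longrightarrow> f' \<in> p_hom P l' m' \<Longrightarrow> g' \<in> p_hom P m' n' \<Longrightarrow>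
          p_tens P l n l' n' (p_comp P l m n f g) (p_comp P l' m' n' f' g') =
          p_comp P (l + l') (m + m') (n + n') (p_tens P l m l' m' f f') (p_tens P m n m' n' g g')"
    and unit_left: "f \<in> p_hom P m n \<Longrightarrow> p_tens P 0 0 m n (p_id P 0) f = f"
    and unit_right: "f \<in> p_hom P m n \<Longrightarrow> p_tens P m n 0 0 f (p_id P 0) = f"
    and tens_assoc: "f \<in> p_hom P m n \<Longrightarrow> g \<in> p_hom P m' n' \<Longrightarrow> h \<in> p_hom P m'' n'' \<Longrightarrow>
          p_tens P (m + m') (n + n') m'' n'' (p_tens P m n m' n' f g) h =
          p_tens P m n (m' + m'') (n' + n'') f (p_tens P m' n' m'' n'' g h)"
    and sym_natural: "f \<in> p_hom P m n \<Longrightarrow> g \<in> p_hom P m' n' \<Longrightarrow>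
          p_comp P (m + m') (n + n') (n' + n) (p_tens P m n m' n' f g) (p_sym P n n') =
          p_comp P (m + m') (m' + m) (n' + n) (p_sym P m m') (p_tens P m' n' m n g f)"
    and sym_inverse: "p_comp P (m + n) (n + m) (m + n) (p_sym P m n) (p_sym P n m) = p_id P (m + n)"
    and sym_unit: "p_sym P n 0 = p_id P n"
    and sym_hexagon: "p_sym P (l + m) n =
          p_comp P (l + m + n) (l + n + m) (n + l + m)
            (p_tens P l l (m + n) (n + m) (p_id P l) (p_sym P m n))
            (p_tens P (l + n) (n + l) m m (p_sym P l n) (p_id P m))"

locale prop_morphism = dom: prop_cat P + cod: prop_cat Q
  for P :: "'a prop_struct" and Q :: "'b prop_struct" +
  fixes \<phi> :: "nat \<Rightarrow> nat \<Rightarrow> 'a \<Rightarrow> 'b"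
  assumes map_hom: "f \<in> p_hom P m n \<Longrightarrow> \<phi> m n f \<in> p_hom Q m n"
    and map_id: "\<phi> n n (p_id P n) = p_id Q n"
    and map_comp: "f \<in> p_hom P l m \<Longrightarrow> g \<in> p_hom P m n \<Longrightarrow>
          \<phi> l n (p_comp P l m n f g) = p_comp Q l m n (\<phi> l m f) (\<phi> m n g)"
    and map_tens: "f \<in> p_hom P m n \<Longrightarrow> g \<in> p_hom P m' n' \<Longrightarrow>
          \<phi> (m + m') (n + n') (p_tens P m n m' n' f g) =
          p_tens Q m n m' n' (\<phi> m n f) (\<phi> m' n' g)"
    and map_sym: "\<phi> (m + n) (n + m) (p_sym P m n) = p_sym Q m n"

definition prop_isomorphism ::
  "'a prop_struct \<Rightarrow> 'b prop_struct \<Rightarrow> (nat \<Rightarrow> nat \<Rightarrow> 'a \<Rightarrow> 'b) \<Rightarrow> bool" where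
  "prop_isomorphism P Q \<phi> \<longleftrightarrow>
     prop_morphism P Q \<phi> \<and>
     (\<exists>\<psi>. prop_morphism Q P \<psi> \<and>
       (\<forall>m n. \<forall>f\<in>p_hom P m n. \<psi> m n (\<phi> m n f) = f) \<and>
       (\<forall>m n. \<forall>g\<in>p_hom Q m n. \<phi> m n (\<psi> m n g) = g))"


section \<open>Props presented by generators and equations\<close>

datatype 'g diagram =
    Gen 'g
  | Wires nat
  | Swap nat nat
  | Seq "'g diagram" "'g diagram" (infixl \<open>\<Zsemi>\<close> 60)
  | Par "'g diagram" "'g diagram" (infixr \<open>\<parallel>\<close> 65)

text \<open>A signature \<open>\<sigma>\<close> assigns to each generator its numbers of inputs and outputs.\<close>

primrec src :: "('g \<Rightarrow> nat \<times> nat) \<Rightarrow> 'g diagram \<Rightarrow> nat" where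
  "src \<sigma> (Gen g) = fst (\<sigma> g)"
| "src \<sigma> (Wires n) = n"
| "src \<sigma> (Swap m n) = m + n"
| "src \<sigma> (s \<Zsemi> t) = src \<sigma> s"
| "src \<sigma> (s \<parallel> t) = src \<sigma> s + src \<sigma> t"

primrec tgt :: "('g \<Rightarrow> nat \<times> nat) \<Rightarrow> 'g diagram \<Rightarrow> nat" where
  "tgt \<sigma> (Gen g) = snd (\<sigma> g)"
| "tgt \<sigma> (Wires n) = n"
| "tgt \<sigma> (Swap m n) = n + m"
| "tgt \<sigma> (s \<Zsemi> t) = tgt \<sigma> t"
| "tgt \<sigma> (s \<parallel> t) = tgt \<sigma> s + tgt \<sigma> t"

primrec composable :: "('g \<Rightarrow> nat \<times> nat) \<Rightarrow> 'g diagram \<Rightarrow> bool" where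
  "composable \<sigma> (Gen g) \<longleftrightarrow> True"
| "composable \<sigma> (Wires n) \<longleftrightarrow> True"
| "composable \<sigma> (Swap m n) \<longleftrightarrow> True"
| "composable \<sigma> (s \<Zsemi> t) \<longleftrightarrow> composable \<sigma> s \<and> composable \<sigma> t \<and> tgt \<sigma> s = src \<sigma> t"
| "composable \<sigma> (s \<parallel> t) \<longleftrightarrow> composable \<sigma> s \<and> composable \<sigma> t"

definition diagrams :: "('g \<Rightarrow> nat \<times> nat) \<Rightarrow> nat \<Rightarrow> nat \<Rightarrow> 'g diagram set" where
  "diagrams \<sigma> m n = {t. composable \<sigma> t \<and> src \<sigma> t = m \<and> tgt \<sigma> t = n}"

text \<open>The congruence on diagrams of the same type generated by the laws of props and the
  equations \<open>E\<close>.\<close>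

inductive diag_eq ::
  "('g \<Rightarrow> nat \<times> nat) \<Rightarrow> ('g diagram \<Rightarrow> 'g diagram \<Rightarrow> bool) \<Rightarrow>
   nat \<Rightarrow> nat \<Rightarrow> 'g diagram \<Rightarrow> 'g diagram \<Rightarrow> bool"
  for \<sigma> E where
  eq_axiom: "E s t \<Longrightarrow> s \<in> diagrams \<sigma> m n \<Longrightarrow> t \<in> diagrams \<sigma> m n \<Longrightarrow> diag_eq \<sigma> E m n s t"
| eq_refl: "t \<in> diagrams \<sigma> m n \<Longrightarrow> diag_eq \<sigma> E m n t t"
| eq_sym: "diag_eq \<sigma> E m n s t \<Longrightarrow> diag_eq \<sigma> E m n t s"
| eq_trans: "diag_eq \<sigma> E m n s t \<Longrightarrow> diag_eq \<sigma> E m n t u \<Longrightarrow> diag_eq \<sigma> E m n s u"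
| eq_Seq: "diag_eq \<sigma> E l m s s' \<Longrightarrow> diag_eq \<sigma> E m n t t' \<Longrightarrow>
    diag_eq \<sigma> E l n (s \<Zsemi> t) (s' \<Zsemi> t')"
| eq_Par: "diag_eq \<sigma> E m n s s' \<Longrightarrow> diag_eq \<sigma> E m' n' t t' \<Longrightarrow>
    diag_eq \<sigma> E (m + m') (n + n') (s \<parallel> t) (s' \<parallel> t')"
| eq_id_left: "t \<in> diagrams \<sigma> m n \<Longrightarrow> diag_eq \<sigma> E m n (Wires m \<Zsemi> t) t"
| eq_id_right: "t \<in> diagrams \<sigma> m n \<Longrightarrow> diag_eq \<sigma> E m n (t \<Zsemi> Wires n) t"
| eq_Seq_assoc: "s \<in> diagrams \<sigma> k l \<Longrightarrow> t \<in> diagrams \<sigma> l m \<Longrightarrow> u \<in> diagrams \<sigma> m n \<Longrightarrow>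
    diag_eq \<sigma> E k n ((s \<Zsemi> t) \<Zsemi> u) (s \<Zsemi> (t \<Zsemi> u))"
| eq_Par_id: "diag_eq \<sigma> E (m + n) (m + n) (Wires m \<parallel> Wires n) (Wires (m + n))"
| eq_interchange:
    "s \<in> diagrams \<sigma> l m \<Longrightarrow> t \<in> diagrams \<sigma> m n \<Longrightarrow> s' \<in> diagrams \<sigma> l' m' \<Longrightarrow> t' \<in> diagrams \<sigma> m' n' \<Longrightarrow>
    diag_eq \<sigma> E (l + l') (n + n') ((s \<Zsemi> t) \<parallel> (s' \<Zsemi> t')) ((s \<parallel> s') \<Zsemi> (t \<parallel> t'))"
| eq_unit_left: "t \<in> diagrams \<sigma> m n \<Longrightarrow> diag_eq \<sigma> E m n (Wires 0 \<parallel> t) t"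
| eq_unit_right: "t \<in> diagrams \<sigma> m n \<Longrightarrow> diag_eq \<sigma> E m n (t \<parallel> Wires 0) t"
| eq_Par_assoc: "s \<in> diagrams \<sigma> m n \<Longrightarrow> t \<in> diagrams \<sigma> m' n' \<Longrightarrow> u \<in> diagrams \<sigma> m'' n'' \<Longrightarrow>
    diag_eq \<sigma> E (m + m' + m'') (n + n' + n'') ((s \<parallel> t) \<parallel> u) (s \<parallel> (t \<parallel> u))"
| eq_Swap_natural: "s \<in> diagrams \<sigma> m n \<Longrightarrow> t \<in> diagrams \<sigma> m' n' \<Longrightarrow>
    diag_eq \<sigma> E (m + m') (n' + n) ((s \<parallel> t) \<Zsemi> Swap n n') (Swap m m' \<Zsemi> (t \<parallel> s))"
| eq_Swap_inverse: "diag_eq \<sigma> E (m + n) (m + n) (Swap m n \<Zsemi> Swap n m) (Wires (m + n))"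
| eq_Swap_unit: "diag_eq \<sigma> E n n (Swap n 0) (Wires n)"
| eq_Swap_hexagon: "diag_eq \<sigma> E (l + m + n) (n + l + m)
    (Swap (l + m) n) ((Wires l \<parallel> Swap m n) \<Zsemi> (Swap l n \<parallel> Wires m))"

definition diag_rel ::
  "('g \<Rightarrow> nat \<times> nat) \<Rightarrow> ('g diagram \<Rightarrow> 'g diagram \<Rightarrow> bool) \<Rightarrow>
   nat \<Rightarrow> nat \<Rightarrow> ('g diagram \<times> 'g diagram) set" where
  "diag_rel \<sigma> E m n = {(s, t). diag_eq \<sigma> E m n s t}"

definition presented_prop ::
  "('g \<Rightarrow> nat \<times> nat) \<Rightarrow> ('g diagram \<Rightarrow> 'g diagram \<Rightarrow> bool) \<Rightarrow> 'g diagram set prop_struct" where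
  "presented_prop \<sigma> E = \<lparr>
     p_hom = (\<lambda>m n. diagrams \<sigma> m n // diag_rel \<sigma> E m n),
     p_id = (\<lambda>n. diag_rel \<sigma> E n n `` {Wires n}),
     p_comp = (\<lambda>l m n X Y. \<Union>s\<in>X. \<Union>t\<in>Y. diag_rel \<sigma> E l n `` {s \<Zsemi> t}),
     p_tens = (\<lambda>m n m' n' X Y. \<Union>s\<in>X. \<Union>t\<in>Y. diag_rel \<sigma> E (m + m') (n + n') `` {s \<parallel> t}),
     p_sym = (\<lambda>m n. diag_rel \<sigma> E (m + n) (n + m) `` {Swap m n})\<rparr>"

text \<open>The extension of an assignment \<open>v\<close> of morphisms of \<open>P\<close> to the generators, first to diagrams
  and then to equivalence classes of diagrams.\<close>

primrec eval :: "('g \<Rightarrow> nat \<times> nat) \<Rightarrow> 'a prop_struct \<Rightarrow> ('g \<Rightarrow> 'a) \<Rightarrow> 'g diagram \<Rightarrow> 'a" where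
  "eval \<sigma> P v (Gen g) = v g"
| "eval \<sigma> P v (Wires n) = p_id P n"
| "eval \<sigma> P v (Swap m n) = p_sym P m n"
| "eval \<sigma> P v (s \<Zsemi> t) = p_comp P (src \<sigma> s) (tgt \<sigma> s) (tgt \<sigma> t) (eval \<sigma> P v s) (eval \<sigma> P v t)"
| "eval \<sigma> P v (s \<parallel> t) =
     p_tens P (src \<sigma> s) (tgt \<sigma> s) (src \<sigma> t) (tgt \<sigma> t) (eval \<sigma> P v s) (eval \<sigma> P v t)"

definition interpretation_map ::
  "('g \<Rightarrow> nat \<times> nat) \<Rightarrow> 'a prop_struct \<Rightarrow> ('g \<Rightarrow> 'a) \<Rightarrow> nat \<Rightarrow> nat \<Rightarrow> 'g diagram set \<Rightarrow> 'a" where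
  "interpretation_map \<sigma> P v m n X = the_elem (eval \<sigma> P v ` X)"


section \<open>Graphical Quadratic Algebra\<close>

datatype gqa_gen =
    Copy | Discard | Add | Zero | Scalar real | One | Nu
  | CoCopy | CoDiscard | CoAdd | CoZero

primrec gqa_sig :: "gqa_gen \<Rightarrow> nat \<times> nat" where
  "gqa_sig Copy = (1, 2)"
| "gqa_sig Discard = (1, 0)"
| "gqa_sig Add = (2, 1)"
| "gqa_sig Zero = (0, 1)"
| "gqa_sig (Scalar k) = (1, 1)"
| "gqa_sig One = (0, 1)"
| "gqa_sig Nu = (0, 1)"
| "gqa_sig CoCopy = (2, 1)"
| "gqa_sig CoDiscard = (0, 1)"
| "gqa_sig CoAdd = (1, 2)"
| "gqa_sig CoZero = (1, 0)"

abbreviation "copy\<^sub>g \<equiv> Gen Copy"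
abbreviation "discard\<^sub>g \<equiv> Gen Discard"
abbreviation "add\<^sub>g \<equiv> Gen Add"
abbreviation "zero\<^sub>g \<equiv> Gen Zero"
abbreviation "scalar\<^sub>g k \<equiv> Gen (Scalar k)"
abbreviation "one\<^sub>g \<equiv> Gen One"
abbreviation "nu\<^sub>g \<equiv> Gen Nu"
abbreviation "cocopy\<^sub>g \<equiv> Gen CoCopy"
abbreviation "codiscard\<^sub>g \<equiv> Gen CoDiscard"
abbreviation "coadd\<^sub>g \<equiv> Gen CoAdd"
abbreviation "cozero\<^sub>g \<equiv> Gen CoZero"
abbreviation wire :: "gqa_gen diagram" where "wire \<equiv> Wires 1"
abbreviation empty_diagram :: "gqa_gen diagram" where "empty_diagram \<equiv> Wires 0"

definition cup :: "gqa_gen diagram" where "cup = codiscard\<^sub>g \<Zsemi> copy\<^sub>g"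
definition cap :: "gqa_gen diagram" where "cap = cocopy\<^sub>g \<Zsemi> discard\<^sub>g"

text \<open>Scalars, the constant and \<open>nu\<close> have no mirrored generators; their mirror images are obtained
  by bending wires.\<close>

definition coscalar :: "real \<Rightarrow> gqa_gen diagram" where
  "coscalar k = (cup \<parallel> wire) \<Zsemi> (wire \<parallel> scalar\<^sub>g k \<parallel> wire) \<Zsemi> (wire \<parallel> cap)"

primrec mirror_gen :: "gqa_gen \<Rightarrow> gqa_gen diagram" where
  "mirror_gen Copy = cocopy\<^sub>g"
| "mirror_gen Discard = codiscard\<^sub>g"
| "mirror_gen Add = coadd\<^sub>g"
| "mirror_gen Zero = cozero\<^sub>g"
| "mirror_gen (Scalar k) = coscalar k"
| "mirror_gen One = (one\<^sub>g \<parallel> wire) \<Zsemi> cap"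
| "mirror_gen Nu = (nu\<^sub>g \<parallel> wire) \<Zsemi> cap"
| "mirror_gen CoCopy = copy\<^sub>g"
| "mirror_gen CoDiscard = discard\<^sub>g"
| "mirror_gen CoAdd = add\<^sub>g"
| "mirror_gen CoZero = zero\<^sub>g"

primrec mirror :: "gqa_gen diagram \<Rightarrow> gqa_gen diagram" where
  "mirror (Gen g) = mirror_gen g"
| "mirror (Wires n) = Wires n"
| "mirror (Swap m n) = Swap n m"
| "mirror (s \<Zsemi> t) = mirror t \<Zsemi> mirror s"
| "mirror (s \<parallel> t) = mirror s \<parallel> mirror t"

text \<open>Matrices: a commutative comonoid and a commutative monoid forming a bialgebra, with real scalars
  acting by bialgebra homomorphisms.\<close>

inductive matrix_axiom :: "gqa_gen diagram \<Rightarrow> gqa_gen diagram \<Rightarrow> bool" where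
  copy_assoc: "matrix_axiom (copy\<^sub>g \<Zsemi> (copy\<^sub>g \<parallel> wire)) (copy\<^sub>g \<Zsemi> (wire \<parallel> copy\<^sub>g))"
| copy_unit: "matrix_axiom (copy\<^sub>g \<Zsemi> (discard\<^sub>g \<parallel> wire)) wire"
| copy_comm: "matrix_axiom (copy\<^sub>g \<Zsemi> Swap 1 1) copy\<^sub>g"
| add_assoc: "matrix_axiom ((add\<^sub>g \<parallel> wire) \<Zsemi> add\<^sub>g) ((wire \<parallel> add\<^sub>g) \<Zsemi> add\<^sub>g)"
| add_unit: "matrix_axiom ((zero\<^sub>g \<parallel> wire) \<Zsemi> add\<^sub>g) wire"
| add_comm: "matrix_axiom (Swap 1 1 \<Zsemi> add\<^sub>g) add\<^sub>g"
| add_copy: "matrix_axiom (add\<^sub>g \<Zsemi> copy\<^sub>g)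
    ((copy\<^sub>g \<parallel> copy\<^sub>g) \<Zsemi> (wire \<parallel> Swap 1 1 \<parallel> wire) \<Zsemi> (add\<^sub>g \<parallel> add\<^sub>g))"
| add_discard: "matrix_axiom (add\<^sub>g \<Zsemi> discard\<^sub>g) (discard\<^sub>g \<parallel> discard\<^sub>g)"
| zero_copy: "matrix_axiom (zero\<^sub>g \<Zsemi> copy\<^sub>g) (zero\<^sub>g \<parallel> zero\<^sub>g)"
| zero_discard: "matrix_axiom (zero\<^sub>g \<Zsemi> discard\<^sub>g) empty_diagram"
| scalar_copy: "matrix_axiom (scalar\<^sub>g k \<Zsemi> copy\<^sub>g) (copy\<^sub>g \<Zsemi> (scalar\<^sub>g k \<parallel> scalar\<^sub>g k))"
| scalar_discard: "matrix_axiom (scalar\<^sub>g k \<Zsemi> discard\<^sub>g) discard\<^sub>g"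
| add_scalar: "matrix_axiom (add\<^sub>g \<Zsemi> scalar\<^sub>g k) ((scalar\<^sub>g k \<parallel> scalar\<^sub>g k) \<Zsemi> add\<^sub>g)"
| zero_scalar: "matrix_axiom (zero\<^sub>g \<Zsemi> scalar\<^sub>g k) zero\<^sub>g"
| scalar_1: "matrix_axiom (scalar\<^sub>g 1) wire"
| scalar_mult: "matrix_axiom (scalar\<^sub>g k \<Zsemi> scalar\<^sub>g l) (scalar\<^sub>g (l * k))"
| scalar_0: "matrix_axiom (scalar\<^sub>g 0) (discard\<^sub>g \<Zsemi> zero\<^sub>g)"
| scalar_add: "matrix_axiom (scalar\<^sub>g (k + l)) (copy\<^sub>g \<Zsemi> (scalar\<^sub>g k \<parallel> scalar\<^sub>g l) \<Zsemi> add\<^sub>g)"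

text \<open>Linear relations: matrices, their mirror images, two extraspecial Frobenius structures whose
  cups and caps agree up to the antipode, and invertibility of nonzero scalars.\<close>

inductive linear_axiom :: "gqa_gen diagram \<Rightarrow> gqa_gen diagram \<Rightarrow> bool" where
  matrix: "matrix_axiom s t \<Longrightarrow> linear_axiom s t"
| comatrix: "matrix_axiom s t \<Longrightarrow> linear_axiom (mirror s) (mirror t)"
| copy_frobenius_left:
    "linear_axiom ((copy\<^sub>g \<parallel> wire) \<Zsemi> (wire \<parallel> cocopy\<^sub>g)) (cocopy\<^sub>g \<Zsemi> copy\<^sub>g)"
| copy_frobenius_right:
    "linear_axiom ((wire \<parallel> copy\<^sub>g) \<Zsemi> (cocopy\<^sub>g \<parallel> wire)) (cocopy\<^sub>g \<Zsemi> copy\<^sub>g)"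
| copy_special: "linear_axiom (copy\<^sub>g \<Zsemi> cocopy\<^sub>g) wire"
| copy_bone: "linear_axiom (codiscard\<^sub>g \<Zsemi> discard\<^sub>g) empty_diagram"
| add_frobenius_left:
    "linear_axiom ((coadd\<^sub>g \<parallel> wire) \<Zsemi> (wire \<parallel> add\<^sub>g)) (add\<^sub>g \<Zsemi> coadd\<^sub>g)"
| add_frobenius_right:
    "linear_axiom ((wire \<parallel> coadd\<^sub>g) \<Zsemi> (add\<^sub>g \<parallel> wire)) (add\<^sub>g \<Zsemi> coadd\<^sub>g)"
| add_special: "linear_axiom (coadd\<^sub>g \<Zsemi> add\<^sub>g) wire"
| add_bone: "linear_axiom (zero\<^sub>g \<Zsemi> cozero\<^sub>g) empty_diagram"
| antipode_cup: "linear_axiom (zero\<^sub>g \<Zsemi> coadd\<^sub>g) (cup \<Zsemi> (wire \<parallel> scalar\<^sub>g (-1)))"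
| antipode_cap: "linear_axiom (add\<^sub>g \<Zsemi> cozero\<^sub>g) ((wire \<parallel> scalar\<^sub>g (-1)) \<Zsemi> cap)"
| scalar_inverse: "k \<noteq> 0 \<Longrightarrow> linear_axiom (scalar\<^sub>g k \<Zsemi> coscalar k) wire"
| scalar_coinverse: "k \<noteq> 0 \<Longrightarrow> linear_axiom (coscalar k \<Zsemi> scalar\<^sub>g k) wire"

inductive affine_axiom :: "gqa_gen diagram \<Rightarrow> gqa_gen diagram \<Rightarrow> bool" where
  linear: "linear_axiom s t \<Longrightarrow> affine_axiom s t"
| one_copy: "affine_axiom (one\<^sub>g \<Zsemi> copy\<^sub>g) (one\<^sub>g \<parallel> one\<^sub>g)"
| one_discard: "affine_axiom (one\<^sub>g \<Zsemi> discard\<^sub>g) empty_diagram"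
| one_cozero: "affine_axiom ((one\<^sub>g \<Zsemi> cozero\<^sub>g) \<parallel> wire) ((one\<^sub>g \<Zsemi> cozero\<^sub>g) \<parallel> (discard\<^sub>g \<Zsemi> codiscard\<^sub>g))"

definition rotation :: "real \<Rightarrow> gqa_gen diagram" where
  "rotation \<phi> = (copy\<^sub>g \<parallel> copy\<^sub>g) \<Zsemi> (wire \<parallel> Swap 1 1 \<parallel> wire)
     \<Zsemi> (scalar\<^sub>g (cos \<phi>) \<parallel> scalar\<^sub>g (- sin \<phi>) \<parallel> scalar\<^sub>g (sin \<phi>) \<parallel> scalar\<^sub>g (cos \<phi>))
     \<Zsemi> (add\<^sub>g \<parallel> add\<^sub>g)"

inductive gqa_axiom :: "gqa_gen diagram \<Rightarrow> gqa_gen diagram \<Rightarrow> bool" where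
  affine: "affine_axiom s t \<Longrightarrow> gqa_axiom s t"
| D: "gqa_axiom (nu\<^sub>g \<Zsemi> discard\<^sub>g) empty_diagram"
| Z: "gqa_axiom (nu\<^sub>g \<Zsemi> cozero\<^sub>g) empty_diagram"
| RI: "gqa_axiom ((nu\<^sub>g \<parallel> nu\<^sub>g) \<Zsemi> rotation \<phi>) (nu\<^sub>g \<parallel> nu\<^sub>g)"

definition GQA :: "gqa_gen diagram set prop_struct" where
  "GQA = presented_prop gqa_sig gqa_axiom"


section \<open>Quadratic relations\<close>

definition holds :: "bool \<Rightarrow> ennreal" where
  "holds \<phi> = (if \<phi> then 0 else \<infinity>)"

text \<open>As usual for affine relations, the empty set is an affine subspace: it arises already by
  composing the constant one with the mirrored zero.\<close>

definition affine_subspace :: "nat \<Rightarrow> real vec set \<Rightarrow> bool" where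
  "affine_subspace n M \<longleftrightarrow> M \<subseteq> carrier_vec n \<and>
     (\<forall>x\<in>M. \<forall>y\<in>M. \<forall>a b. a + b = 1 \<longrightarrow> a \<cdot>\<^sub>v x + b \<cdot>\<^sub>v y \<in> M)"

definition partial_quadratic :: "nat \<Rightarrow> (real vec \<Rightarrow> ereal) \<Rightarrow> bool" where
  "partial_quadratic n f \<longleftrightarrow>
     (\<exists>S\<in>carrier_mat n n. \<exists>b\<in>carrier_vec n. \<exists>c. \<exists>M.
        transpose_mat S = S \<and> affine_subspace n M \<and>
        (\<forall>x\<in>carrier_vec n. f x = ereal (x \<bullet> (S *\<^sub>v x) + b \<bullet> x + c) + enn2ereal (holds (x \<in> M))))"

type_synonym qfun = "real vec \<times> real vec \<Rightarrow> ennreal"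

text \<open>A function on the product of the spaces of dimensions \<open>m\<close> and \<open>n\<close> is represented
  extensionally, that is, it is \<open>undefined\<close> off that product. Its quadratic form lives on
  the space of concatenated vectors.\<close>

abbreviation points :: "nat \<Rightarrow> nat \<Rightarrow> (real vec \<times> real vec) set" where
  "points m n \<equiv> carrier_vec m \<times> carrier_vec n"

definition quad_hom :: "nat \<Rightarrow> nat \<Rightarrow> qfun set" where
  "quad_hom m n = {F \<in> extensional (points m n).
     partial_quadratic (m + n) (\<lambda>z. enn2ereal (F (vec_first z m, vec_last z n)))}"

definition QuadRel :: "qfun prop_struct" where
  "QuadRel = \<lparr>
     p_hom = quad_hom,
     p_id = (\<lambda>n. \<lambda>(x, y)\<in>points n n. holds (x = y)),
     p_comp = (\<lambda>l m n F G. \<lambda>(x, z)\<in>points l n. INF y\<in>carrier_vec m. F (x, y) + G (y, z)),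
     p_tens = (\<lambda>m n m' n' F G. \<lambda>(x, y)\<in>points (m + m') (n + n').
        F (vec_first x m, vec_first y n) + G (vec_last x m', vec_last y n')),
     p_sym = (\<lambda>m n. \<lambda>(x, y)\<in>points (m + n) (n + m). holds (y = vec_last x n @\<^sub>v vec_first x m))\<rparr>"

primrec gen_interp :: "gqa_gen \<Rightarrow> qfun" where
  "gen_interp Copy = (\<lambda>(x, y)\<in>points 1 2. holds (x $ 0 = y $ 0 \<and> x $ 0 = y $ 1))"
| "gen_interp Discard = (\<lambda>(x, y)\<in>points 1 0. 0)"
| "gen_interp Add = (\<lambda>(x, y)\<in>points 2 1. holds (y $ 0 = x $ 0 + x $ 1))"
| "gen_interp Zero = (\<lambda>(x, y)\<in>points 0 1. holds (y $ 0 = 0))"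
| "gen_interp (Scalar k) = (\<lambda>(x, y)\<in>points 1 1. holds (y $ 0 = k * x $ 0))"
| "gen_interp One = (\<lambda>(x, y)\<in>points 0 1. holds (y $ 0 = 1))"
| "gen_interp Nu = (\<lambda>(x, y)\<in>points 0 1. ennreal (1 / 2 * (y $ 0)\<^sup>2))"
| "gen_interp CoCopy = (\<lambda>(x, y)\<in>points 2 1. holds (y $ 0 = x $ 0 \<and> y $ 0 = x $ 1))"
| "gen_interp CoDiscard = (\<lambda>(x, y)\<in>points 0 1. 0)"
| "gen_interp CoAdd = (\<lambda>(x, y)\<in>points 1 2. holds (x $ 0 = y $ 0 + y $ 1))"
| "gen_interp CoZero = (\<lambda>(x, y)\<in>points 1 0. holds (x $ 0 = 0))"

definition gqa_class :: "gqa_gen diagram \<Rightarrow> gqa_gen diagram set" where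
  "gqa_class t = diag_rel gqa_sig gqa_axiom (src gqa_sig t) (tgt gqa_sig t) `` {t}"

definition gqa_interp :: "nat \<Rightarrow> nat \<Rightarrow> gqa_gen diagram set \<Rightarrow> qfun" where
  "gqa_interp = interpretation_map gqa_sig QuadRel gen_interp"

end

theory Submission
  imports Defs
begin

text \<open>
  Bending outputs into inputs reduces everything to effects \<open>p \<rightarrow> 0\<close>. Copying turns these into a
  commutative monoid, generated by the constraints \<open>r \<bullet> x = 0\<close> and the costs \<open>(r \<bullet> x)\<^sup>2 / 2\<close> of
  linear forms. Adding multiples of a constraint to the other rows, or rotating pairs of costs by
  (RI), clears the last variable from all rows but one. That row can then be eliminated: a
  constraint by substitution, a cost by (D), and (Z) removes the cost of the zero form. Hence hidden
  variables can be discharged and every effect is a conjunction of rows. The same elimination gives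
  completeness by induction on the number of variables: the weight determines the coefficient of
  the last variable in the remaining row, and its other coefficients up to a form that vanishes
  wherever the rest is finite, which the induction hypothesis allows to be added for free.

  The constant one becomes an additional variable. Since the weights are homogeneous, their values
  at height one determine them at every nonzero height, and the parallelogram law extends this to
  height zero unless the value at height one is everywhere infinite; in that case the constraint
  \<open>1 = 0\<close> makes all diagrams of one type equal. Fullness is completion of squares along the last
  variable, and closure of the partial quadratic functions under composition is then read off the
  normal form.
\<close>

section \<open>Arrows of the presented prop\<close>

text \<open>(RI) speaks of two states \<open>nu\<close> fed into a rotation matrix, whereas
  elimination has to rotate the costs of two arbitrary linear forms. The bridge is to read a cost as
  a constraint with one hidden input, r \<bullet> x = t with t supplied by \<open>nu\<close>:
  rotating two such inputs changes only the coefficients of the inputs, and recombining the two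
  constraints moves this change over to the forms. The semantic side has an obstacle of its own.
  \<open>QuadRel\<close> cannot be used as a prop before the quadratic functions are known to be
  closed under composition, and that closure is itself deduced from diagrams. Soundness is therefore
  proved in the larger prop \<open>AllRel\<close> of all weight functions, where the laws hold
  without any condition on the shape of the functions. Rows are homogeneous, so a list of rows is
  always consistent at the origin. Inconsistency can only appear once the constant is plugged in,
  which is why infinite weights need a separate argument there.\<close>

lemma diag_eq_diagrams:
  "diag_eq \<sigma> E m n s t \<Longrightarrow> s \<in> diagrams \<sigma> m n \<and> t \<in> diagrams \<sigma> m n"
  by (induction rule: diag_eq.induct) (auto simp: diagrams_def)

abbreviation gqa_eq :: "nat \<Rightarrow> nat \<Rightarrow> gqa_gen diagram \<Rightarrow> gqa_gen diagram \<Rightarrow> bool" where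
  "gqa_eq \<equiv> diag_eq gqa_sig gqa_axiom"

text \<open>All ill-typed diagrams are collapsed to a single junk arrow. Composition is then total, and
  associativity and the monoidal laws hold without typing hypotheses.\<close>

definition arr_rel :: "gqa_gen diagram \<Rightarrow> gqa_gen diagram \<Rightarrow> bool" where
  "arr_rel s t \<longleftrightarrow> \<not> composable gqa_sig s \<and> \<not> composable gqa_sig t \<or>
     gqa_eq (src gqa_sig s) (tgt gqa_sig s) s t"

lemma arr_rel_cases:
  assumes "arr_rel s t"
  obtains "\<not> composable gqa_sig s" "\<not> composable gqa_sig t"
  | "composable gqa_sig s" "composable gqa_sig t" "src gqa_sig t = src gqa_sig s"
    "tgt gqa_sig t = tgt gqa_sig s" "gqa_eq (src gqa_sig s) (tgt gqa_sig s) s t"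
proof (cases "\<not> composable gqa_sig s \<and> \<not> composable gqa_sig t")
  case False
  with assms have *: "gqa_eq (src gqa_sig s) (tgt gqa_sig s) s t" by (auto simp: arr_rel_def)
  from diag_eq_diagrams[OF *] show ?thesis by (intro that(2) *) (auto simp: diagrams_def)
qed (use that in blast)

lemma arr_relI: "gqa_eq m n s t \<Longrightarrow> arr_rel s t"
  using diag_eq_diagrams[of gqa_sig gqa_axiom m n s t] by (auto simp: arr_rel_def diagrams_def)

lemma arr_relI':
  assumes "composable gqa_sig s \<longleftrightarrow> composable gqa_sig t"
    and "composable gqa_sig s \<Longrightarrow> composable gqa_sig t \<Longrightarrow>
      gqa_eq (src gqa_sig s) (tgt gqa_sig s) s t"
  shows "arr_rel s t"
  using assms by (auto simp: arr_rel_def)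

lemma arr_rel_equivp: "equivp arr_rel"
proof (rule equivpI)
  show "reflp arr_rel"
    by (rule reflpI, rule arr_relI') (auto intro!: eq_refl simp: diagrams_def)
  show "symp arr_rel"
    by (rule sympI, erule arr_rel_cases) (auto simp: arr_rel_def intro: eq_sym)
  show "transp arr_rel"
    by (rule transpI, erule arr_rel_cases; erule arr_rel_cases)
      (auto simp: arr_rel_def intro: eq_trans)
qed

quotient_type arr = "gqa_gen diagram" / arr_rel
  by (rule arr_rel_equivp)

lift_definition cmp :: "arr \<Rightarrow> arr \<Rightarrow> arr" (infixl \<open>\<Zcomp>\<close> 60) is Seq
  by (elim arr_rel_cases; rule arr_relI') (auto intro!: eq_Seq)

lift_definition ten :: "arr \<Rightarrow> arr \<Rightarrow> arr" (infixr \<open>\<boxtimes>\<close> 65) is Par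
  by (elim arr_rel_cases; rule arr_relI') (auto intro!: eq_Par)

lift_definition idn :: "nat \<Rightarrow> arr" is Wires .
lift_definition sw :: "nat \<Rightarrow> nat \<Rightarrow> arr" is Swap .
lift_definition gen :: "gqa_gen \<Rightarrow> arr" is Gen .

lift_definition ok :: "arr \<Rightarrow> bool" is "composable gqa_sig"
  by (auto elim: arr_rel_cases)

lift_definition dm :: "arr \<Rightarrow> nat" is "\<lambda>t. if composable gqa_sig t then src gqa_sig t else 0"
  by (auto elim: arr_rel_cases)

lift_definition cd :: "arr \<Rightarrow> nat" is "\<lambda>t. if composable gqa_sig t then tgt gqa_sig t else 0"
  by (auto elim: arr_rel_cases)

lemma ok_simps [simp]:
  "ok (idn n)" "ok (sw m n)" "ok (gen c)"
  "ok (f \<boxtimes> g) \<longleftrightarrow> ok f \<and> ok g"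
  by (transfer; simp)+

lemma ok_cmp [simp]: "ok (f \<Zcomp> g) \<longleftrightarrow> ok f \<and> ok g \<and> cd f = dm g"
  by transfer auto

lemma dm_cd_simps [simp]:
  "dm (idn n) = n" "cd (idn n) = n" "dm (sw m n) = m + n" "cd (sw m n) = n + m"
  "dm (gen g) = fst (gqa_sig g)" "cd (gen g) = snd (gqa_sig g)"
  by (transfer; simp)+

lemma dm_cd_ok [simp]:
  "ok f \<Longrightarrow> ok g \<Longrightarrow> dm (f \<boxtimes> g) = dm f + dm g"
  "ok f \<Longrightarrow> ok g \<Longrightarrow> cd (f \<boxtimes> g) = cd f + cd g"
  "ok f \<Longrightarrow> ok g \<Longrightarrow> cd f = dm g \<Longrightarrow> dm (f \<Zcomp> g) = dm f"
  "ok f \<Longrightarrow> ok g \<Longrightarrow> cd f = dm g \<Longrightarrow> cd (f \<Zcomp> g) = cd g"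
  by (transfer; auto)+

lemma cmp_assoc: "(f \<Zcomp> g) \<Zcomp> h = f \<Zcomp> (g \<Zcomp> h)"
  by transfer (rule arr_relI'; auto intro!: eq_Seq_assoc simp: diagrams_def)

lemma ten_assoc: "(f \<boxtimes> g) \<boxtimes> h = f \<boxtimes> (g \<boxtimes> h)"
  by transfer (rule arr_relI'; auto intro!: eq_Par_assoc simp: diagrams_def)

lemma idn_cmp [simp]: "dm f = m \<Longrightarrow> idn m \<Zcomp> f = f"
  by transfer (rule arr_relI'; auto intro!: eq_id_left simp: diagrams_def split: if_splits)

lemma cmp_idn [simp]: "cd f = n \<Longrightarrow> f \<Zcomp> idn n = f"
  by transfer (rule arr_relI'; auto intro!: eq_id_right simp: diagrams_def split: if_splits)

lemma idn_ten [simp]: "idn 0 \<boxtimes> f = f"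
  by transfer (rule arr_relI'; auto intro!: eq_unit_left simp: diagrams_def)

lemma ten_idn [simp]: "f \<boxtimes> idn 0 = f"
  by transfer (rule arr_relI'; auto intro!: eq_unit_right simp: diagrams_def)

lemma idn_ten_idn: "idn m \<boxtimes> idn n = idn (m + n)"
  by transfer (rule arr_relI'; auto intro!: eq_Par_id simp: diagrams_def)

lemma interchange:
  "cd f = dm g \<Longrightarrow> cd f' = dm g' \<Longrightarrow> (f \<boxtimes> f') \<Zcomp> (g \<boxtimes> g') = (f \<Zcomp> g) \<boxtimes> (f' \<Zcomp> g')"
  by transfer (rule arr_relI'; auto intro!: eq_sym[OF eq_interchange] simp: diagrams_def split: if_splits)

lemma sw_natural:
  "dm f = m \<Longrightarrow> cd f = n \<Longrightarrow> dm g = m' \<Longrightarrow> cd g = n' \<Longrightarrow>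
    (f \<boxtimes> g) \<Zcomp> sw n n' = sw m m' \<Zcomp> (g \<boxtimes> f)"
  by transfer (rule arr_relI'; auto intro!: eq_Swap_natural simp: diagrams_def split: if_splits)

lemma sw_inverse [simp]: "sw m n \<Zcomp> sw n m = idn (m + n)"
  by transfer (rule arr_relI', auto intro!: eq_Swap_inverse simp: diagrams_def)

lemma sw_0_right [simp]: "sw n 0 = idn n"
  by transfer (rule arr_relI', auto intro!: eq_Swap_unit simp: diagrams_def)

lemma sw_add_left: "sw (l + m) n = (idn l \<boxtimes> sw m n) \<Zcomp> (sw l n \<boxtimes> idn m)"
  by transfer (rule arr_relI', auto intro!: eq_Swap_hexagon[unfolded add.assoc] simp: diagrams_def add.assoc)

lemma gqa_axiom_arr: "gqa_axiom s t \<Longrightarrow> composable gqa_sig s \<Longrightarrow> composable gqa_sig t \<Longrightarrow>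
  src gqa_sig s = src gqa_sig t \<Longrightarrow> tgt gqa_sig s = tgt gqa_sig t \<Longrightarrow> abs_arr s = abs_arr t"
  unfolding arr.abs_eq_iff
  by (rule arr_relI[of "src gqa_sig t" "tgt gqa_sig t"], rule eq_axiom) (auto simp: diagrams_def)

lemma abs_arr_simps:
  "abs_arr (s \<Zsemi> t) = abs_arr s \<Zcomp> abs_arr t" "abs_arr (s \<parallel> t) = abs_arr s \<boxtimes> abs_arr t"
  "abs_arr (Wires n) = idn n" "abs_arr (Swap m n) = sw m n" "abs_arr (Gen g) = gen g"
  by (simp_all add: cmp.abs_eq ten.abs_eq idn.abs_eq sw.abs_eq gen.abs_eq)

section \<open>Whiskering and the comonoid on several wires\<close>

text \<open>\<open>gqa_sig\<close> gives arities as the numeral 2, while adding wires yields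
  successors; this rewriting puts both into one form throughout the diagrammatic part.\<close>

declare numeral_2_eq_2 [simp]

text \<open>By interchange every tensor is a composite of layers in which a single arrow acts
  between idle wires. In that form a diagram is a sequence of layers, and rearranging it is repeated
  use of \<open>exchange\<close>.\<close>

definition wh :: "nat \<Rightarrow> arr \<Rightarrow> nat \<Rightarrow> arr" where
  "wh j f k = idn j \<boxtimes> f \<boxtimes> idn k"

lemma ok_wh [simp]: "ok (wh j f k) \<longleftrightarrow> ok f"
  by (simp add: wh_def)

lemma dm_cd_wh [simp]: "ok f \<Longrightarrow> dm (wh j f k) = j + dm f + k" "ok f \<Longrightarrow> cd (wh j f k) = j + cd f + k"
  by (simp_all add: wh_def)

lemma ten_cmp_right: "cd X = dm Y \<Longrightarrow> (X \<Zcomp> Y) \<boxtimes> Z = (X \<boxtimes> Z) \<Zcomp> (Y \<boxtimes> idn (cd Z))"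
  by (simp add: interchange)

lemma ten_cmp_left: "cd X = dm Y \<Longrightarrow> Z \<boxtimes> (X \<Zcomp> Y) = (Z \<boxtimes> X) \<Zcomp> (idn (cd Z) \<boxtimes> Y)"
  by (simp add: interchange)

lemma wh_0 [simp]: "wh 0 f 0 = f"
  by (simp add: wh_def)

lemma wh_idn [simp]: "wh i (idn j) k = idn (i + j + k)"
  by (simp add: wh_def idn_ten_idn add.assoc)

lemma wh_wh: "wh i (wh j f k) l = wh (i + j) f (k + l)"
  by (simp add: wh_def idn_ten_idn[symmetric] ten_assoc)

lemma not_ok_eq: "\<not> ok f \<Longrightarrow> \<not> ok g \<Longrightarrow> f = g"
  by transfer (simp add: arr_rel_def)

lemma wh_cmp: "cd f = dm g \<Longrightarrow> wh j (f \<Zcomp> g) k = wh j f k \<Zcomp> wh j g k"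
  by (cases "ok f \<and> ok g") (auto simp: wh_def interchange cmp_assoc intro!: not_ok_eq)

lemma idn_ten_wh: "idn i \<boxtimes> f = wh i f 0" by (simp add: wh_def)
lemma ten_idn_wh: "f \<boxtimes> idn k = wh 0 f k" by (simp add: wh_def)

lemma ten_wh: "f \<boxtimes> g = wh 0 f (dm g) \<Zcomp> wh (cd f) g 0"
  by (simp add: wh_def interchange)

lemma ten_wh': "f \<boxtimes> g = wh (dm f) g 0 \<Zcomp> wh 0 f (cd g)"
  by (simp add: wh_def interchange)

text \<open>Two arrows separated by \<open>k\<close> idle wires act independently. The widths are
  variables tied by equations, so that the rule applies however the sums of arities happen to be
  written.\<close>

lemma exchange:
  assumes "ok f" "ok g" "a = k + dm g + l" "b = j + cd f + k" "c = j + dm f + k" "d = k + cd g + l"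
  shows "wh j f a \<Zcomp> wh b g l = wh c g l \<Zcomp> wh j f d"
proof -
  have "wh j f a \<Zcomp> wh b g l = wh j (wh 0 f (k + dm g) \<Zcomp> wh (cd f + k) g 0) l"
    using assms by (simp add: wh_cmp wh_wh add.assoc)
  also have "wh 0 f (k + dm g) \<Zcomp> wh (cd f + k) g 0 = f \<boxtimes> wh k g 0"
    using assms by (simp add: ten_wh wh_wh)
  also have "\<dots> = wh (dm f + k) g 0 \<Zcomp> wh 0 f (k + cd g)"
    using assms by (simp add: ten_wh' wh_wh)
  finally show ?thesis
    using assms by (simp add: wh_cmp wh_wh add.assoc)
qed

lemma sw_0_left [simp]: "sw 0 n = idn n"
  using sw_inverse[of 0 n] by simp

text \<open>Only the hexagon that splits the first argument is a law of props. This one follows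
  because both sides are inverse to \<open>sw (m + n) l\<close>.\<close>

lemma sw_add_right: "sw l (m + n) = (sw l m \<boxtimes> idn n) \<Zcomp> (idn m \<boxtimes> sw l n)" (is "_ = ?X")
proof -
  have "sw (m + n) l \<Zcomp> ?X = (idn m \<boxtimes> sw n l) \<Zcomp> (((sw m l \<boxtimes> idn n) \<Zcomp> (sw l m \<boxtimes> idn n)) \<Zcomp> (idn m \<boxtimes> sw l n))"
    by (simp add: sw_add_left cmp_assoc)
  also have "\<dots> = idn (m + n + l)"
    by (simp add: interchange idn_ten_idn add_ac)
  finally have "sw l (m + n) \<Zcomp> (sw (m + n) l \<Zcomp> ?X) = sw l (m + n)"
    by (simp add: add_ac)
  then show ?thesis
    by (simp add: cmp_assoc[symmetric])
qed

lemma sw_natural_left: "ok f \<Longrightarrow> dm f = m \<Longrightarrow> cd f = n \<Longrightarrow>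
    wh 0 f k \<Zcomp> sw n k = sw m k \<Zcomp> wh k f 0"
  using sw_natural[of f m n "idn k" k k] by (simp add: wh_def)

lemma sw_natural_right: "ok f \<Longrightarrow> dm f = m \<Longrightarrow> cd f = n \<Longrightarrow>
    wh k f 0 \<Zcomp> sw k n = sw k m \<Zcomp> wh 0 f k"
  using sw_natural[of "idn k" k k f m n] by (simp add: wh_def)

lemma sw_add_add:
  "sw (a + b) (c + d) = wh a (sw b c) d \<Zcomp> ((sw a c \<boxtimes> sw b d) \<Zcomp> wh c (sw a d) b)"
proof -
  have "sw (a + b) (c + d) = wh a (sw b c) d \<Zcomp> (wh (a + c) (sw b d) 0 \<Zcomp> (wh 0 (sw a c) (d + b) \<Zcomp> wh c (sw a d) b))"
    by (simp add: sw_add_left[of a b] sw_add_right[of a c d] sw_add_right[of b c d] idn_ten_wh ten_idn_wh wh_cmp wh_wh cmp_assoc)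
  moreover have "sw a c \<boxtimes> sw b d = wh (a + c) (sw b d) 0 \<Zcomp> wh 0 (sw a c) (d + b)"
    by (simp add: ten_wh')
  ultimately show ?thesis by (simp add: cmp_assoc)
qed

abbreviation "cp \<equiv> gen Copy"
abbreviation "dl \<equiv> gen Discard"
abbreviation "ad \<equiv> gen Add"
abbreviation "ze \<equiv> gen Zero"
abbreviation "sc k \<equiv> gen (Scalar k)"
abbreviation "on \<equiv> gen One"
abbreviation "nu \<equiv> gen Nu"
abbreviation "ccp \<equiv> gen CoCopy"
abbreviation "cdl \<equiv> gen CoDiscard"
abbreviation "cad \<equiv> gen CoAdd"
abbreviation "cze \<equiv> gen CoZero"

section \<open>Copying and discarding several wires at once\<close>

primrec del :: "nat \<Rightarrow> arr" where
  "del 0 = idn 0"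
| "del (Suc n) = del n \<boxtimes> dl"

text \<open>The tensor delivers x x a a; the crossing reorders this to x a x a.\<close>

primrec dup :: "nat \<Rightarrow> arr" where
  "dup 0 = idn 0"
| "dup (Suc n) = (dup n \<boxtimes> cp) \<Zcomp> wh n (sw n 1) 1"

lemma ok_del [simp]: "ok (del n)" and dm_del [simp]: "dm (del n) = n" and cd_del [simp]: "cd (del n) = 0"
  by (induction n) simp_all

lemma ok_dup_aux: "ok (dup n) \<and> dm (dup n) = n \<and> cd (dup n) = n + n"
  by (induction n) simp_all

lemma ok_dup [simp]: "ok (dup n)" "dm (dup n) = n" "cd (dup n) = n + n"
  using ok_dup_aux by simp_all

lemma del_1 [simp]: "del (Suc 0) = dl"
  by simp

lemma dup_1 [simp]: "dup (Suc 0) = cp"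
  by simp

lemma del_add: "del (m + n) = del m \<boxtimes> del n"
  by (induction n) (simp_all add: ten_assoc)

lemma dup_add: "dup (m + n) = (dup m \<boxtimes> dup n) \<Zcomp> wh m (sw m n) n"
proof (induction n)
  case 0
  then show ?case by (simp add: add_ac)
next
  case (Suc n)
  let ?D = "dup m \<boxtimes> dup n \<boxtimes> cp"
  have "dup (m + Suc n) = (((dup m \<boxtimes> dup n) \<Zcomp> wh m (sw m n) n) \<boxtimes> cp) \<Zcomp> wh (m + n) (sw (m + n) 1) 1"
    by (simp add: Suc)
  also have "\<dots> = ?D \<Zcomp> (wh m (sw m n) (n + 2) \<Zcomp> (wh (m + n + m) (sw n 1) 1 \<Zcomp> wh (m + n) (sw m 1) (n + 1)))"
    by (simp add: sw_add_left[of m n] ten_cmp_right ten_assoc cmp_assoc ten_idn_wh idn_ten_wh wh_wh wh_cmp)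
  also have "\<dots> = ?D \<Zcomp> (wh (m + m + n) (sw n 1) 1 \<Zcomp> (wh m (sw m n) (n + 2) \<Zcomp> wh (m + n) (sw m 1) (n + 1)))"
    using exchange[of "sw m n" "sw n 1" "n + 2" 0 1 "m + n + m" m "m + m + n" "n + 2"]
    by (simp add: cmp_assoc[symmetric])
  also have "\<dots> = (dup m \<boxtimes> dup (Suc n)) \<Zcomp> wh m (sw m (n + 1)) (Suc n)"
    by (simp only: sw_add_right[of m n] dup.simps)
      (simp add: ten_cmp_left ten_assoc cmp_assoc ten_idn_wh idn_ten_wh wh_wh wh_cmp add_ac)
  finally show ?case by simp
qed

lemma dup_comm: "dup n \<Zcomp> sw n n = dup n"
proof (induction n)
  case (Suc n)
  have cp: "cp \<Zcomp> sw 1 1 = cp"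
    using gqa_axiom_arr[OF gqa_axiom.affine[OF affine_axiom.linear[OF linear_axiom.matrix[OF copy_comm]]]]
    by (simp add: abs_arr_simps)
  have "dup (Suc n) \<Zcomp> sw (n + 1) (n + 1) =
    (dup n \<boxtimes> cp) \<Zcomp> ((wh n (sw n 1) 1 \<Zcomp> wh n (sw 1 n) 1) \<Zcomp> ((sw n n \<boxtimes> sw 1 1) \<Zcomp> wh n (sw n 1) 1))"
    by (simp only: sw_add_add dup.simps cmp_assoc)
  also have "wh n (sw n 1) 1 \<Zcomp> wh n (sw 1 n) 1 = idn (n + n + 2)"
    by (simp add: wh_cmp[symmetric])
  also have "(dup n \<boxtimes> cp) \<Zcomp> (idn (n + n + 2) \<Zcomp> ((sw n n \<boxtimes> sw 1 1) \<Zcomp> wh n (sw n 1) 1)) =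
    ((dup n \<Zcomp> sw n n) \<boxtimes> (cp \<Zcomp> sw 1 1)) \<Zcomp> wh n (sw n 1) 1"
    by (simp add: cmp_assoc[symmetric] interchange)
  finally show ?case by (simp only: Suc cp) simp
qed simp

lemma dup_del_left: "dup n \<Zcomp> (del n \<boxtimes> idn n) = idn n"
proof (induction n)
  case (Suc n)
  have cp: "cp \<Zcomp> (dl \<boxtimes> idn 1) = idn 1"
    using gqa_axiom_arr[OF gqa_axiom.affine[OF affine_axiom.linear[OF linear_axiom.matrix[OF copy_unit]]]]
    by (simp add: abs_arr_simps)
  have "wh n (sw n 1) 1 \<Zcomp> (del (Suc n) \<boxtimes> idn (Suc n)) = wh n (sw n 1) 1 \<Zcomp> (del n \<boxtimes> (dl \<boxtimes> idn n) \<boxtimes> idn 1)"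
    by (simp add: ten_assoc idn_ten_idn)
  also have "\<dots> = del n \<boxtimes> (sw n 1 \<Zcomp> wh 0 dl n) \<boxtimes> idn 1"
    by (simp add: wh_def interchange)
  also have "\<dots> = del n \<boxtimes> (idn n \<boxtimes> dl) \<boxtimes> idn 1"
    using sw_natural_right[of dl 1 0 n] by (simp add: idn_ten_wh)
  finally have "dup (Suc n) \<Zcomp> (del (Suc n) \<boxtimes> idn (Suc n)) = (dup n \<boxtimes> cp) \<Zcomp> ((del n \<boxtimes> idn n) \<boxtimes> (dl \<boxtimes> idn 1))"
    by (simp add: cmp_assoc ten_assoc)
  also have "\<dots> = (dup n \<Zcomp> (del n \<boxtimes> idn n)) \<boxtimes> (cp \<Zcomp> (dl \<boxtimes> idn 1))"
    by (simp add: interchange)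
  also have "\<dots> = idn (Suc n)"
    by (simp only: Suc cp idn_ten_idn) simp
  finally show ?case .
qed simp

lemma dup_del_right: "dup n \<Zcomp> (idn n \<boxtimes> del n) = idn n"
proof -
  have "dup n \<Zcomp> (idn n \<boxtimes> del n) = dup n \<Zcomp> (sw n n \<Zcomp> wh n (del n) 0)"
    by (simp add: cmp_assoc[symmetric] dup_comm idn_ten_wh)
  also have "sw n n \<Zcomp> wh n (del n) 0 = wh 0 (del n) n"
    using sw_natural_left[of "del n" n 0 n] by simp
  finally show ?thesis
    using dup_del_left[of n] by (simp add: wh_def)
qed

lemma dup_assoc: "dup n \<Zcomp> (dup n \<boxtimes> idn n) = dup n \<Zcomp> (idn n \<boxtimes> dup n)"
proof (induction n)
  case (Suc n)
  have cp: "cp \<Zcomp> (cp \<boxtimes> idn 1) = cp \<Zcomp> (idn 1 \<boxtimes> cp)"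
    using gqa_axiom_arr[OF gqa_axiom.affine[OF affine_axiom.linear[OF linear_axiom.matrix[OF copy_assoc]]]]
    by (simp add: abs_arr_simps)
  \<comment> \<open>Both sides reduce to coassociativity on n wires beside coassociativity on one
    wire, followed by crossings. \<open>l1\<close> and \<open>r1\<close> slide the copies through
    the crossings; the crossings left over agree.\<close>
  have l1: "wh n (sw n 1) 1 \<Zcomp> (dup n \<boxtimes> (cp \<boxtimes> idn n) \<boxtimes> idn 1) =
      (dup n \<boxtimes> (idn n \<boxtimes> cp) \<boxtimes> idn 1) \<Zcomp> wh (n + n) (sw n 2) 1"
  proof -
    have "wh n (sw n 1) 1 \<Zcomp> (dup n \<boxtimes> (cp \<boxtimes> idn n) \<boxtimes> idn 1) = dup n \<boxtimes> (sw n 1 \<Zcomp> wh 0 cp n) \<boxtimes> idn 1"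
      by (simp add: wh_def interchange)
    also have "sw n 1 \<Zcomp> wh 0 cp n = wh n cp 0 \<Zcomp> sw n 2"
      using sw_natural_right[of cp 1 2 n] by simp
    finally show ?thesis by (simp add: wh_def interchange)
  qed
  have r1: "wh n (sw n 1) 1 \<Zcomp> (idn n \<boxtimes> (idn 1 \<boxtimes> dup n) \<boxtimes> cp) =
      (idn n \<boxtimes> (dup n \<boxtimes> idn 1) \<boxtimes> cp) \<Zcomp> wh n (sw (n + n) 1) 2"
  proof -
    have "wh n (sw n 1) 1 \<Zcomp> (idn n \<boxtimes> (idn 1 \<boxtimes> dup n) \<boxtimes> cp) = idn n \<boxtimes> (sw n 1 \<Zcomp> wh 1 (dup n) 0) \<boxtimes> cp"
      by (simp add: wh_def interchange)
    also have "sw n 1 \<Zcomp> wh 1 (dup n) 0 = wh 0 (dup n) 1 \<Zcomp> sw (n + n) 1"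
      using sw_natural_left[of "dup n" n "n + n" 1] by simp
    finally show ?thesis by (simp add: wh_def interchange)
  qed
  have "dup (Suc n) \<Zcomp> (dup (Suc n) \<boxtimes> idn (Suc n)) =
      (dup n \<boxtimes> cp) \<Zcomp> ((wh n (sw n 1) 1 \<Zcomp> (dup n \<boxtimes> (cp \<boxtimes> idn n) \<boxtimes> idn 1)) \<Zcomp> wh n (sw n 1) (1 + n + 1))"
  proof -
    have "dup (Suc n) \<boxtimes> idn (Suc n) = (dup n \<boxtimes> (cp \<boxtimes> idn n) \<boxtimes> idn 1) \<Zcomp> wh n (sw n 1) (1 + n + 1)"
      by (simp add: ten_cmp_right ten_assoc idn_ten_idn wh_def)
    then show ?thesis by (simp add: cmp_assoc)
  qed
  also have "\<dots> = (dup n \<boxtimes> cp) \<Zcomp> ((dup n \<boxtimes> (idn n \<boxtimes> cp) \<boxtimes> idn 1) \<Zcomp> (wh (n + n) (sw n 2) 1 \<Zcomp> wh n (sw n 1) (1 + n + 1)))"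
    by (simp only: l1 cmp_assoc)
  also have "\<dots> = ((dup n \<Zcomp> (dup n \<boxtimes> idn n)) \<boxtimes> (cp \<Zcomp> (cp \<boxtimes> idn 1))) \<Zcomp> (wh (n + n) (sw n 2) 1 \<Zcomp> wh n (sw n 1) (1 + n + 1))"
    using interchange[of "dup n" "dup n \<boxtimes> idn n" cp "cp \<boxtimes> idn 1"]
    by (simp add: ten_assoc cmp_assoc[symmetric])
  also have "wh (n + n) (sw n 2) 1 \<Zcomp> wh n (sw n 1) (1 + n + 1) = wh n (sw (n + n) 1) 2 \<Zcomp> wh (n + 1 + n) (sw n 1) 1"
  proof -
    have "wh (n + n) (sw n (1 + 1)) 1 \<Zcomp> wh n (sw n 1) (1 + n + 1) =
      wh (n + n) (sw n 1) 2 \<Zcomp> (wh (n + n + 1) (sw n 1) 1 \<Zcomp> wh n (sw n 1) (1 + n + 1))"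
      by (simp only: sw_add_right) (simp add: ten_idn_wh idn_ten_wh wh_wh wh_cmp cmp_assoc)
    also have "wh (n + n + 1) (sw n 1) 1 \<Zcomp> wh n (sw n 1) (1 + n + 1) =
       wh n (sw n 1) (n + 1 + 1) \<Zcomp> wh (n + 1 + n) (sw n 1) 1"
      using exchange[of "sw n 1" "sw n 1" "n + 1 + 1" 0 1 "n + 1 + n" n "n + n + 1" "1 + n + 1"]
      by simp
    finally show ?thesis
      by (simp add: sw_add_left ten_idn_wh idn_ten_wh wh_wh wh_cmp cmp_assoc)
  qed
  also have "((dup n \<Zcomp> (dup n \<boxtimes> idn n)) \<boxtimes> (cp \<Zcomp> (cp \<boxtimes> idn 1))) \<Zcomp> (wh n (sw (n + n) 1) 2 \<Zcomp> wh (n + 1 + n) (sw n 1) 1) =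
     (dup n \<boxtimes> cp) \<Zcomp> ((idn n \<boxtimes> (dup n \<boxtimes> idn 1) \<boxtimes> cp) \<Zcomp> wh n (sw (n + n) 1) 2 \<Zcomp> wh (n + 1 + n) (sw n 1) 1)"
    using interchange[of "dup n" "idn n \<boxtimes> dup n" cp "idn 1 \<boxtimes> cp"]
    by (simp only: Suc cp) (simp add: ten_assoc cmp_assoc[symmetric])
  also have "\<dots> = (dup n \<boxtimes> cp) \<Zcomp> (wh n (sw n 1) 1 \<Zcomp> (idn n \<boxtimes> (idn 1 \<boxtimes> dup n) \<boxtimes> cp) \<Zcomp> wh (n + 1 + n) (sw n 1) 1)"
    by (simp only: r1)
  also have "\<dots> = dup (Suc n) \<Zcomp> (idn (Suc n) \<boxtimes> dup (Suc n))"
  proof -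
    have "idn (Suc n) \<boxtimes> dup (Suc n) = (idn n \<boxtimes> (idn 1 \<boxtimes> dup n) \<boxtimes> cp) \<Zcomp> wh (n + 1 + n) (sw n 1) 1"
      by (simp add: ten_cmp_left ten_assoc[symmetric] idn_ten_idn wh_def)
    then show ?thesis by (simp add: cmp_assoc)
  qed
  finally show ?case .
qed simp

section \<open>Equations between small diagrams\<close>

abbreviation "W \<equiv> idn (Suc 0)"
abbreviation "sw1 \<equiv> sw (Suc 0) (Suc 0)"

lemma linear_axiom_arr: "linear_axiom s t \<Longrightarrow> composable gqa_sig s \<Longrightarrow> composable gqa_sig t \<Longrightarrow>
  src gqa_sig s = src gqa_sig t \<Longrightarrow> tgt gqa_sig s = tgt gqa_sig t \<Longrightarrow> abs_arr s = abs_arr t"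
  by (rule gqa_axiom_arr[OF gqa_axiom.affine[OF affine_axiom.linear]])

lemmas matrix_axiom_arr = linear_axiom_arr[OF linear_axiom.matrix]
lemmas comatrix_axiom_arr = linear_axiom_arr[OF linear_axiom.comatrix]
lemmas affine_axiom_arr = gqa_axiom_arr[OF gqa_axiom.affine]

lemma ax_matrix:
  "cp \<Zcomp> (cp \<boxtimes> W) = cp \<Zcomp> (W \<boxtimes> cp)"
  "cp \<Zcomp> (dl \<boxtimes> W) = W"
  "cp \<Zcomp> sw1 = cp"
  "(ad \<boxtimes> W) \<Zcomp> ad = (W \<boxtimes> ad) \<Zcomp> ad"
  "(ze \<boxtimes> W) \<Zcomp> ad = W"
  "sw1 \<Zcomp> ad = ad"
  "ad \<Zcomp> cp = (cp \<boxtimes> cp) \<Zcomp> wh 1 sw1 1 \<Zcomp> (ad \<boxtimes> ad)"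
  "ad \<Zcomp> dl = dl \<boxtimes> dl"
  "ze \<Zcomp> cp = ze \<boxtimes> ze"
  "ze \<Zcomp> dl = idn 0"
  "sc k \<Zcomp> cp = cp \<Zcomp> (sc k \<boxtimes> sc k)"
  "sc k \<Zcomp> dl = dl"
  "ad \<Zcomp> sc k = (sc k \<boxtimes> sc k) \<Zcomp> ad"
  "ze \<Zcomp> sc k = ze"
  "sc 1 = W"
  "sc k \<Zcomp> sc l = sc (l * k)"
  "sc 0 = dl \<Zcomp> ze"
  "sc (k + l) = cp \<Zcomp> (sc k \<boxtimes> sc l) \<Zcomp> ad"
  using matrix_axiom_arr[OF copy_assoc] matrix_axiom_arr[OF copy_unit] matrix_axiom_arr[OF copy_comm]
    matrix_axiom_arr[OF add_assoc] matrix_axiom_arr[OF add_unit] matrix_axiom_arr[OF add_comm]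
    matrix_axiom_arr[OF add_copy] matrix_axiom_arr[OF add_discard] matrix_axiom_arr[OF zero_copy]
    matrix_axiom_arr[OF zero_discard] matrix_axiom_arr[OF scalar_copy[of k]] matrix_axiom_arr[OF scalar_discard[of k]]
    matrix_axiom_arr[OF add_scalar[of k]] matrix_axiom_arr[OF zero_scalar[of k]] matrix_axiom_arr[OF scalar_1]
    matrix_axiom_arr[OF scalar_mult[of k l]] matrix_axiom_arr[OF scalar_0] matrix_axiom_arr[OF scalar_add[of k l]]
  by (simp_all add: abs_arr_simps wh_def)

definition cap1 :: arr where "cap1 = ccp \<Zcomp> dl"
definition cup1 :: arr where "cup1 = cdl \<Zcomp> cp"
definition cosc :: "real \<Rightarrow> arr" where
  "cosc k = (cup1 \<boxtimes> W) \<Zcomp> (W \<boxtimes> sc k \<boxtimes> W) \<Zcomp> (W \<boxtimes> cap1)"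
definition cnu :: arr where "cnu = (nu \<boxtimes> W) \<Zcomp> cap1"

lemma types_cap [simp]: "ok cap1" "dm cap1 = 2" "cd cap1 = 0" "ok cup1" "dm cup1 = 0" "cd cup1 = 2"
  by (simp_all add: cap1_def cup1_def)

lemma types_cnu [simp]: "ok cnu" "dm cnu = 1" "cd cnu = 0" "ok (cosc k)" "dm (cosc k) = 1" "cd (cosc k) = 1"
  by (simp_all add: cnu_def cosc_def)

lemma abs_cup_cap: "abs_arr cup = cup1" "abs_arr cap = cap1" "abs_arr (coscalar k) = cosc k"
  by (simp_all add: cup_def cap_def cup1_def cap1_def cosc_def coscalar_def abs_arr_simps)

lemma composable_cup_cap:
  "composable gqa_sig cup" "src gqa_sig cup = 0" "tgt gqa_sig cup = 2"
  "composable gqa_sig cap" "src gqa_sig cap = 2" "tgt gqa_sig cap = 0"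
  "composable gqa_sig (coscalar k)" "src gqa_sig (coscalar k) = 1" "tgt gqa_sig (coscalar k) = 1"
  by (simp_all add: cup_def cap_def coscalar_def)

lemma ax_linear:
  "(cdl \<boxtimes> W) \<Zcomp> ccp = W"
  "sw1 \<Zcomp> ccp = ccp"
  "cad \<Zcomp> (cze \<boxtimes> W) = W"
  "cdl \<Zcomp> cad = cdl \<boxtimes> cdl"
  "ccp \<Zcomp> cze = cze \<boxtimes> cze"
  "cdl \<Zcomp> cze = idn 0"
  "cdl \<Zcomp> cosc k = cdl"
  "(cp \<boxtimes> W) \<Zcomp> (W \<boxtimes> ccp) = ccp \<Zcomp> cp"
  "(W \<boxtimes> cp) \<Zcomp> (ccp \<boxtimes> W) = ccp \<Zcomp> cp"
  "cdl \<Zcomp> dl = idn 0"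
  "(cad \<boxtimes> W) \<Zcomp> (W \<boxtimes> ad) = ad \<Zcomp> cad"
  "(W \<boxtimes> cad) \<Zcomp> (ad \<boxtimes> W) = ad \<Zcomp> cad"
  "ze \<Zcomp> cze = idn 0"
  "ze \<Zcomp> cad = cup1 \<Zcomp> (W \<boxtimes> sc (-1))"
  "ad \<Zcomp> cze = (W \<boxtimes> sc (-1)) \<Zcomp> cap1"
  "k \<noteq> 0 \<Longrightarrow> cosc k \<Zcomp> sc k = W"
  using comatrix_axiom_arr[OF copy_unit] comatrix_axiom_arr[OF copy_comm]
    comatrix_axiom_arr[OF add_unit] comatrix_axiom_arr[OF add_discard]
    comatrix_axiom_arr[OF zero_copy] comatrix_axiom_arr[OF zero_discard]
    comatrix_axiom_arr[OF scalar_discard[of k]]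
    linear_axiom_arr[OF copy_frobenius_left] linear_axiom_arr[OF copy_frobenius_right]
    linear_axiom_arr[OF copy_bone] linear_axiom_arr[OF add_frobenius_left]
    linear_axiom_arr[OF add_frobenius_right] linear_axiom_arr[OF add_bone]
    linear_axiom_arr[OF antipode_cup] linear_axiom_arr[OF antipode_cap]
    linear_axiom_arr[OF scalar_coinverse[of k]]
  by (simp_all add: abs_arr_simps abs_cup_cap composable_cup_cap)

text \<open>The rotation matrix row by row, with one copy of the inputs for each linear form. In
  this shape \<open>lin_scale\<close> and \<open>lin_add\<close> compute its effect on a further
  form.\<close>

definition rot :: "real \<Rightarrow> arr" where
  "rot \<phi> = dup 2 \<Zcomp> (((sc (cos \<phi>) \<boxtimes> sc (- sin \<phi>)) \<Zcomp> ad) \<boxtimes> ((sc (sin \<phi>) \<boxtimes> sc (cos \<phi>)) \<Zcomp> ad))"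

lemma abs_rotation: "abs_arr (rotation \<phi>) = rot \<phi>"
proof -
  have "dup 2 = (cp \<boxtimes> cp) \<Zcomp> wh 1 sw1 1"
    using dup_add[of 1 1] by simp
  then show ?thesis
    using interchange[of "sc (cos \<phi>) \<boxtimes> sc (- sin \<phi>)" ad "sc (sin \<phi>) \<boxtimes> sc (cos \<phi>)" ad]
    by (simp add: rot_def rotation_def abs_arr_simps cmp_assoc ten_assoc wh_def)
qed

lemma ax_affine:
  "on \<Zcomp> cp = on \<boxtimes> on"
  "on \<Zcomp> dl = idn 0"
  "(on \<Zcomp> cze) \<boxtimes> W = (on \<Zcomp> cze) \<boxtimes> (dl \<Zcomp> cdl)"
  "nu \<Zcomp> dl = idn 0"
  "nu \<Zcomp> cze = idn 0"
  "(nu \<boxtimes> nu) \<Zcomp> rot \<phi> = nu \<boxtimes> nu"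
  using affine_axiom_arr[OF one_copy] affine_axiom_arr[OF one_discard] affine_axiom_arr[OF one_cozero]
    gqa_axiom_arr[OF D] gqa_axiom_arr[OF Z] gqa_axiom_arr[OF RI[of \<phi>]]
  by (simp_all add: abs_arr_simps abs_rotation) (simp_all add: rotation_def)

section \<open>Consequences of the Frobenius and antipode laws\<close>

lemma cp_dl_right: "cp \<Zcomp> (W \<boxtimes> dl) = W"
  using dup_del_right[of 1] by simp

lemma ze_ad_right: "(W \<boxtimes> ze) \<Zcomp> ad = W"
proof -
  have "(W \<boxtimes> ze) \<Zcomp> ad = (W \<boxtimes> ze) \<Zcomp> (sw1 \<Zcomp> ad)"
    by (simp add: ax_matrix)
  also have "(W \<boxtimes> ze) \<Zcomp> (sw1 \<Zcomp> ad) = (ze \<boxtimes> W) \<Zcomp> ad"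
    using sw_natural_right[of ze 0 1 1] by (simp add: wh_def cmp_assoc[symmetric])
  finally show ?thesis by (simp add: ax_matrix)
qed

lemma ze_ze_ad: "(ze \<boxtimes> ze) \<Zcomp> ad = ze"
proof -
  have "(ze \<boxtimes> ze) \<Zcomp> ad = ze \<Zcomp> ((ze \<boxtimes> W) \<Zcomp> ad)"
    using ten_wh'[of ze ze] by (simp add: wh_def cmp_assoc)
  then show ?thesis by (simp add: ax_matrix)
qed

lemma cdl_ccp_right: "(W \<boxtimes> cdl) \<Zcomp> ccp = W"
proof -
  have "(W \<boxtimes> cdl) \<Zcomp> ccp = (W \<boxtimes> cdl) \<Zcomp> (sw1 \<Zcomp> ccp)"
    by (simp add: ax_linear)
  also have "\<dots> = (cdl \<boxtimes> W) \<Zcomp> ccp"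
    using sw_natural_right[of cdl 0 1 1] by (simp add: wh_def cmp_assoc[symmetric])
  finally show ?thesis by (simp add: ax_linear)
qed

text \<open>The cup beside the cap contains
  \<open>(W \<boxtimes> cp) \<Zcomp> (ccp \<boxtimes> W)\<close>. The Frobenius law turns this into
  \<open>ccp \<Zcomp> cp\<close>, and a unit law cancels on either side.\<close>

lemma snake: "(W \<boxtimes> cup1) \<Zcomp> (cap1 \<boxtimes> W) = W"
proof -
  have "(W \<boxtimes> cup1) \<Zcomp> (cap1 \<boxtimes> W) = (W \<boxtimes> cdl) \<Zcomp> (((W \<boxtimes> cp) \<Zcomp> (ccp \<boxtimes> W)) \<Zcomp> (dl \<boxtimes> W))"
    by (simp add: cup1_def cap1_def ten_cmp_left ten_cmp_right cmp_assoc)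
  also have "\<dots> = ((W \<boxtimes> cdl) \<Zcomp> ccp) \<Zcomp> (cp \<Zcomp> (dl \<boxtimes> W))"
    by (simp only: ax_linear cmp_assoc)
  also have "\<dots> = W" by (simp add: cdl_ccp_right ax_matrix)
  finally show ?thesis .
qed

text \<open>This equation, \<open>cad_eq\<close> and \<open>nu_eq\<close> reduce the generators
  \<open>ccp\<close>, \<open>cad\<close> and \<open>nu\<close> to linear arrows together with
  \<open>cdl\<close>, \<open>cze\<close> and \<open>cnu\<close>, so that the normal form needs no
  separate argument for them.\<close>

lemma ccp_eq: "ccp = (cp \<boxtimes> W) \<Zcomp> (W \<boxtimes> cap1)"
proof -
  have "(cp \<boxtimes> W) \<Zcomp> (W \<boxtimes> cap1) = ((cp \<boxtimes> W) \<Zcomp> (W \<boxtimes> ccp)) \<Zcomp> (W \<boxtimes> dl)"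
    by (simp add: cap1_def ten_cmp_left cmp_assoc)
  also have "\<dots> = ccp"
    by (simp add: ax_linear cmp_assoc cp_dl_right)
  finally show ?thesis by simp
qed

lemma sc_neg_neg: "sc (-1) \<Zcomp> sc (-1) = W"
  by (simp add: ax_matrix)

lemma cap1_eq: "cap1 = (W \<boxtimes> sc (-1)) \<Zcomp> (ad \<Zcomp> cze)"
proof -
  have "(W \<boxtimes> sc (-1)) \<Zcomp> (ad \<Zcomp> cze) = (W \<boxtimes> (sc (-1) \<Zcomp> sc (-1))) \<Zcomp> cap1"
    by (simp add: ax_linear ten_cmp_left cmp_assoc)
  then show ?thesis by (simp add: sc_neg_neg idn_ten_idn)
qed

lemma cad_eq: "cad = ((cup1 \<Zcomp> (W \<boxtimes> sc (-1))) \<boxtimes> W) \<Zcomp> (W \<boxtimes> ad)"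
proof -
  have "((cup1 \<Zcomp> (W \<boxtimes> sc (-1))) \<boxtimes> W) \<Zcomp> (W \<boxtimes> ad) = (ze \<boxtimes> W) \<Zcomp> ((cad \<boxtimes> W) \<Zcomp> (W \<boxtimes> ad))"
    by (simp add: ax_linear(14)[symmetric] ten_cmp_right cmp_assoc)
  also have "\<dots> = ((ze \<boxtimes> W) \<Zcomp> ad) \<Zcomp> cad" by (simp only: ax_linear cmp_assoc)
  finally show ?thesis by (simp add: ax_matrix)
qed

lemma nu_eq: "nu = cup1 \<Zcomp> (cnu \<boxtimes> W)"
proof -
  have "cup1 \<Zcomp> (cnu \<boxtimes> W) = (cup1 \<Zcomp> wh 0 nu 2) \<Zcomp> (cap1 \<boxtimes> W)"
    by (simp add: cnu_def ten_cmp_right cmp_assoc wh_def ten_assoc idn_ten_idn)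
  also have "cup1 \<Zcomp> wh 0 nu 2 = nu \<Zcomp> (W \<boxtimes> cup1)"
    using ten_wh[of nu cup1] ten_wh'[of nu cup1] by (simp add: wh_def)
  finally show ?thesis by (simp add: cmp_assoc snake)
qed

text \<open>The two cups differ only by the antipode \<open>sc (-1)\<close>, which squares to the
  identity. On the additive cup \<open>cze\<close> acts as a counit and leaves \<open>ze\<close>,
  which every scalar fixes.\<close>

lemma cup1_cze: "cup1 \<Zcomp> (cze \<boxtimes> W) = ze"
proof -
  have "cup1 \<Zcomp> (W \<boxtimes> sc (-1)) \<Zcomp> (W \<boxtimes> sc (-1)) = cup1"
    by (simp add: cmp_assoc interchange sc_neg_neg idn_ten_idn)
  then have "cup1 \<Zcomp> (cze \<boxtimes> W) = ze \<Zcomp> cad \<Zcomp> ((W \<boxtimes> sc (-1)) \<Zcomp> (cze \<boxtimes> W))"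
    by (simp add: ax_linear cmp_assoc[symmetric])
  also have "(W \<boxtimes> sc (-1)) \<Zcomp> (cze \<boxtimes> W) = (cze \<boxtimes> W) \<Zcomp> sc (-1)"
    using ten_wh[of cze "sc (-1)"] ten_wh'[of cze "sc (-1)"] by (simp add: wh_def)
  also have "ze \<Zcomp> cad \<Zcomp> ((cze \<boxtimes> W) \<Zcomp> sc (-1)) = ze \<Zcomp> ((cad \<Zcomp> (cze \<boxtimes> W)) \<Zcomp> sc (-1))"
    by (simp only: cmp_assoc)
  also have "\<dots> = ze"
    by (simp only: ax_linear(3)) (simp add: ax_matrix)
  finally show ?thesis .
qed

text \<open>The source of all substitution: once one copy of a value has been tested to be zero, the
  other copy may be replaced by \<open>ze\<close>. The copy is written with a bent wire, so that the
  mirrored law for \<open>ccp \<Zcomp> cze\<close> applies.\<close>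

lemma cp_cze: "cp \<Zcomp> (cze \<boxtimes> W) = cze \<Zcomp> ze"
proof -
  have "cp = (W \<boxtimes> cup1) \<Zcomp> (ccp \<boxtimes> W)"
  proof -
    have "(W \<boxtimes> cup1) \<Zcomp> (ccp \<boxtimes> W) = (W \<boxtimes> cdl) \<Zcomp> ((W \<boxtimes> cp) \<Zcomp> (ccp \<boxtimes> W))"
      by (simp add: cup1_def ten_cmp_left cmp_assoc)
    also have "\<dots> = ((W \<boxtimes> cdl) \<Zcomp> ccp) \<Zcomp> cp" by (simp only: ax_linear cmp_assoc)
    finally show ?thesis by (simp add: cdl_ccp_right)
  qed
  then have "cp \<Zcomp> (cze \<boxtimes> W) = (W \<boxtimes> cup1) \<Zcomp> ((ccp \<Zcomp> cze) \<boxtimes> W)"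
    by (simp add: ten_cmp_right cmp_assoc)
  also have "\<dots> = cze \<boxtimes> (cup1 \<Zcomp> (cze \<boxtimes> W))"
    by (simp add: ax_linear ten_assoc interchange)
  also have "\<dots> = cze \<Zcomp> ze"
    using ten_wh[of cze ze] by (simp add: cup1_cze)
  finally show ?thesis .
qed

lemma cdl_sc: "k \<noteq> 0 \<Longrightarrow> cdl \<Zcomp> sc k = cdl"
proof -
  assume k: "k \<noteq> 0"
  have "cdl \<Zcomp> sc k = cdl \<Zcomp> cosc k \<Zcomp> sc k" by (simp add: ax_linear)
  also have "\<dots> = cdl" by (simp add: cmp_assoc ax_linear(16)[OF k])
  finally show ?thesis .
qed

text \<open>A sum with a free summand is free, which is what allows a hidden variable to be
  eliminated. The addition is first written as the test \<open>ad \<Zcomp> cze\<close> with its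
  output bent through \<open>cad\<close>, so that the law for \<open>cdl \<Zcomp> cad\<close>
  applies.\<close>

lemma cdl_ad: "(W \<boxtimes> cdl) \<Zcomp> ad = dl \<boxtimes> cdl"
proof -
  have dl: "(W \<boxtimes> cdl) \<Zcomp> (ad \<Zcomp> cze) = dl"
  proof -
    have "(W \<boxtimes> cdl) \<Zcomp> (ad \<Zcomp> cze) = (W \<boxtimes> (cdl \<Zcomp> sc (-1))) \<Zcomp> cap1"
      by (simp add: ax_linear ten_cmp_left cmp_assoc)
    also have "\<dots> = (W \<boxtimes> cdl) \<Zcomp> ccp \<Zcomp> dl"
      by (simp add: cdl_sc cap1_def cmp_assoc)
    finally show ?thesis by (simp add: cdl_ccp_right)
  qed
  have "ad = ad \<Zcomp> (cad \<Zcomp> (cze \<boxtimes> W))" by (simp add: ax_linear)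
  also have "\<dots> = (W \<boxtimes> cad) \<Zcomp> (ad \<boxtimes> W) \<Zcomp> (cze \<boxtimes> W)"
    by (simp only: ax_linear(12) cmp_assoc[symmetric])
  finally have "ad = (W \<boxtimes> cad) \<Zcomp> ((ad \<Zcomp> cze) \<boxtimes> W)"
    by (simp add: ten_cmp_right cmp_assoc)
  then have "(W \<boxtimes> cdl) \<Zcomp> ad = (W \<boxtimes> (cdl \<Zcomp> cad)) \<Zcomp> ((ad \<Zcomp> cze) \<boxtimes> W)"
    by (simp add: ten_cmp_left cmp_assoc)
  also have "\<dots> = ((W \<boxtimes> cdl) \<Zcomp> (ad \<Zcomp> cze)) \<boxtimes> cdl"
    by (simp add: ax_linear ten_assoc[symmetric] interchange)
  finally show ?thesis by (simp only: dl)
qed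

text \<open>(D) after bending the output of \<open>nu\<close>.\<close>

lemma cdl_cnu: "cdl \<Zcomp> cnu = idn 0"
proof -
  have "cdl \<Zcomp> cnu = (cdl \<Zcomp> (nu \<boxtimes> W)) \<Zcomp> (ccp \<Zcomp> dl)"
    by (simp add: cnu_def cap1_def cmp_assoc)
  also have "cdl \<Zcomp> (nu \<boxtimes> W) = nu \<Zcomp> (W \<boxtimes> cdl)"
    using ten_wh[of nu cdl] ten_wh'[of nu cdl] by (simp add: wh_def)
  also have "nu \<Zcomp> (W \<boxtimes> cdl) \<Zcomp> (ccp \<Zcomp> dl) = nu \<Zcomp> (((W \<boxtimes> cdl) \<Zcomp> ccp) \<Zcomp> dl)"
    by (simp only: cmp_assoc)
  finally show ?thesis by (simp add: cdl_ccp_right ax_affine)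
qed

text \<open>(Z) after bending: by \<open>cap1_eq\<close> the cap is a test of a sum, and with
  \<open>ze\<close> as one summand it becomes \<open>cze\<close> on the other.\<close>

lemma ze_cnu: "ze \<Zcomp> cnu = idn 0"
proof -
  have "ze \<Zcomp> cnu = (ze \<Zcomp> (nu \<boxtimes> W)) \<Zcomp> (W \<boxtimes> sc (-1)) \<Zcomp> (ad \<Zcomp> cze)"
    by (simp add: cnu_def cap1_eq cmp_assoc)
  also have "ze \<Zcomp> (nu \<boxtimes> W) = nu \<Zcomp> (W \<boxtimes> ze)"
    using ten_wh[of nu ze] ten_wh'[of nu ze] by (simp add: wh_def)
  also have "nu \<Zcomp> (W \<boxtimes> ze) \<Zcomp> (W \<boxtimes> sc (-1)) \<Zcomp> (ad \<Zcomp> cze) = nu \<Zcomp> (((W \<boxtimes> (ze \<Zcomp> sc (-1))) \<Zcomp> ad) \<Zcomp> cze)"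
    by (simp add: ten_cmp_left cmp_assoc)
  finally show ?thesis by (simp add: ax_matrix ze_ad_right ax_affine)
qed

section \<open>Cartesian arrows and linear forms\<close>

lemma interchange3:
  "cd f = dm f' \<Longrightarrow> cd g = dm g' \<Longrightarrow> cd h = dm h' \<Longrightarrow>
    (f \<boxtimes> g \<boxtimes> h) \<Zcomp> (f' \<boxtimes> g' \<boxtimes> h') = (f \<Zcomp> f') \<boxtimes> (g \<Zcomp> g') \<boxtimes> (h \<Zcomp> h')"
  by (cases "ok g \<and> ok g' \<and> ok h \<and> ok h'") (auto simp: interchange intro!: not_ok_eq)

text \<open>Comonoid homomorphisms, the diagrammatic counterpart of total functions. Along them a
  conjunction of effects is pulled back conjunct by conjunct (\<open>cart_cnj\<close>).\<close>

definition cart :: "arr \<Rightarrow> bool" where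
  "cart f \<longleftrightarrow> ok f \<and> f \<Zcomp> dup (cd f) = dup (dm f) \<Zcomp> (f \<boxtimes> f) \<and> f \<Zcomp> del (cd f) = del (dm f)"

lemma cart_ok: "cart f \<Longrightarrow> ok f" by (simp add: cart_def)

lemma cart_idn [simp]: "cart (idn n)"
  by (simp add: cart_def idn_ten_idn)

lemma cart_cmp:
  assumes "cart f" "cart g" "cd f = dm g" shows "cart (f \<Zcomp> g)"
proof -
  have f: "f \<Zcomp> dup (cd f) = dup (dm f) \<Zcomp> (f \<boxtimes> f)"
    using assms by (simp add: cart_def)
  have "(f \<Zcomp> g) \<Zcomp> dup (cd g) = f \<Zcomp> (dup (cd f) \<Zcomp> (g \<boxtimes> g))"
    using assms by (simp add: cart_def cmp_assoc)
  also have "\<dots> = (f \<Zcomp> dup (cd f)) \<Zcomp> (g \<boxtimes> g)"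
    by (simp only: cmp_assoc)
  also have "\<dots> = dup (dm f) \<Zcomp> ((f \<boxtimes> f) \<Zcomp> (g \<boxtimes> g))"
    by (simp only: f cmp_assoc)
  also have "(f \<boxtimes> f) \<Zcomp> (g \<boxtimes> g) = (f \<Zcomp> g) \<boxtimes> (f \<Zcomp> g)"
    using assms by (simp add: interchange)
  finally have "(f \<Zcomp> g) \<Zcomp> dup (cd g) = dup (dm f) \<Zcomp> ((f \<Zcomp> g) \<boxtimes> (f \<Zcomp> g))" .
  moreover have "(f \<Zcomp> g) \<Zcomp> del (cd g) = del (dm f)"
    using assms by (simp add: cart_def cmp_assoc)
  moreover have "ok f" "ok g" using assms by (simp_all add: cart_def)
  ultimately show ?thesis using assms(3) unfolding cart_def by simp
qed

lemma cart_ten: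
  assumes "cart f" "cart g" shows "cart (f \<boxtimes> g)"
proof -
  define a b c d where "a = dm f" and "b = cd f" and "c = dm g" and "d = cd g"
  note abcd = this
  have ok: "ok f" "ok g" using assms by (auto simp: cart_def)
  have f: "f \<Zcomp> dup b = dup a \<Zcomp> (f \<boxtimes> f)" and g: "g \<Zcomp> dup d = dup c \<Zcomp> (g \<boxtimes> g)"
    using assms by (simp_all add: cart_def abcd)
  have "(f \<boxtimes> g) \<Zcomp> dup (b + d) = ((f \<Zcomp> dup b) \<boxtimes> (g \<Zcomp> dup d)) \<Zcomp> wh b (sw b d) d"
    by (simp add: dup_add cmp_assoc[symmetric] interchange abcd)
  also have "\<dots> = ((dup a \<boxtimes> dup c) \<Zcomp> ((f \<boxtimes> f) \<boxtimes> (g \<boxtimes> g))) \<Zcomp> wh b (sw b d) d"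
    by (simp only: f g) (simp add: interchange abcd ok)
  also have "\<dots> = (dup a \<boxtimes> dup c) \<Zcomp> (f \<boxtimes> ((f \<boxtimes> g) \<Zcomp> sw b d) \<boxtimes> g)"
  proof -
    have "(f \<boxtimes> (f \<boxtimes> g) \<boxtimes> g) \<Zcomp> wh b (sw b d) d = (f \<Zcomp> idn b) \<boxtimes> ((f \<boxtimes> g) \<Zcomp> sw b d) \<boxtimes> (g \<Zcomp> idn d)"
      unfolding wh_def by (rule interchange3) (simp_all add: abcd ok)
    also have "\<dots> = f \<boxtimes> ((f \<boxtimes> g) \<Zcomp> sw b d) \<boxtimes> g"
      by (simp add: abcd)
    finally show ?thesis by (simp only: cmp_assoc ten_assoc)
  qed
  also have "(f \<boxtimes> g) \<Zcomp> sw b d = sw a c \<Zcomp> (g \<boxtimes> f)"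
    by (rule sw_natural) (simp_all add: abcd)
  also have "(dup a \<boxtimes> dup c) \<Zcomp> (f \<boxtimes> (sw a c \<Zcomp> (g \<boxtimes> f)) \<boxtimes> g) = ((dup a \<boxtimes> dup c) \<Zcomp> wh a (sw a c) c) \<Zcomp> (f \<boxtimes> (g \<boxtimes> f) \<boxtimes> g)"
    by (simp add: cmp_assoc wh_def interchange abcd ok)
  also have "\<dots> = dup (a + c) \<Zcomp> ((f \<boxtimes> g) \<boxtimes> (f \<boxtimes> g))"
    by (simp add: dup_add ten_assoc)
  finally show ?thesis
    using assms by (simp add: cart_def del_add interchange abcd)
qed

lemma cart_sw: "cart (sw m n)"
proof -
  have "sw m n \<Zcomp> dup (n + m) = ((dup m \<boxtimes> dup n) \<Zcomp> sw (m + m) (n + n)) \<Zcomp> wh n (sw n m) m"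
    by (simp add: dup_add cmp_assoc[symmetric] sw_natural)
  also have "\<dots> = (dup m \<boxtimes> dup n) \<Zcomp> (wh m (sw m n) n \<Zcomp> ((sw m n \<boxtimes> sw m n) \<Zcomp> (wh n (sw m n) m \<Zcomp> wh n (sw n m) m)))"
    by (simp only: sw_add_add cmp_assoc)
  also have "wh n (sw m n) m \<Zcomp> wh n (sw n m) m = idn (n + m + (n + m))"
    by (simp add: wh_cmp[symmetric] add_ac)
  also have "(sw m n \<boxtimes> sw m n) \<Zcomp> idn (n + m + (n + m)) = sw m n \<boxtimes> sw m n"
    by simp
  also have "(dup m \<boxtimes> dup n) \<Zcomp> (wh m (sw m n) n \<Zcomp> (sw m n \<boxtimes> sw m n)) = dup (m + n) \<Zcomp> (sw m n \<boxtimes> sw m n)"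
    by (simp add: dup_add cmp_assoc)
  finally show ?thesis
    using sw_natural[of "del m" m 0 "del n" n 0] by (simp add: cart_def del_add)
qed

lemma cart_dup: "cart (dup n)"
proof -
  have "dup n \<Zcomp> (dup n \<boxtimes> dup n) = (dup n \<Zcomp> (dup n \<boxtimes> idn n)) \<Zcomp> (idn n \<boxtimes> idn n \<boxtimes> dup n)"
    by (simp add: cmp_assoc ten_assoc[symmetric] interchange idn_ten_idn)
  also have "\<dots> = dup n \<Zcomp> (idn n \<boxtimes> (dup n \<Zcomp> (idn n \<boxtimes> dup n)))"
    by (simp add: dup_assoc ten_cmp_left cmp_assoc)
  also have "\<dots> = dup n \<Zcomp> (idn n \<boxtimes> (dup n \<Zcomp> (dup n \<boxtimes> idn n)))"
    by (simp only: dup_assoc)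
  finally have *: "dup n \<Zcomp> (dup n \<boxtimes> dup n) = dup n \<Zcomp> (idn n \<boxtimes> (dup n \<Zcomp> (dup n \<boxtimes> idn n)))" .
  have "dup n \<Zcomp> dup (n + n) = dup n \<Zcomp> (idn n \<boxtimes> (dup n \<Zcomp> (dup n \<boxtimes> idn n))) \<Zcomp> wh n (sw n n) n"
    by (simp only: dup_add cmp_assoc[symmetric] *)
  also have "\<dots> = dup n \<Zcomp> (idn n \<boxtimes> (dup n \<Zcomp> ((dup n \<Zcomp> sw n n) \<boxtimes> idn n)))"
    by (simp add: cmp_assoc wh_def ten_cmp_left ten_cmp_right)
  also have "\<dots> = dup n \<Zcomp> (dup n \<boxtimes> dup n)"
    by (simp only: dup_comm *)
  finally have "dup n \<Zcomp> dup (n + n) = dup n \<Zcomp> (dup n \<boxtimes> dup n)" .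
  moreover have "dup n \<Zcomp> del (n + n) = del n"
  proof -
    have "dup n \<Zcomp> (del n \<boxtimes> del n) = dup n \<Zcomp> (del n \<boxtimes> idn n) \<Zcomp> del n"
      using ten_wh[of "del n" "del n"] by (simp add: cmp_assoc wh_def)
    then show ?thesis by (simp add: del_add dup_del_left)
  qed
  ultimately show ?thesis by (simp add: cart_def)
qed

lemma cart_gen: "cart cp" "cart dl" "cart ad" "cart ze" "cart (sc k)" "cart on"
proof -
  show "cart cp" using cart_dup[of 1] by simp
  have dup2: "dup (Suc (Suc 0)) = (cp \<boxtimes> cp) \<Zcomp> wh 1 sw1 1" using dup_add[of 1 1] by simp
  have "cp \<Zcomp> (dl \<boxtimes> dl) = dl"
    using ten_wh[of dl dl] ax_matrix(2) by (simp add: cmp_assoc[symmetric] wh_def)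
  then show "cart dl" by (simp add: cart_def del: del.simps(2) dup.simps(2))
  show "cart ad" by (simp add: cart_def ax_matrix dup2 cmp_assoc del: dup.simps(2))
  show "cart ze" "cart (sc k)" "cart on"
    by (simp_all add: cart_def ax_matrix ax_affine del: del.simps(2) dup.simps(2))
qed

declare cart_gen [simp]

section \<open>Linear forms and linear maps\<close>

primrec lin :: "nat \<Rightarrow> (nat \<Rightarrow> real) \<Rightarrow> arr" where
  "lin 0 r = ze"
| "lin (Suc p) r = (lin p r \<boxtimes> sc (r p)) \<Zcomp> ad"

lemma cart_lin_aux: "cart (lin p r) \<and> dm (lin p r) = p \<and> cd (lin p r) = 1"
  by (induction p) (auto intro!: cart_cmp cart_ten simp: cart_ok)

lemma lin_simps [simp]: "cart (lin p r)" "ok (lin p r)" "dm (lin p r) = p" "cd (lin p r) = Suc 0"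
  using cart_lin_aux[of p r] by (auto simp: cart_ok)

text \<open>Coefficients are functions on all naturals of which only the values below
  \<open>p\<close> count. One function can thus be restricted, padded or updated at \<open>p\<close>
  without reindexing.\<close>

lemma lin_cong: "(\<And>i. i < p \<Longrightarrow> r i = s i) \<Longrightarrow> lin p r = lin p s"
  by (induction p) simp_all

lemma lin_1 [simp]: "lin (Suc 0) r = sc (r 0)"
proof -
  have "(ze \<boxtimes> sc (r 0)) \<Zcomp> ad = sc (r 0) \<Zcomp> ((ze \<boxtimes> W) \<Zcomp> ad)"
    using ten_wh'[of ze "sc (r 0)"] by (simp add: wh_def cmp_assoc)
  then show ?thesis by (simp add: ax_matrix)
qed

lemma lin_0: "lin p (\<lambda>_. 0) = del p \<Zcomp> ze"
proof (induction p)
  case (Suc p)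
  have "lin (Suc p) (\<lambda>_. 0) = ((del p \<Zcomp> ze) \<boxtimes> (dl \<Zcomp> ze)) \<Zcomp> ad"
    by (simp add: Suc ax_matrix)
  also have "\<dots> = (del p \<boxtimes> dl) \<Zcomp> ((ze \<boxtimes> ze) \<Zcomp> ad)"
    using interchange[of "del p" ze dl ze] by (simp add: cmp_assoc[symmetric])
  finally show ?case by (simp add: ze_ze_ad)
qed simp

lemma lin_scale: "lin p r \<Zcomp> sc c = lin p (\<lambda>i. c * r i)"
proof (induction p)
  case (Suc p)
  have "lin (Suc p) r \<Zcomp> sc c = ((lin p r \<boxtimes> sc (r p)) \<Zcomp> (sc c \<boxtimes> sc c)) \<Zcomp> ad"
    by (simp add: cmp_assoc ax_matrix)
  then show ?case by (simp add: interchange Suc) (simp add: ax_matrix)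
qed (simp add: ax_matrix)

lemma ad_ad_ad: "(ad \<boxtimes> ad) \<Zcomp> ad = wh 1 ad 1 \<Zcomp> ((ad \<boxtimes> W) \<Zcomp> ad)"
proof -
  have "(ad \<boxtimes> ad) \<Zcomp> ad = (ad \<boxtimes> W \<boxtimes> W) \<Zcomp> ((W \<boxtimes> ad) \<Zcomp> ad)"
    using ten_wh[of ad ad] by (simp add: wh_def cmp_assoc idn_ten_idn)
  also have "\<dots> = (((ad \<boxtimes> W) \<Zcomp> ad) \<boxtimes> W) \<Zcomp> ad"
    by (simp add: ax_matrix(4)[symmetric] ten_cmp_right cmp_assoc ten_assoc)
  also have "\<dots> = (((W \<boxtimes> ad) \<Zcomp> ad) \<boxtimes> W) \<Zcomp> ad"
    by (simp only: ax_matrix(4))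
  finally show ?thesis by (simp add: ten_cmp_right cmp_assoc wh_def ten_assoc)
qed

lemma sw_ad_ad_ad: "wh 1 sw1 1 \<Zcomp> ((ad \<boxtimes> ad) \<Zcomp> ad) = (ad \<boxtimes> ad) \<Zcomp> ad"
proof -
  have "wh 1 sw1 1 \<Zcomp> ((ad \<boxtimes> ad) \<Zcomp> ad) = wh 1 (sw1 \<Zcomp> ad) 1 \<Zcomp> ((ad \<boxtimes> W) \<Zcomp> ad)"
    by (simp add: ad_ad_ad wh_cmp cmp_assoc)
  then show ?thesis by (simp add: ax_matrix ad_ad_ad)
qed

lemma lin_add: "dup p \<Zcomp> ((lin p r \<boxtimes> lin p s) \<Zcomp> ad) = lin p (\<lambda>i. r i + s i)"
proof (induction p)
  case 0
  then show ?case by (simp add: ze_ze_ad)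
next
  case (Suc p)
  \<comment> \<open>The crossing inside \<open>dup (Suc p)\<close> slides behind the forms, where it
    merely permutes summands and \<open>sw_ad_ad_ad\<close> absorbs it.\<close>
  have slide: "wh p (sw p 1) 1 \<Zcomp> ((lin p r \<boxtimes> sc (r p)) \<boxtimes> (lin p s \<boxtimes> sc (s p))) =
      (lin p r \<boxtimes> lin p s \<boxtimes> sc (r p) \<boxtimes> sc (s p)) \<Zcomp> wh 1 sw1 1"
  proof -
    have "wh p (sw p 1) 1 \<Zcomp> ((lin p r \<boxtimes> sc (r p)) \<boxtimes> (lin p s \<boxtimes> sc (s p))) =
        lin p r \<boxtimes> (sw p 1 \<Zcomp> (sc (r p) \<boxtimes> lin p s)) \<boxtimes> sc (s p)"
      using interchange3[of "idn p" "lin p r" "sw p 1" "sc (r p) \<boxtimes> lin p s" "idn 1" "sc (s p)"]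
      by (simp add: wh_def ten_assoc)
    also have "sw p 1 \<Zcomp> (sc (r p) \<boxtimes> lin p s) = (lin p s \<boxtimes> sc (r p)) \<Zcomp> sw1"
      by (rule sw_natural[symmetric]) simp_all
    finally show ?thesis
      using interchange3[of "lin p r" W "lin p s \<boxtimes> sc (r p)" sw1 "sc (s p)" W]
      by (simp add: wh_def ten_assoc)
  qed
  have "dup (Suc p) \<Zcomp> ((lin (Suc p) r \<boxtimes> lin (Suc p) s) \<Zcomp> ad) =
     (dup p \<boxtimes> cp) \<Zcomp> ((wh p (sw p 1) 1 \<Zcomp> ((lin p r \<boxtimes> sc (r p)) \<boxtimes> (lin p s \<boxtimes> sc (s p)))) \<Zcomp> ((ad \<boxtimes> ad) \<Zcomp> ad))"
    by (simp add: cmp_assoc interchange[symmetric])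
  also have "\<dots> = (dup p \<boxtimes> cp) \<Zcomp> ((lin p r \<boxtimes> lin p s \<boxtimes> sc (r p) \<boxtimes> sc (s p)) \<Zcomp> ((ad \<boxtimes> ad) \<Zcomp> ad))"
    by (simp only: slide cmp_assoc sw_ad_ad_ad)
  also have "\<dots> = ((dup p \<Zcomp> ((lin p r \<boxtimes> lin p s) \<Zcomp> ad)) \<boxtimes> (cp \<Zcomp> ((sc (r p) \<boxtimes> sc (s p)) \<Zcomp> ad))) \<Zcomp> ad"
    by (simp add: interchange[symmetric] cmp_assoc ten_assoc)
  also have "cp \<Zcomp> ((sc (r p) \<boxtimes> sc (s p)) \<Zcomp> ad) = sc (r p + s p)"
    by (simp add: ax_matrix(18) cmp_assoc)
  finally show ?case by (simp add: Suc)
qed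

lemma lin_split: "lin (m + n) r = (lin m r \<boxtimes> lin n (\<lambda>i. r (m + i))) \<Zcomp> ad"
proof (induction n)
  case 0
  have "(lin m r \<boxtimes> ze) \<Zcomp> ad = lin m r \<Zcomp> ((W \<boxtimes> ze) \<Zcomp> ad)"
    using ten_wh[of "lin m r" ze] by (simp add: wh_def cmp_assoc)
  then show ?case by (simp add: ze_ad_right)
next
  case (Suc n)
  have "lin (m + Suc n) r = (((lin m r \<boxtimes> lin n (\<lambda>i. r (m + i))) \<Zcomp> ad) \<boxtimes> sc (r (m + n))) \<Zcomp> ad"
    by (simp add: Suc)
  also have "\<dots> = (lin m r \<boxtimes> lin n (\<lambda>i. r (m + i)) \<boxtimes> sc (r (m + n))) \<Zcomp> ((ad \<boxtimes> W) \<Zcomp> ad)"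
    by (simp add: ten_cmp_right cmp_assoc ten_assoc)
  also have "\<dots> = (lin m r \<boxtimes> lin (Suc n) (\<lambda>i. r (m + i))) \<Zcomp> ad"
    by (simp add: ax_matrix(4) ten_cmp_left cmp_assoc)
  finally show ?case .
qed

text \<open>A matrix is known only through the existence of the forms it pulls back to and is never
  written down. \<open>on\<close> is cartesian too, but it pulls a form back to a constant rather
  than to a form.\<close>

definition linear :: "arr \<Rightarrow> bool" where
  "linear f \<longleftrightarrow> cart f \<and> (\<forall>s. \<exists>r. f \<Zcomp> lin (cd f) s = lin (dm f) r)"

lemma linear_idn: "linear (idn n)"
  by (auto simp: linear_def)

lemma linear_cmp: "linear f \<Longrightarrow> linear g \<Longrightarrow> cd f = dm g \<Longrightarrow> linear (f \<Zcomp> g)"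
  unfolding linear_def by (auto simp: cart_cmp cart_ok cmp_assoc) metis

lemma linear_ten:
  assumes "linear f" "linear g" shows "linear (f \<boxtimes> g)"
proof -
  have ok: "ok f" "ok g" using assms by (auto simp: linear_def cart_ok)
  have "\<exists>r. (f \<boxtimes> g) \<Zcomp> lin (cd f + cd g) s = lin (dm f + dm g) r" for s
  proof -
    obtain r1 where r1: "f \<Zcomp> lin (cd f) s = lin (dm f) r1"
      using assms by (auto simp: linear_def)
    obtain r2 where r2: "g \<Zcomp> lin (cd g) (\<lambda>i. s (cd f + i)) = lin (dm g) r2"
      using assms unfolding linear_def by blast
    define r where "r = (\<lambda>i. if i < dm f then r1 i else r2 (i - dm f))"
    have "lin (dm f) r1 = lin (dm f) r" by (rule lin_cong) (simp add: r_def)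
    moreover have "lin (dm g) r2 = lin (dm g) (\<lambda>i. r (dm f + i))" by (rule lin_cong) (simp add: r_def)
    ultimately have "lin (dm f + dm g) r = ((f \<Zcomp> lin (cd f) s) \<boxtimes> (g \<Zcomp> lin (cd g) (\<lambda>i. s (cd f + i)))) \<Zcomp> ad"
      by (simp only: lin_split r1 r2)
    also have "\<dots> = (f \<boxtimes> g) \<Zcomp> lin (cd f + cd g) s"
      by (simp add: lin_split cmp_assoc[symmetric] interchange)
    finally show ?thesis by metis
  qed
  then show ?thesis using assms ok by (simp add: linear_def cart_ten)
qed

lemma linear_wh: "linear f \<Longrightarrow> linear (wh j f k)"
  by (simp add: wh_def linear_ten linear_idn)

lemma linear_sw: "linear (sw m n)"
proof -
  have "\<exists>r. sw m n \<Zcomp> lin (n + m) s = lin (m + n) r" for s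
  proof -
    define r where "r = (\<lambda>i. if i < m then s (n + i) else s (i - m))"
    have "lin n s = lin n (\<lambda>i. r (m + i))" "lin m (\<lambda>i. s (n + i)) = lin m r"
      by (auto intro!: lin_cong simp: r_def)
    then have "sw m n \<Zcomp> lin (n + m) s = (sw m n \<Zcomp> (lin n (\<lambda>i. r (m + i)) \<boxtimes> lin m r)) \<Zcomp> ad"
      by (simp add: lin_split cmp_assoc)
    also have "\<dots> = (lin m r \<boxtimes> lin n (\<lambda>i. r (m + i))) \<Zcomp> (sw1 \<Zcomp> ad)"
    proof -
      have "(lin m r \<boxtimes> lin n (\<lambda>i. r (m + i))) \<Zcomp> sw1 = sw m n \<Zcomp> (lin n (\<lambda>i. r (m + i)) \<boxtimes> lin m r)"
        by (rule sw_natural) simp_all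
      then show ?thesis by (simp only: cmp_assoc[symmetric])
    qed
    finally show ?thesis by (auto simp: ax_matrix lin_split)
  qed
  then show ?thesis by (simp add: linear_def cart_sw)
qed

lemma linear_gen: "linear cp" "linear dl" "linear ad" "linear ze" "linear (sc k)"
proof -
  have "cp \<Zcomp> lin (Suc (Suc 0)) s = lin (Suc 0) (\<lambda>_. s 0 + s 1)" for s
    by (simp only: lin.simps(2)[of "Suc 0" s] lin_1) (simp add: ax_matrix(18) cmp_assoc)
  then show "linear cp" by (auto simp: linear_def simp del: lin.simps)
  have "dl \<Zcomp> ze = lin (Suc 0) (\<lambda>_. 0)"
    by (simp add: ax_matrix del: lin.simps)
  then show "linear dl" by (auto simp: linear_def simp del: lin.simps(2))
  have "ad \<Zcomp> lin (Suc 0) s = lin (Suc (Suc 0)) (\<lambda>_. s 0)" for s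
  proof -
    have "lin (Suc (Suc 0)) (\<lambda>_. s 0) = (lin (Suc 0) (\<lambda>_. s 0) \<boxtimes> sc (s 0)) \<Zcomp> ad" by (rule lin.simps)
    then show ?thesis by (simp add: ax_matrix del: lin.simps)
  qed
  then show "linear ad" by (auto simp: linear_def simp del: lin.simps)
  show "linear ze" by (auto simp: linear_def ax_matrix simp del: lin.simps(2))
  have "sc k \<Zcomp> lin (Suc 0) s = lin (Suc 0) (\<lambda>_. s 0 * k)" for s
    by (simp add: ax_matrix del: lin.simps)
  then show "linear (sc k)" by (auto simp: linear_def simp del: lin.simps(2))
qed

section \<open>The algebra of effects\<close>

definition eff :: "nat \<Rightarrow> arr \<Rightarrow> bool" where
  "eff p e \<longleftrightarrow> ok e \<and> dm e = p \<and> cd e = 0"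

lemma effD: "eff p e \<Longrightarrow> ok e" "eff p e \<Longrightarrow> dm e = p" "eff p e \<Longrightarrow> cd e = 0"
  by (auto simp: eff_def)

definition cnj :: "nat \<Rightarrow> arr \<Rightarrow> arr \<Rightarrow> arr" where
  "cnj p e e' = dup p \<Zcomp> (e \<boxtimes> e')"

lemma eff_cnj [simp]: "eff p e \<Longrightarrow> eff p e' \<Longrightarrow> eff p (cnj p e e')"
  by (simp add: eff_def cnj_def)

lemma eff_del [simp]: "eff p (del p)"
  by (simp add: eff_def)

lemma eff_cmp [simp]: "ok f \<Longrightarrow> dm f = p \<Longrightarrow> eff (cd f) e \<Longrightarrow> eff p (f \<Zcomp> e)"
  by (simp add: eff_def)

lemma eff_ten_dl [simp]: "eff p e \<Longrightarrow> eff (Suc p) (e \<boxtimes> dl)"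
  by (simp add: eff_def)

lemma cnj_assoc: "eff p e \<Longrightarrow> eff p e' \<Longrightarrow> eff p e'' \<Longrightarrow> cnj p (cnj p e e') e'' = cnj p e (cnj p e' e'')"
proof -
  assume e: "eff p e" "eff p e'" "eff p e''"
  have "cnj p (cnj p e e') e'' = (dup p \<Zcomp> (dup p \<boxtimes> idn p)) \<Zcomp> ((e \<boxtimes> e') \<boxtimes> e'')"
    using e by (simp add: eff_def cnj_def cmp_assoc) (simp add: interchange eff_def)
  also have "\<dots> = dup p \<Zcomp> ((idn p \<boxtimes> dup p) \<Zcomp> (e \<boxtimes> (e' \<boxtimes> e'')))"
    by (simp add: dup_assoc cmp_assoc ten_assoc)
  also have "\<dots> = cnj p e (cnj p e' e'')"
    using e by (simp add: eff_def cnj_def interchange)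
  finally show ?thesis .
qed

lemma cnj_comm: "eff p e \<Longrightarrow> eff p e' \<Longrightarrow> cnj p e e' = cnj p e' e"
  using sw_natural[of e p 0 e' p 0] by (simp add: eff_def cnj_def) (simp add: cmp_assoc[symmetric] dup_comm)

lemma cnj_left_comm: "eff p e \<Longrightarrow> eff p e' \<Longrightarrow> eff p e'' \<Longrightarrow> cnj p e (cnj p e' e'') = cnj p e' (cnj p e e'')"
  by (simp add: cnj_assoc[symmetric] cnj_comm[of p e e'])

lemma cnj_del_right [simp]: "eff p e \<Longrightarrow> cnj p e (del p) = e"
  using ten_wh'[of e "del p"] dup_del_right[of p] by (simp add: eff_def cnj_def cmp_assoc[symmetric] wh_def)

lemma cnj_del_left [simp]: "eff p e \<Longrightarrow> cnj p (del p) e = e"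
  using cnj_comm[of p "del p" e] by simp

lemma cart_cnj: "cart f \<Longrightarrow> cd f = p \<Longrightarrow> eff p e \<Longrightarrow> eff p e' \<Longrightarrow>
    f \<Zcomp> cnj p e e' = cnj (dm f) (f \<Zcomp> e) (f \<Zcomp> e')"
proof -
  assume f: "cart f" "cd f = p" and e: "eff p e" "eff p e'"
  from f have "f \<Zcomp> dup p = dup (dm f) \<Zcomp> (f \<boxtimes> f)" by (auto simp: cart_def)
  then have "f \<Zcomp> cnj p e e' = dup (dm f) \<Zcomp> ((f \<boxtimes> f) \<Zcomp> (e \<boxtimes> e'))"
    by (simp only: cnj_def cmp_assoc[symmetric])
  then show ?thesis using f e by (simp add: eff_def cart_ok cnj_def interchange)
qed

lemma cart_del: "cart f \<Longrightarrow> cd f = p \<Longrightarrow> f \<Zcomp> del p = del (dm f)"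
  by (auto simp: cart_def)

text \<open>The copy of the last wire that goes to \<open>e \<boxtimes> dl\<close> is discarded at
  once, so by the counit law that wire need not be copied at all.\<close>

lemma cnj_pad:
  assumes x: "eff (Suc p) x" and e: "eff p e"
  shows "cnj (Suc p) (e \<boxtimes> dl) x = ((dup p \<Zcomp> (e \<boxtimes> idn p)) \<boxtimes> W) \<Zcomp> x"
proof -
  have "wh p (sw p 1) 1 \<Zcomp> ((e \<boxtimes> dl) \<boxtimes> idn (Suc p)) = wh p (sw p 1) 1 \<Zcomp> (e \<boxtimes> (dl \<boxtimes> idn p) \<boxtimes> idn 1)"
    by (simp add: ten_assoc idn_ten_idn)
  also have "\<dots> = (idn p \<Zcomp> e) \<boxtimes> (sw p 1 \<Zcomp> wh 0 dl p) \<boxtimes> (idn 1 \<Zcomp> idn 1)"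
    unfolding wh_def by (subst interchange3) (use e in \<open>simp_all add: eff_def\<close>)
  also have "\<dots> = e \<boxtimes> (idn p \<boxtimes> dl) \<boxtimes> idn 1"
    using sw_natural_right[of dl 1 0 p] e by (simp add: eff_def idn_ten_wh)
  finally have *: "wh p (sw p 1) 1 \<Zcomp> ((e \<boxtimes> dl) \<boxtimes> idn (Suc p)) = e \<boxtimes> (idn p \<boxtimes> dl) \<boxtimes> idn 1" .
  have "cnj (Suc p) (e \<boxtimes> dl) x = dup (Suc p) \<Zcomp> (((e \<boxtimes> dl) \<boxtimes> idn (Suc p)) \<Zcomp> x)"
    using e x ten_wh[of "e \<boxtimes> dl" x] by (simp add: eff_def cnj_def wh_def)
  also have "\<dots> = (dup p \<boxtimes> cp) \<Zcomp> ((wh p (sw p 1) 1 \<Zcomp> ((e \<boxtimes> dl) \<boxtimes> idn (Suc p))) \<Zcomp> x)"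
    by (simp add: cmp_assoc)
  also have "\<dots> = ((dup p \<boxtimes> cp) \<Zcomp> ((e \<boxtimes> idn p) \<boxtimes> (dl \<boxtimes> idn 1))) \<Zcomp> x"
    unfolding * by (simp only: cmp_assoc ten_assoc)
  also have "(dup p \<boxtimes> cp) \<Zcomp> ((e \<boxtimes> idn p) \<boxtimes> (dl \<boxtimes> idn 1)) = (dup p \<Zcomp> (e \<boxtimes> idn p)) \<boxtimes> (cp \<Zcomp> (dl \<boxtimes> idn 1))"
    by (rule interchange) (use e in \<open>simp_all add: eff_def\<close>)
  finally show ?thesis by (simp add: ax_matrix)
qed

lemma plug_cnj_pad:
  assumes "eff p e" "eff (Suc p) x" "ok g" "dm g = 0" "cd g = 1"
  shows "(idn p \<boxtimes> g) \<Zcomp> cnj (Suc p) (e \<boxtimes> dl) x = cnj p e ((idn p \<boxtimes> g) \<Zcomp> x)"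
proof -
  have "(idn p \<boxtimes> g) \<Zcomp> cnj (Suc p) (e \<boxtimes> dl) x = ((dup p \<Zcomp> (e \<boxtimes> idn p)) \<boxtimes> g) \<Zcomp> x"
    using assms by (simp add: eff_def cnj_pad cmp_assoc[symmetric] interchange)
  also have "(dup p \<Zcomp> (e \<boxtimes> idn p)) \<boxtimes> g = (dup p \<Zcomp> (e \<boxtimes> idn p)) \<Zcomp> (idn p \<boxtimes> g)"
    using ten_wh[of "dup p \<Zcomp> (e \<boxtimes> idn p)" g] assms by (simp add: eff_def eff_def wh_def)
  also have "\<dots> \<Zcomp> x = dup p \<Zcomp> ((e \<boxtimes> idn p) \<Zcomp> ((idn p \<boxtimes> g) \<Zcomp> x))"
    by (simp add: cmp_assoc)
  also have "(e \<boxtimes> idn p) \<Zcomp> ((idn p \<boxtimes> g) \<Zcomp> x) = e \<boxtimes> ((idn p \<boxtimes> g) \<Zcomp> x)"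
    using ten_wh[of e "(idn p \<boxtimes> g) \<Zcomp> x"] assms by (simp add: eff_def eff_def wh_def)
  finally show ?thesis by (simp add: cnj_def)
qed

lemma ten_eff_wire: "eff p e \<Longrightarrow> eff 1 g \<Longrightarrow> e \<boxtimes> g = cnj (Suc p) (e \<boxtimes> dl) (del p \<boxtimes> g)"
proof -
  assume e: "eff p e" "eff 1 g"
  have x: "eff (Suc p) (del p \<boxtimes> g)" using e by (simp add: eff_def eff_def)
  have "cnj (Suc p) (e \<boxtimes> dl) (del p \<boxtimes> g) = ((dup p \<Zcomp> (e \<boxtimes> idn p)) \<boxtimes> W) \<Zcomp> (del p \<boxtimes> g)"
    by (rule cnj_pad[OF x e(1)])
  also have "\<dots> = (dup p \<Zcomp> ((e \<boxtimes> idn p) \<Zcomp> del p)) \<boxtimes> g"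
    using e by (simp add: eff_def interchange cmp_assoc)
  also have "(e \<boxtimes> idn p) \<Zcomp> del p = e \<boxtimes> del p"
    using ten_wh[of e "del p"] e by (simp add: eff_def wh_def)
  finally show ?thesis using e by (simp add: eff_def cnj_def[symmetric])
qed

lemma ten_dl_cnj: "eff p e \<Longrightarrow> eff p e' \<Longrightarrow> cnj p e e' \<boxtimes> dl = cnj (Suc p) (e \<boxtimes> dl) (e' \<boxtimes> dl)"
proof -
  assume e: "eff p e" "eff p e'"
  have "cnj (Suc p) (e \<boxtimes> dl) (e' \<boxtimes> dl) = ((dup p \<Zcomp> (e \<boxtimes> idn p)) \<boxtimes> W) \<Zcomp> (e' \<boxtimes> dl)"
    using e by (simp add: eff_def cnj_pad)
  also have "\<dots> = (dup p \<Zcomp> ((e \<boxtimes> idn p) \<Zcomp> e')) \<boxtimes> dl"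
    using e by (simp add: eff_def interchange cmp_assoc)
  also have "(e \<boxtimes> idn p) \<Zcomp> e' = e \<boxtimes> e'"
    using ten_wh[of e e'] e by (simp add: eff_def wh_def)
  finally show ?thesis by (simp add: cnj_def)
qed

section \<open>Row operations on constraints and costs\<close>

definition zr :: "nat \<Rightarrow> (nat \<Rightarrow> real) \<Rightarrow> arr" where "zr p r = lin p r \<Zcomp> cze"
definition nr :: "nat \<Rightarrow> (nat \<Rightarrow> real) \<Rightarrow> arr" where "nr p r = lin p r \<Zcomp> cnu"

lemma eff_zr [simp]: "eff p (zr p r)" and eff_nr [simp]: "eff p (nr p r)"
  by (simp_all add: zr_def nr_def eff_def)

lemma zr_cong: "(\<And>i. i < p \<Longrightarrow> r i = s i) \<Longrightarrow> zr p r = zr p s"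
  and nr_cong: "(\<And>i. i < p \<Longrightarrow> r i = s i) \<Longrightarrow> nr p r = nr p s"
  by (simp_all add: zr_def nr_def cong: lin_cong)

lemma zr_0 [simp]: "zr p (\<lambda>_. 0) = del p" and nr_0 [simp]: "nr p (\<lambda>_. 0) = del p"
  by (simp_all add: zr_def nr_def lin_0 cmp_assoc ax_linear ze_cnu)

text \<open>The form \<open>r\<close> occurs twice, once tested by \<open>cze\<close> and once as a
  summand. After both occurrences are made copies of one wire, \<open>cp_cze\<close> replaces the
  summand by zero. Leaving the second test \<open>g\<close> arbitrary gives the row operation for
  constraints and costs alike.\<close>

lemma test_shear:
  assumes "eff 1 g"
  shows "cnj p (zr p r) (lin p (\<lambda>i. s i + c * r i) \<Zcomp> g) = cnj p (zr p r) (lin p s \<Zcomp> g)"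
proof -
  note [simp] = assms
  have g: "dm g = Suc 0" "ok g" "cd g = 0" using assms by (auto simp: eff_def)
  have l: "lin p (\<lambda>i. s i + c * r i) = dup p \<Zcomp> ((lin p r \<boxtimes> lin p s) \<Zcomp> ((sc c \<boxtimes> W) \<Zcomp> ad))"
  proof -
    have "lin p (\<lambda>i. s i + c * r i) = dup p \<Zcomp> (((lin p r \<Zcomp> sc c) \<boxtimes> lin p s) \<Zcomp> ad)"
      by (simp add: lin_scale lin_add add.commute)
    also have "(lin p r \<Zcomp> sc c) \<boxtimes> lin p s = (lin p r \<boxtimes> lin p s) \<Zcomp> (sc c \<boxtimes> W)"
      by (simp add: interchange)
    finally show ?thesis by (simp only: cmp_assoc)
  qed
  have z: "(cze \<boxtimes> sc c \<boxtimes> W) \<Zcomp> (ad \<Zcomp> g) = cze \<boxtimes> ((sc c \<boxtimes> W) \<Zcomp> (ad \<Zcomp> g))"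
    using ten_wh[of cze "(sc c \<boxtimes> W) \<Zcomp> (ad \<Zcomp> g)"] ten_wh[of cze "sc c \<boxtimes> W"] g by (simp add: wh_def cmp_assoc)
  have c: "cp \<Zcomp> (cze \<boxtimes> sc c) = cze \<Zcomp> ze"
  proof -
    have "cp \<Zcomp> (cze \<boxtimes> sc c) = (cp \<Zcomp> (cze \<boxtimes> W)) \<Zcomp> sc c"
      using ten_wh[of cze "sc c"] by (simp add: wh_def cmp_assoc)
    then show ?thesis by (simp add: cp_cze cmp_assoc ax_matrix)
  qed
  have "cnj p (zr p r) (lin p (\<lambda>i. s i + c * r i) \<Zcomp> g) =
      dup p \<Zcomp> ((lin p r \<Zcomp> cze) \<boxtimes> (dup p \<Zcomp> ((lin p r \<boxtimes> lin p s) \<Zcomp> ((sc c \<boxtimes> W) \<Zcomp> (ad \<Zcomp> g)))))"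
    by (simp add: cnj_def zr_def l cmp_assoc)
  also have "\<dots> = dup p \<Zcomp> ((idn p \<boxtimes> dup p) \<Zcomp> ((lin p r \<boxtimes> lin p r \<boxtimes> lin p s) \<Zcomp> (cze \<boxtimes> ((sc c \<boxtimes> W) \<Zcomp> (ad \<Zcomp> g)))))"
    by (simp add: interchange g)
  also have "\<dots> = (dup p \<Zcomp> (idn p \<boxtimes> dup p)) \<Zcomp> ((lin p r \<boxtimes> lin p r \<boxtimes> lin p s) \<Zcomp> ((cze \<boxtimes> sc c \<boxtimes> W) \<Zcomp> (ad \<Zcomp> g)))"
    by (simp only: z cmp_assoc)
  also have "\<dots> = dup p \<Zcomp> (((dup p \<boxtimes> idn p) \<Zcomp> ((lin p r \<boxtimes> lin p r) \<boxtimes> lin p s)) \<Zcomp> ((cze \<boxtimes> sc c \<boxtimes> W) \<Zcomp> (ad \<Zcomp> g)))"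
    by (simp only: dup_assoc[symmetric] cmp_assoc ten_assoc)
  also have "(dup p \<boxtimes> idn p) \<Zcomp> ((lin p r \<boxtimes> lin p r) \<boxtimes> lin p s) = (lin p r \<Zcomp> cp) \<boxtimes> lin p s"
    using lin_simps(1)[of p r] by (simp add: interchange cart_def)
  also have "\<dots> = (lin p r \<boxtimes> lin p s) \<Zcomp> (cp \<boxtimes> W)"
    by (simp add: interchange)
  also have "dup p \<Zcomp> ((lin p r \<boxtimes> lin p s) \<Zcomp> (cp \<boxtimes> W) \<Zcomp> ((cze \<boxtimes> sc c \<boxtimes> W) \<Zcomp> (ad \<Zcomp> g))) =
     dup p \<Zcomp> ((lin p r \<boxtimes> lin p s) \<Zcomp> (((cp \<boxtimes> W) \<Zcomp> ((cze \<boxtimes> sc c) \<boxtimes> W)) \<Zcomp> (ad \<Zcomp> g)))"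
    by (simp only: cmp_assoc ten_assoc)
  also have "(cp \<boxtimes> W) \<Zcomp> ((cze \<boxtimes> sc c) \<boxtimes> W) = (cze \<boxtimes> W) \<Zcomp> (ze \<boxtimes> W)"
    by (simp add: interchange c)
  also have "(cze \<boxtimes> W) \<Zcomp> (ze \<boxtimes> W) \<Zcomp> (ad \<Zcomp> g) = (cze \<boxtimes> W) \<Zcomp> (((ze \<boxtimes> W) \<Zcomp> ad) \<Zcomp> g)"
    by (simp only: cmp_assoc)
  also have "\<dots> = cze \<boxtimes> g"
    using ten_wh[of cze g] g by (simp add: ax_matrix wh_def)
  also have "dup p \<Zcomp> ((lin p r \<boxtimes> lin p s) \<Zcomp> (cze \<boxtimes> g)) = cnj p (zr p r) (lin p s \<Zcomp> g)"
    using g by (simp add: cnj_def zr_def interchange)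
  finally show ?thesis .
qed

lemma zr_shear: "cnj p (zr p r) (zr p (\<lambda>i. s i + c * r i)) = cnj p (zr p r) (zr p s)"
  using test_shear[of cze p r s c] by (simp add: zr_def eff_def)

lemma zr_nr_shear: "cnj p (zr p r) (nr p (\<lambda>i. s i + c * r i)) = cnj p (zr p r) (nr p s)"
  using test_shear[of cnu p r s c] by (simp add: nr_def eff_def)

lemma zr_multiple: "cnj p (zr p r) (zr p (\<lambda>i. c * r i)) = zr p r"
  using zr_shear[of p r "\<lambda>_. 0" c] by simp

lemma zr_scale: "c \<noteq> 0 \<Longrightarrow> zr p (\<lambda>i. c * r i) = zr p r"
  using zr_multiple[of p r c] zr_multiple[of p "\<lambda>i. c * r i" "1 / c"] cnj_comm[of p "zr p r" "zr p (\<lambda>i. c * r i)"]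
  by simp

lemma zr_combination:
  "cnj p (cnj p (zr p r) (zr p s)) (zr p (\<lambda>i. a * r i + b * s i)) = cnj p (zr p r) (zr p s)"
proof -
  have "cnj p (zr p s) (zr p (\<lambda>i. a * r i + b * s i)) = cnj p (zr p s) (zr p (\<lambda>i. a * r i))"
    by (rule zr_shear)
  then show ?thesis
    by (simp add: cnj_assoc) (simp add: cnj_left_comm[of p "zr p r" "zr p s"] zr_multiple cnj_comm[of p "zr p s" "zr p r"])
qed

text \<open>Each pair of forms lies in the span of the other because the determinant is nonzero, so
  by \<open>zr_combination\<close> both conjunctions equal the conjunction of all four
  constraints.\<close>

lemma zr_change_basis:
  assumes "a * d - b * c \<noteq> 0"
  shows "cnj p (zr p (\<lambda>i. a * r i + b * s i)) (zr p (\<lambda>i. c * r i + d * s i)) = cnj p (zr p r) (zr p s)"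
proof -
  define D where "D = a * d - b * c"
  define u where "u = (\<lambda>i. a * r i + b * s i)"
  define v where "v = (\<lambda>i. c * r i + d * s i)"
  have D: "D \<noteq> 0" using assms by (simp add: D_def)
  have r: "r = (\<lambda>i. (d / D) * u i + (- b / D) * v i)"
    by (rule ext) (use D in \<open>simp add: u_def v_def field_simps\<close>, simp add: D_def algebra_simps)
  have s: "s = (\<lambda>i. (- c / D) * u i + (a / D) * v i)"
    by (rule ext) (use D in \<open>simp add: u_def v_def field_simps\<close>, simp add: D_def algebra_simps)
  have "cnj p (zr p r) (zr p s) = cnj p (cnj p (cnj p (zr p r) (zr p s)) (zr p u)) (zr p v)"
    unfolding u_def v_def zr_combination ..
  also have "\<dots> = cnj p (cnj p (cnj p (zr p u) (zr p v)) (zr p r)) (zr p s)"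
    by (simp add: cnj_assoc cnj_left_comm[of p "zr p s" "zr p u"] cnj_left_comm[of p "zr p r" "zr p u"]
        cnj_comm[of p "zr p s" "zr p v"] cnj_left_comm[of p "zr p r" "zr p v"])
  also have "\<dots> = cnj p (zr p u) (zr p v)"
    unfolding arg_cong[OF r, of "zr p"] arg_cong[OF s, of "zr p"] by (simp only: zr_combination)
  finally show ?thesis by (simp add: u_def v_def)
qed

lemma lin_pad: "r p = 0 \<Longrightarrow> lin (Suc p) r = lin p r \<boxtimes> dl"
proof -
  assume "r p = 0"
  then have "lin (Suc p) r = (lin p r \<boxtimes> (dl \<Zcomp> ze)) \<Zcomp> ad"
    by (simp add: ax_matrix)
  also have "lin p r \<boxtimes> (dl \<Zcomp> ze) = (lin p r \<boxtimes> dl) \<Zcomp> (W \<boxtimes> ze)"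
    by (simp add: interchange)
  finally show ?thesis by (simp add: cmp_assoc ze_ad_right)
qed

lemma lin_pad_cmp: "r p = 0 \<Longrightarrow> eff 1 g \<Longrightarrow> lin (Suc p) r \<Zcomp> g = (lin p r \<Zcomp> g) \<boxtimes> dl"
  using interchange[of "lin p r" g dl "idn 0"] by (simp add: lin_pad eff_def del: lin.simps)

lemma zr_pad: "r p = 0 \<Longrightarrow> zr (Suc p) r = zr p r \<boxtimes> dl"
  by (simp only: zr_def, rule lin_pad_cmp) (simp_all add: eff_def)

lemma nr_pad: "r p = 0 \<Longrightarrow> nr (Suc p) r = nr p r \<boxtimes> dl"
  by (simp only: nr_def, rule lin_pad_cmp) (simp_all add: eff_def)

section \<open>The rotation axiom for rows\<close>

lemma cnu_flip: "cnu = (W \<boxtimes> nu) \<Zcomp> cap1"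
proof -
  have "cnu = (nu \<boxtimes> W) \<Zcomp> (sw1 \<Zcomp> ccp) \<Zcomp> dl"
    by (simp add: cnu_def cap1_def ax_linear cmp_assoc)
  also have "\<dots> = ((nu \<boxtimes> W) \<Zcomp> sw1) \<Zcomp> (ccp \<Zcomp> dl)" by (simp only: cmp_assoc)
  also have "(nu \<boxtimes> W) \<Zcomp> sw1 = W \<boxtimes> nu"
    using sw_natural[of nu 0 1 W 1 1] by simp
  finally show ?thesis by (simp add: cap1_def)
qed

text \<open>The additional variable is supplied by \<open>nu\<close>, and its coefficient -1 makes
  the constraint say that it equals the form.\<close>

lemma nr_eq_plug: "nr p r = (idn p \<boxtimes> nu) \<Zcomp> zr (Suc p) (r(p := - 1))"
proof -
  have "nr p r = (lin p r \<Zcomp> (W \<boxtimes> nu)) \<Zcomp> ((W \<boxtimes> sc (-1)) \<Zcomp> (ad \<Zcomp> cze))"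
    by (simp add: nr_def cnu_flip cap1_eq cmp_assoc)
  also have "lin p r \<Zcomp> (W \<boxtimes> nu) = (idn p \<boxtimes> nu) \<Zcomp> (lin p r \<boxtimes> W)"
    using ten_wh[of "lin p r" nu] ten_wh'[of "lin p r" nu] by (simp add: wh_def)
  also have "(idn p \<boxtimes> nu) \<Zcomp> (lin p r \<boxtimes> W) \<Zcomp> ((W \<boxtimes> sc (-1)) \<Zcomp> (ad \<Zcomp> cze)) =
     (idn p \<boxtimes> nu) \<Zcomp> (((lin p r \<boxtimes> W) \<Zcomp> (W \<boxtimes> sc (-1))) \<Zcomp> (ad \<Zcomp> cze))"
    by (simp only: cmp_assoc)
  also have "(lin p r \<boxtimes> W) \<Zcomp> (W \<boxtimes> sc (-1)) = lin p (r(p := -1)) \<boxtimes> sc (-1)"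
    by (simp add: interchange cong: lin_cong)
  finally show ?thesis by (simp add: zr_def cmp_assoc)
qed

text \<open>Each cost gets a variable of its own, \<open>Suc p\<close> for \<open>r\<close> and
  \<open>p\<close> for \<open>s\<close>, with coefficient 0 in the other row. This produces the pair
  \<open>nu \<boxtimes> nu\<close> that (RI) needs.\<close>

lemma nr_nr_eq_plug:
  "cnj p (nr p r) (nr p s) = (idn p \<boxtimes> nu \<boxtimes> nu) \<Zcomp>
     cnj (Suc (Suc p)) (zr (Suc (Suc p)) (r(p := 0, Suc p := - 1))) (zr (Suc (Suc p)) (s(p := - 1, Suc p := 0)))"
proof -
  let ?s = "zr (Suc p) (s(p := -1))"
  have "cnj p (nr p r) (nr p s) = (idn p \<boxtimes> nu) \<Zcomp> cnj (Suc p) (nr p r \<boxtimes> dl) ?s"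
    by (simp add: nr_eq_plug[of p s] plug_cnj_pad)
  also have "nr p r \<boxtimes> dl = nr (Suc p) (r(p := 0))"
    by (simp add: nr_pad cong: nr_cong)
  also have "\<dots> = (idn (Suc p) \<boxtimes> nu) \<Zcomp> zr (Suc (Suc p)) (r(p := 0, Suc p := - 1))"
    by (rule nr_eq_plug)
  also have "cnj (Suc p) \<dots> ?s = cnj (Suc p) ?s \<dots>"
    by (rule cnj_comm) simp_all
  also have "\<dots> = (idn (Suc p) \<boxtimes> nu) \<Zcomp> cnj (Suc (Suc p)) (?s \<boxtimes> dl) (zr (Suc (Suc p)) (r(p := 0, Suc p := - 1)))"
    by (simp add: plug_cnj_pad)
  also have "?s \<boxtimes> dl = zr (Suc (Suc p)) (s(p := -1, Suc p := 0))"
    by (simp add: zr_pad cong: zr_cong)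
  also have "cnj (Suc (Suc p)) \<dots> (zr (Suc (Suc p)) (r(p := 0, Suc p := - 1))) =
     cnj (Suc (Suc p)) (zr (Suc (Suc p)) (r(p := 0, Suc p := - 1))) (zr (Suc (Suc p)) (s(p := -1, Suc p := 0)))"
    by (rule cnj_comm) simp_all
  also have "(idn p \<boxtimes> nu) \<Zcomp> ((idn (Suc p) \<boxtimes> nu) \<Zcomp> X) = (idn p \<boxtimes> nu \<boxtimes> nu) \<Zcomp> X" for X
  proof -
    have "(idn p \<boxtimes> nu) \<Zcomp> (idn (Suc p) \<boxtimes> nu) = idn p \<boxtimes> (nu \<Zcomp> (W \<boxtimes> nu))"
      by (simp add: ten_cmp_left ten_assoc[symmetric] idn_ten_idn)
    also have "nu \<Zcomp> (W \<boxtimes> nu) = nu \<boxtimes> nu"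
      using ten_wh[of nu nu] by (simp add: wh_def)
    finally show ?thesis by (simp add: cmp_assoc[symmetric])
  qed
  finally show ?thesis .
qed

lemma rot_types [simp]: "ok (rot \<phi>)" "dm (rot \<phi>) = 2" "cd (rot \<phi>) = 2"
  by (simp_all add: rot_def del: dup.simps)

lemma cart_rot: "cart (rot \<phi>)"
  unfolding rot_def
  by (intro cart_cmp cart_ten cart_gen cart_dup) (simp_all del: dup.simps)

lemma lin_2: "lin (Suc (Suc 0)) r = (sc (r 0) \<boxtimes> sc (r 1)) \<Zcomp> ad"
  by (simp only: lin.simps(2)[of "Suc 0"] lin_1) simp

lemma rot_lin: "rot \<phi> \<Zcomp> lin 2 r =
    lin 2 (\<lambda>i. if i = 0 then r 0 * cos \<phi> + r 1 * sin \<phi> else r 1 * cos \<phi> - r 0 * sin \<phi>)"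
proof -
  define u where "u = (\<lambda>i::nat. if i = 0 then cos \<phi> else - sin \<phi>)"
  define v where "v = (\<lambda>i::nat. if i = 0 then sin \<phi> else cos \<phi>)"
  have "rot \<phi> = dup 2 \<Zcomp> (lin 2 u \<boxtimes> lin 2 v)"
    by (simp add: rot_def lin_2 u_def v_def del: dup.simps lin.simps)
  then have "rot \<phi> \<Zcomp> lin 2 r = dup 2 \<Zcomp> (((lin 2 u \<boxtimes> lin 2 v) \<Zcomp> (sc (r 0) \<boxtimes> sc (r 1))) \<Zcomp> ad)"
    by (simp add: lin_2[of r] cmp_assoc del: dup.simps lin.simps)
  also have "(lin 2 u \<boxtimes> lin 2 v) \<Zcomp> (sc (r 0) \<boxtimes> sc (r 1)) = (lin 2 u \<Zcomp> sc (r 0)) \<boxtimes> (lin 2 v \<Zcomp> sc (r 1))"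
    by (rule interchange) (simp_all del: lin.simps)
  finally show ?thesis
    by (simp only: lin_scale lin_add) (rule lin_cong, simp add: u_def v_def algebra_simps)
qed

lemma wh_rot_zr: "(idn p \<boxtimes> rot \<phi>) \<Zcomp> zr (Suc (Suc p)) r =
    zr (Suc (Suc p)) (r(p := r p * cos \<phi> + r (Suc p) * sin \<phi>, Suc p := r (Suc p) * cos \<phi> - r p * sin \<phi>))"
  (is "_ = zr _ ?r")
proof -
  have "(idn p \<boxtimes> rot \<phi>) \<Zcomp> lin (p + 2) r = (lin p r \<boxtimes> (rot \<phi> \<Zcomp> lin 2 (\<lambda>i. r (p + i)))) \<Zcomp> ad"
    unfolding lin_split by (simp add: cmp_assoc[symmetric] interchange del: lin.simps)
  also have "\<dots> = (lin p ?r \<boxtimes> lin 2 (\<lambda>i. ?r (p + i))) \<Zcomp> ad"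
    unfolding rot_lin by (intro arg_cong2[where f = cmp] arg_cong2[where f = ten] lin_cong refl) auto
  finally have "(idn p \<boxtimes> rot \<phi>) \<Zcomp> lin (p + 2) r = lin (p + 2) ?r"
    by (simp only: lin_split)
  then show ?thesis by (simp add: zr_def cmp_assoc[symmetric] del: lin.simps)
qed

lemma nr_rotate:
  "cnj p (nr p (\<lambda>i. cos \<phi> * r i - sin \<phi> * s i)) (nr p (\<lambda>i. sin \<phi> * r i + cos \<phi> * s i)) =
    cnj p (nr p r) (nr p s)"
proof -
  let ?p = "Suc (Suc p)"
  let ?u = "r(p := 0, Suc p := - 1)" and ?v = "s(p := - 1, Suc p := 0)"
  let ?u' = "(\<lambda>i. cos \<phi> * r i - sin \<phi> * s i)(p := 0, Suc p := - 1)"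
  let ?v' = "(\<lambda>i. sin \<phi> * r i + cos \<phi> * s i)(p := - 1, Suc p := 0)"
  \<comment> \<open>(RI) inserts a rotation for free. With the opposite angle, its action on the two
    added coefficients agrees with recombining the original rows by cos and sin, and
    \<open>zr_change_basis\<close> undoes that recombination.\<close>
  have nn: "idn p \<boxtimes> nu \<boxtimes> nu = (idn p \<boxtimes> nu \<boxtimes> nu) \<Zcomp> (idn p \<boxtimes> rot (- \<phi>))"
    using interchange[of "idn p" "idn p" "nu \<boxtimes> nu" "rot (- \<phi>)"] by (simp add: ax_affine)
  have cr: "cart (idn p \<boxtimes> rot (- \<phi>))" by (intro cart_ten cart_idn cart_rot)
  have "cnj p (nr p (\<lambda>i. cos \<phi> * r i - sin \<phi> * s i)) (nr p (\<lambda>i. sin \<phi> * r i + cos \<phi> * s i)) =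
     (idn p \<boxtimes> nu \<boxtimes> nu) \<Zcomp> ((idn p \<boxtimes> rot (- \<phi>)) \<Zcomp> cnj ?p (zr ?p ?u') (zr ?p ?v'))"
    by (simp only: nr_nr_eq_plug cmp_assoc[symmetric] nn[symmetric])
  also have "(idn p \<boxtimes> rot (- \<phi>)) \<Zcomp> cnj ?p (zr ?p ?u') (zr ?p ?v') =
      cnj ?p ((idn p \<boxtimes> rot (- \<phi>)) \<Zcomp> zr ?p ?u') ((idn p \<boxtimes> rot (- \<phi>)) \<Zcomp> zr ?p ?v')"
    by (subst cart_cnj[OF cr]) simp_all
  also have "\<dots> = cnj ?p (zr ?p (\<lambda>i. cos \<phi> * ?u i + (- sin \<phi>) * ?v i)) (zr ?p (\<lambda>i. sin \<phi> * ?u i + cos \<phi> * ?v i))"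
    unfolding wh_rot_zr
    by (intro arg_cong2[where f = "cnj ?p"] zr_cong) (auto simp: fun_upd_def)
  also have "\<dots> = cnj ?p (zr ?p ?u) (zr ?p ?v)"
    by (rule zr_change_basis) simp
  finally show ?thesis by (simp only: nr_nr_eq_plug)
qed

section \<open>Every effect has a normal form\<close>

text \<open>A row \<open>(b, r)\<close> stands for the constraint \<open>r \<bullet> x = 0\<close> if \<open>b\<close> holds and for the
  cost \<open>(r \<bullet> x)\<^sup>2 / 2\<close> otherwise.\<close>

type_synonym row = "bool \<times> (nat \<Rightarrow> real)"

definition ef :: "nat \<Rightarrow> row \<Rightarrow> arr" where
  "ef p x = (if fst x then zr p (snd x) else nr p (snd x))"

primrec effs :: "nat \<Rightarrow> row list \<Rightarrow> arr" where
  "effs p [] = del p"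
| "effs p (x # L) = cnj p (ef p x) (effs p L)"

lemma eff_ef [simp]: "eff p (ef p x)"
  by (simp add: ef_def)

lemma eff_effs [simp]: "eff p (effs p L)"
  by (induction L) simp_all

lemma types_effs [simp]: "ok (effs p L)" "dm (effs p L) = p" "cd (effs p L) = 0"
  using eff_effs[of p L] by (auto simp: eff_def simp del: eff_effs)

lemma ef_pad: "snd x p = 0 \<Longrightarrow> ef (Suc p) x = ef p x \<boxtimes> dl"
  by (simp add: ef_def zr_pad nr_pad)

text \<open>Normalised so that weights determine the last coefficient: a constraint is fixed only up
  to a nonzero factor, a cost only up to sign. A cost with last coefficient 0 stands for the absence
  of the last variable.\<close>

definition last_normal :: "nat \<Rightarrow> row \<Rightarrow> bool" where
  "last_normal p x \<longleftrightarrow> (if fst x then snd x p = 1 else 0 \<le> snd x p)"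

text \<open>One elimination step: the pivot \<open>x\<close> takes in a further row \<open>y\<close>
  and gives back a row free of the last variable. A constraint that involves the variable is
  preferred as pivot, since it clears rows of either kind by shearing; two costs have to be
  rotated.\<close>

lemma ef_merge:
  assumes "last_normal p x"
  shows "\<exists>x' y'. last_normal p x' \<and> snd y' p = 0 \<and>
    cnj (Suc p) (ef (Suc p) y) (ef (Suc p) x) = cnj (Suc p) (ef (Suc p) x') (ef (Suc p) y')"
proof -
  obtain b r where x: "x = (b, r)" by (cases x)
  obtain b' s where y: "y = (b', s)" by (cases y)
  consider "b" | "\<not> b" "b'" "s p = 0" | "\<not> b" "b'" "s p \<noteq> 0" | "\<not> b" "\<not> b'" by blast
  then show ?thesis
  proof cases
    case 1
    define y' where "y' = (b', \<lambda>i. s i + (- s p) * r i)"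
    have "cnj (Suc p) (ef (Suc p) x) (ef (Suc p) y') = cnj (Suc p) (ef (Suc p) x) (ef (Suc p) y)"
      using 1 zr_shear[of "Suc p" r s "- s p"] zr_nr_shear[of "Suc p" r s "- s p"]
      by (simp add: ef_def x y y'_def)
    moreover have "snd y' p = 0" using 1 assms by (simp add: y'_def x last_normal_def)
    ultimately show ?thesis using assms
      by (intro exI[of _ x] exI[of _ y']) (simp add: cnj_comm[of "Suc p" "ef (Suc p) y" "ef (Suc p) x"])
  next
    case 2
    then show ?thesis
      using assms cnj_comm[of "Suc p" "ef (Suc p) x" "ef (Suc p) y"] by (intro exI[of _ x] exI[of _ y]) (simp add: y)
  next
    case 3
    define s1 where "s1 = (\<lambda>i. (1 / s p) * s i)"
    define y' where "y' = (\<lambda>i. r i + (- r p) * s1 i)"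
    have "ef (Suc p) y = zr (Suc p) s1"
      using 3 by (simp add: ef_def y s1_def zr_scale del: times_divide_eq_left)
    then have "cnj (Suc p) (ef (Suc p) y) (ef (Suc p) x) = cnj (Suc p) (zr (Suc p) s1) (nr (Suc p) y')"
      using 3 by (simp only: y'_def zr_nr_shear) (simp add: x ef_def)
    also have "\<dots> = cnj (Suc p) (ef (Suc p) (True, s1)) (ef (Suc p) (False, y'))"
      by (simp add: ef_def)
    finally show ?thesis using 3
      by (intro exI[of _ "(True, s1)"] exI[of _ "(False, y')"]) (simp add: last_normal_def y'_def s1_def)
  next
    case 4
    define h where "h = sqrt ((s p)\<^sup>2 + (r p)\<^sup>2)"
    \<comment> \<open>The angle of the point with coordinates \<open>r p\<close> and
      \<open>s p\<close>. Turning by it makes the two last coefficients 0 and \<open>h\<close>, and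
      \<open>h\<close> is nonnegative as \<open>last_normal\<close> demands.\<close>
    have "\<exists>\<phi>. cos \<phi> * s p - sin \<phi> * r p = 0 \<and> 0 \<le> sin \<phi> * s p + cos \<phi> * r p"
    proof (cases "h = 0")
      case True
      then have "s p = 0" "r p = 0" by (simp_all add: h_def sum_power2_eq_zero_iff)
      then show ?thesis by simp
    next
      case False
      have h: "h * h = s p * s p + r p * r p" by (simp add: h_def)
      have "(r p / h)\<^sup>2 + (s p / h)\<^sup>2 = (s p * s p + r p * r p) / (h * h)"
        by (simp add: power_divide add_divide_distrib)
      also have "\<dots> = 1"
        unfolding h[symmetric] using False by simp
      finally have "(r p / h)\<^sup>2 + (s p / h)\<^sup>2 = 1" .
      then obtain \<phi> where \<phi>: "r p / h = cos \<phi>" "s p / h = sin \<phi>"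
        using sincos_total_2pi by metis
      have "0 \<le> h" by (simp add: h_def)
      moreover have "s p / h * s p + r p / h * r p = h"
        using False h by (simp add: field_simps)
      ultimately show ?thesis
        by (intro exI[of _ \<phi>]) (simp add: \<phi>[symmetric] field_simps)
    qed
    then obtain \<phi> where \<phi>: "cos \<phi> * s p - sin \<phi> * r p = 0" "0 \<le> sin \<phi> * s p + cos \<phi> * r p"
      by blast
    define y' where "y' = (False, \<lambda>i. cos \<phi> * s i - sin \<phi> * r i)"
    define x' where "x' = (False, \<lambda>i. sin \<phi> * s i + cos \<phi> * r i)"
    have "cnj (Suc p) (ef (Suc p) y') (ef (Suc p) x') = cnj (Suc p) (ef (Suc p) y) (ef (Suc p) x)"
      using 4 by (simp add: ef_def x y x'_def y'_def nr_rotate)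
    moreover have "snd y' p = 0" "last_normal p x'" using \<phi> by (simp_all add: y'_def x'_def last_normal_def)
    ultimately show ?thesis
      by (intro exI[of _ x'] exI[of _ y']) (simp add: cnj_comm[of "Suc p" "ef (Suc p) x'" "ef (Suc p) y'"])
  qed
qed

lemma effs_reduce:
  "\<exists>x L0. last_normal p x \<and> effs (Suc p) L = cnj (Suc p) (ef (Suc p) x) (effs p L0 \<boxtimes> dl)"
proof (induction L)
  case Nil
  \<comment> \<open>The initial pivot is the cost of the zero form, which is trivial by (Z).\<close>
  have "ef (Suc p) (False, \<lambda>_. 0) = del (Suc p)"
    by (simp add: ef_def del: del.simps)
  then have "effs (Suc p) [] = cnj (Suc p) (ef (Suc p) (False, \<lambda>_. 0)) (effs p [] \<boxtimes> dl)"
    by (simp only: cnj_del_right[OF eff_del] effs.simps del.simps[symmetric])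
  then show ?case
    by (intro exI[of _ "(False, \<lambda>_. 0)"] exI[of _ "[]"]) (simp add: last_normal_def)
next
  case (Cons y L)
  then obtain x L0 where x: "last_normal p x" and
    L: "effs (Suc p) L = cnj (Suc p) (ef (Suc p) x) (effs p L0 \<boxtimes> dl)" by blast
  obtain x' y' where x': "last_normal p x'" and y': "snd y' p = 0" and
    m: "cnj (Suc p) (ef (Suc p) y) (ef (Suc p) x) = cnj (Suc p) (ef (Suc p) x') (ef (Suc p) y')"
    using ef_merge[OF x] by blast
  have "effs (Suc p) (y # L) = cnj (Suc p) (cnj (Suc p) (ef (Suc p) y) (ef (Suc p) x)) (effs p L0 \<boxtimes> dl)"
    by (simp add: L cnj_assoc)
  also have "\<dots> = cnj (Suc p) (ef (Suc p) x') (cnj (Suc p) (ef p y' \<boxtimes> dl) (effs p L0 \<boxtimes> dl))"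
    using y' by (simp add: m cnj_assoc ef_pad)
  also have "\<dots> = cnj (Suc p) (ef (Suc p) x') (effs p (y' # L0) \<boxtimes> dl)"
    by (simp add: ten_dl_cnj)
  finally show ?case using x' by blast
qed

text \<open>With a nonzero last coefficient, hiding the last variable makes the value of the whole
  form free by \<open>cdl_ad\<close>, so only \<open>cdl \<Zcomp> g\<close> remains. For constraints
  this is empty by a mirrored bialgebra law, for costs by (D).\<close>

lemma hide_lin:
  assumes "r p \<noteq> 0" "eff 1 g" "cdl \<Zcomp> g = idn 0"
  shows "(idn p \<boxtimes> cdl) \<Zcomp> (lin (Suc p) r \<Zcomp> g) = del p"
proof -
  have "(idn p \<boxtimes> cdl) \<Zcomp> (lin (Suc p) r \<Zcomp> g) = ((idn p \<boxtimes> cdl) \<Zcomp> (lin p r \<boxtimes> sc (r p))) \<Zcomp> (ad \<Zcomp> g)"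
    by (simp add: cmp_assoc)
  also have "(idn p \<boxtimes> cdl) \<Zcomp> (lin p r \<boxtimes> sc (r p)) = lin p r \<Zcomp> (W \<boxtimes> cdl)"
    using ten_wh[of "lin p r" cdl] assms by (simp add: interchange cdl_sc wh_def)
  also have "lin p r \<Zcomp> (W \<boxtimes> cdl) \<Zcomp> (ad \<Zcomp> g) = lin p r \<Zcomp> (((W \<boxtimes> cdl) \<Zcomp> ad) \<Zcomp> g)"
    by (simp only: cmp_assoc)
  also have "\<dots> = lin p r \<Zcomp> (dl \<Zcomp> (cdl \<Zcomp> g))"
    using ten_wh[of dl cdl] by (simp add: cdl_ad cmp_assoc)
  also have "\<dots> = del p"
    using cart_del[of "lin p r" 1] by (simp add: assms)
  finally show ?thesis .
qed

lemma hide_effs: "\<exists>L'. (idn p \<boxtimes> cdl) \<Zcomp> effs (Suc p) L = effs p L'"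
proof -
  obtain x L0 where x: "last_normal p x" and
    L: "effs (Suc p) L = cnj (Suc p) (ef (Suc p) x) (effs p L0 \<boxtimes> dl)"
    using effs_reduce by blast
  have "(idn p \<boxtimes> cdl) \<Zcomp> effs (Suc p) L = (idn p \<boxtimes> cdl) \<Zcomp> cnj (Suc p) (effs p L0 \<boxtimes> dl) (ef (Suc p) x)"
    unfolding L by (subst cnj_comm) simp_all
  also have "\<dots> = cnj p (effs p L0) ((idn p \<boxtimes> cdl) \<Zcomp> ef (Suc p) x)"
    by (rule plug_cnj_pad) simp_all
  finally have *: "(idn p \<boxtimes> cdl) \<Zcomp> effs (Suc p) L = cnj p (effs p L0) ((idn p \<boxtimes> cdl) \<Zcomp> ef (Suc p) x)" .
  show ?thesis
  proof (cases "snd x p = 0")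
    case True
    \<comment> \<open>The pivot ignores the hidden variable, which then meets only \<open>dl\<close>
      and vanishes by \<open>copy_bone\<close>; the pivot itself survives as a row.\<close>
    then have "(idn p \<boxtimes> cdl) \<Zcomp> ef (Suc p) x = (idn p \<boxtimes> cdl) \<Zcomp> (ef p x \<boxtimes> dl)"
      by (simp add: ef_pad)
    also have "\<dots> = ef p x"
      using eff_ef[of p x] interchange[of "idn p" "ef p x" cdl dl] by (simp add: eff_def ax_linear)
    finally have "(idn p \<boxtimes> cdl) \<Zcomp> effs (Suc p) L = effs p (x # L0)"
      by (simp add: * cnj_comm)
    then show ?thesis by blast
  next
    case False
    then have "(idn p \<boxtimes> cdl) \<Zcomp> ef (Suc p) x = del p"
      by (simp add: ef_def zr_def nr_def hide_lin eff_def ax_linear cdl_cnu del: lin.simps)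
    then show ?thesis by (auto simp: *)
  qed
qed

section \<open>Pulling rows back along arrows\<close>

lemma pull_ef:
  assumes "linear f" "cd f = p" shows "\<exists>y. f \<Zcomp> ef p x = ef (dm f) y"
proof -
  obtain r where "f \<Zcomp> lin p (snd x) = lin (dm f) r"
    using assms by (auto simp: linear_def)
  then have "f \<Zcomp> ef p x = ef (dm f) (fst x, r)"
    by (simp add: ef_def zr_def nr_def cmp_assoc[symmetric])
  then show ?thesis by blast
qed

lemma pull_effs:
  assumes "linear f" "cd f = p" shows "\<exists>L'. f \<Zcomp> effs p L = effs (dm f) L'"
proof (induction L)
  case Nil
  have "f \<Zcomp> effs p [] = effs (dm f) []"
    using assms by (simp add: linear_def cart_del)
  then show ?case by blast
next
  case (Cons x L)
  then obtain L' where L': "f \<Zcomp> effs p L = effs (dm f) L'" by blast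
  obtain y where y: "f \<Zcomp> ef p x = ef (dm f) y" using pull_ef[OF assms] by blast
  have "f \<Zcomp> effs p (x # L) = effs (dm f) (y # L')"
    using assms by (simp add: linear_def cart_cnj L' y)
  then show ?case by blast
qed

lemma lin_unit: "lin (Suc p) (\<lambda>i. if i = p then 1 else 0) = del p \<boxtimes> W"
proof -
  have "lin (Suc p) (\<lambda>i. if i = p then 1 else 0) = (lin p (\<lambda>_. 0) \<boxtimes> sc 1) \<Zcomp> ad"
    by (simp cong: lin_cong)
  also have "lin p (\<lambda>_. 0) \<boxtimes> sc 1 = (del p \<boxtimes> W) \<Zcomp> (ze \<boxtimes> W)"
    using interchange[of "del p" ze W W] by (simp add: lin_0 ax_matrix(15))
  finally show ?thesis by (simp add: cmp_assoc ax_matrix)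
qed

lemma effs_ten_test:
  assumes "g = cze \<or> g = cnu" shows "\<exists>L'. effs p L \<boxtimes> g = effs (Suc p) L'"
proof -
  have "linear (idn p \<boxtimes> dl)" by (intro linear_ten linear_idn linear_gen)
  from pull_effs[OF this, of p L] obtain L1 where L1: "(idn p \<boxtimes> dl) \<Zcomp> effs p L = effs (Suc p) L1"
    by auto
  have "(idn p \<boxtimes> dl) \<Zcomp> effs p L = effs p L \<boxtimes> dl"
    using ten_wh'[of "effs p L" dl] by (simp add: wh_def)
  with L1 have 1: "effs p L \<boxtimes> dl = effs (Suc p) L1" by simp
  \<comment> \<open>The flag \<open>g = cze\<close> chooses the kind of row; its form is the
    coordinate of the new wire.\<close>
  define x where "x = (g = cze, \<lambda>i. if i = p then 1 else (0::real))"
  have gs: "eff 1 g" using assms by (auto simp: eff_def)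
  have 2: "del p \<boxtimes> g = ef (Suc p) x"
    using assms gs interchange[of "del p" "idn 0" W g]
    by (auto simp: x_def ef_def zr_def nr_def lin_unit eff_def simp del: lin.simps)
  have "effs p L \<boxtimes> g = effs (Suc p) (x # L1)"
    unfolding ten_eff_wire[OF eff_effs gs] 1 2 by (simp add: cnj_comm)
  then show ?thesis by blast
qed

definition aff :: "nat \<Rightarrow> arr \<Rightarrow> bool" where
  "aff p e \<longleftrightarrow> (\<exists>L. e = (idn p \<boxtimes> on) \<Zcomp> effs (Suc p) L)"

text \<open>Asking for stability in every context of idle wires makes the property pass to tensors
  as well as to composites, so that only generators remain to be checked.\<close>

definition good :: "arr \<Rightarrow> bool" where
  "good f \<longleftrightarrow> ok f \<and> (\<forall>j k e. aff (j + cd f + k) e \<longrightarrow> aff (j + dm f + k) (wh j f k \<Zcomp> e))"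

lemma good_cmp: "good f \<Longrightarrow> good g \<Longrightarrow> cd f = dm g \<Longrightarrow> good (f \<Zcomp> g)"
  by (simp add: good_def wh_cmp cmp_assoc)

lemma good_wh: "good f \<Longrightarrow> good (wh j f k)"
proof -
  assume f: "good f"
  have "aff (j' + (j + dm f + k) + k') (wh j' (wh j f k) k' \<Zcomp> e)"
    if "aff (j' + (j + cd f + k) + k') e" for j' k' e
  proof -
    have "aff ((j' + j) + cd f + (k + k')) e" using that by (simp add: add.assoc)
    then have "aff ((j' + j) + dm f + (k + k')) (wh (j' + j) f (k + k') \<Zcomp> e)"
      using f unfolding good_def by blast
    then show ?thesis by (simp add: wh_wh add.assoc)
  qed
  with f show ?thesis by (simp add: good_def)
qed

lemma good_ten: "good f \<Longrightarrow> good g \<Longrightarrow> good (f \<boxtimes> g)"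
  unfolding ten_wh by (rule good_cmp[OF good_wh good_wh]) (auto simp: good_def)

text \<open>Moves the constant wire, which is kept last, past a whiskered arrow.\<close>

lemma goodI:
  assumes "ok f"
    and "\<And>j k L. \<exists>L'. wh j f (Suc k) \<Zcomp> effs (j + cd f + Suc k) L = effs (j + dm f + Suc k) L'"
  shows "good f"
  unfolding good_def
proof (intro conjI allI impI assms(1))
  fix j k e
  assume "aff (j + cd f + k) e"
  then obtain L where e: "e = (idn (j + cd f + k) \<boxtimes> on) \<Zcomp> effs (Suc (j + cd f + k)) L"
    by (auto simp: aff_def)
  obtain L' where L': "wh j f (Suc k) \<Zcomp> effs (j + cd f + Suc k) L = effs (j + dm f + Suc k) L'"
    using assms(2) by blast
  have "wh j f k \<Zcomp> (idn (j + cd f + k) \<boxtimes> on) = (idn (j + dm f + k) \<boxtimes> on) \<Zcomp> wh j f (Suc k)"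
    using exchange[of f on k k 0 "j + cd f + k" j "j + dm f + k" "k + 1"] assms(1)
    by (simp add: wh_def)
  then have "wh j f k \<Zcomp> e = (idn (j + dm f + k) \<boxtimes> on) \<Zcomp> (wh j f (Suc k) \<Zcomp> effs (j + cd f + Suc k) L)"
    unfolding e by (simp add: cmp_assoc[symmetric])
  then show "aff (j + dm f + k) (wh j f k \<Zcomp> e)"
    unfolding L' aff_def by auto
qed

lemma good_linear: "linear f \<Longrightarrow> good f"
proof (rule goodI)
  assume f: "linear f"
  then show "ok f" by (simp add: linear_def cart_ok)
  show "\<exists>L'. wh j f (Suc k) \<Zcomp> effs (j + cd f + Suc k) L = effs (j + dm f + Suc k) L'" for j k L
    using pull_effs[OF linear_wh[OF f], of j "Suc k"] \<open>ok f\<close> by simp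
qed

text \<open>\<open>hide_effs\<close> hides the last wire only. The hidden wire is therefore created
  in last position and crossed into place, and the crossing, being linear, pulls rows back to
  rows.\<close>

lemma good_cdl: "good cdl"
proof (rule goodI)
  fix j k L
  have "wh j cdl (Suc k) = (idn (j + Suc k) \<boxtimes> cdl) \<Zcomp> wh j (sw (Suc k) 1) 0"
  proof -
    have "wh 0 cdl (Suc k) = wh (Suc k) cdl 0 \<Zcomp> sw (Suc k) 1"
      using sw_natural_right[of cdl 0 1 "Suc k"] by simp
    then have "wh j (wh 0 cdl (Suc k)) 0 = wh j (wh (Suc k) cdl 0 \<Zcomp> sw (Suc k) 1) 0" by simp
    then show ?thesis by (simp add: wh_wh wh_cmp idn_ten_wh)
  qed
  moreover obtain L1 where "wh j (sw (Suc k) 1) 0 \<Zcomp> effs (j + cd cdl + Suc k) L = effs (Suc (j + Suc k)) L1"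
    using pull_effs[OF linear_wh[OF linear_sw], of j "Suc k" 1 0 "j + cd cdl + Suc k" L] by auto
  moreover obtain L2 where "(idn (j + Suc k) \<boxtimes> cdl) \<Zcomp> effs (Suc (j + Suc k)) L1 = effs (j + Suc k) L2"
    using hide_effs by blast
  ultimately have "wh j cdl (Suc k) \<Zcomp> effs (j + cd cdl + Suc k) L = effs (j + Suc k) L2"
    by (simp only: cmp_assoc)
  then show "\<exists>L'. wh j cdl (Suc k) \<Zcomp> effs (j + cd cdl + Suc k) L = effs (j + dm cdl + Suc k) L'"
    by auto
qed simp

lemma good_test:
  assumes g: "g = cze \<or> g = cnu" shows "good g"
proof (rule goodI)
  show ok: "ok g" using g by auto
  fix j k L
  have t: "ok g" "dm g = 1" "cd g = 0" using g by auto
  have "wh j g (Suc k) = wh j (sw 1 (Suc k)) 0 \<Zcomp> (idn (j + Suc k) \<boxtimes> g)"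
  proof -
    have "wh 0 g (Suc k) = sw 1 (Suc k) \<Zcomp> wh (Suc k) g 0"
      using sw_natural_left[of g 1 0 "Suc k"] t by simp
    then have "wh j (wh 0 g (Suc k)) 0 = wh j (sw 1 (Suc k) \<Zcomp> wh (Suc k) g 0) 0" by simp
    then show ?thesis using t by (simp add: wh_wh wh_cmp idn_ten_wh)
  qed
  moreover have "(idn (j + Suc k) \<boxtimes> g) \<Zcomp> effs (j + Suc k) L = effs (j + Suc k) L \<boxtimes> g"
    using ten_wh'[of "effs (j + Suc k) L" g] t by (simp add: wh_def)
  moreover obtain L1 where "effs (j + Suc k) L \<boxtimes> g = effs (Suc (j + Suc k)) L1"
    using effs_ten_test[OF g] by blast
  moreover obtain L2 where "wh j (sw 1 (Suc k)) 0 \<Zcomp> effs (Suc (j + Suc k)) L1 = effs (j + 1 + Suc k) L2"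
    using pull_effs[OF linear_wh[OF linear_sw], of j 1 "Suc k" 0 "Suc (j + Suc k)" L1] by auto
  ultimately have "wh j g (Suc k) \<Zcomp> effs (j + Suc k) L = effs (j + 1 + Suc k) L2"
    by (simp only: cmp_assoc)
  then show "\<exists>L'. wh j g (Suc k) \<Zcomp> effs (j + cd g + Suc k) L = effs (j + dm g + Suc k) L'"
    using t by auto
qed

text \<open>A second constant wire is a copy of the last one.\<close>

lemma good_on: "good on"
  unfolding good_def
proof (intro conjI allI impI)
  fix j k e
  assume "aff (j + cd on + k) e"
  then obtain L where e: "e = wh (j + 1 + k) on 0 \<Zcomp> effs (Suc (j + 1 + k)) L"
    by (auto simp: aff_def idn_ten_wh)
  have 1: "wh j on k = wh (j + k) on 0 \<Zcomp> wh j (sw k 1) 0"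
  proof -
    have "wh 0 on k = wh k on 0 \<Zcomp> sw k 1"
      using sw_natural_right[of on 0 1 k] by simp
    then have "wh j (wh 0 on k) 0 = wh j (wh k on 0 \<Zcomp> sw k 1) 0" by simp
    then show ?thesis by (simp add: wh_wh wh_cmp)
  qed
  have 2: "wh j (sw k 1) 0 \<Zcomp> wh (j + 1 + k) on 0 = wh (j + k + 1) on 0 \<Zcomp> wh j (sw k 1) 1"
    using exchange[of "sw k 1" on 0 0 0 "j + 1 + k" j "j + k + 1" 1] by simp
  have 3: "wh (j + k) on 0 \<Zcomp> wh (j + k + 1) on 0 = wh (j + k) on 0 \<Zcomp> wh (j + k) cp 0"
  proof -
    have "on \<Zcomp> wh 1 on 0 = on \<boxtimes> on" using ten_wh[of on on] by simp
    then have "wh (j + k) (on \<Zcomp> wh 1 on 0) 0 = wh (j + k) (on \<Zcomp> cp) 0" by (simp add: ax_affine)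
    then show ?thesis by (simp add: wh_wh wh_cmp)
  qed
  have "wh j on k \<Zcomp> e = wh (j + k) on 0 \<Zcomp> ((wh j (sw k 1) 0 \<Zcomp> wh (j + 1 + k) on 0) \<Zcomp> effs (Suc (j + 1 + k)) L)"
    by (simp only: 1 e cmp_assoc)
  also have "\<dots> = (wh (j + k) on 0 \<Zcomp> wh (j + k + 1) on 0) \<Zcomp> (wh j (sw k 1) 1 \<Zcomp> effs (Suc (j + 1 + k)) L)"
    by (simp only: 2 cmp_assoc)
  also have "\<dots> = wh (j + k) on 0 \<Zcomp> ((wh (j + k) cp 0 \<Zcomp> wh j (sw k 1) 1) \<Zcomp> effs (Suc (j + 1 + k)) L)"
    by (simp only: 3 cmp_assoc)
  finally have e': "wh j on k \<Zcomp> e = wh (j + k) on 0 \<Zcomp> ((wh (j + k) cp 0 \<Zcomp> wh j (sw k 1) 1) \<Zcomp> effs (Suc (j + 1 + k)) L)" .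
  have "linear (wh (j + k) cp 0 \<Zcomp> wh j (sw k 1) 1)"
    by (intro linear_cmp linear_wh linear_gen linear_sw) simp
  from pull_effs[OF this, of "Suc (j + 1 + k)" L]
  obtain L' where "(wh (j + k) cp 0 \<Zcomp> wh j (sw k 1) 1) \<Zcomp> effs (Suc (j + 1 + k)) L = effs (Suc (j + k)) L'"
    by auto
  with e' show "aff (j + dm on + k) (wh j on k \<Zcomp> e)"
    by (auto simp: aff_def idn_ten_wh)
qed simp

lemma good_gen: "good (gen g)"
proof -
  have [simp]: "good W" by (rule good_linear[OF linear_idn])
  have lin: "good cp" "good dl" "good ad" "good ze" "good (sc k)" for k
    by (intro good_linear linear_gen)+
  have cze: "good cze" and cnu: "good cnu" by (auto intro: good_test)
  have cap: "good cap1"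
    unfolding cap1_eq by (intro good_cmp good_ten lin cze) simp_all
  have cup: "good cup1"
    unfolding cup1_def by (intro good_cmp good_cdl lin) simp_all
  have "good ccp"
    by (subst ccp_eq, intro good_cmp good_ten lin cap) simp_all
  moreover have "good cad"
    by (subst cad_eq, intro good_cmp good_ten lin cup) simp_all
  moreover have "good nu"
    by (subst nu_eq, intro good_cmp good_ten cnu cup) simp_all
  ultimately show ?thesis
    using lin cze good_cdl good_on by (cases g) simp_all
qed

lemma good_all: "ok f \<Longrightarrow> good f"
proof -
  assume ok: "ok f"
  define t where "t = rep_arr f"
  have f: "f = abs_arr t" by (simp add: t_def Quotient3_abs_rep[OF Quotient3_arr])
  have "good (abs_arr t)" if "composable gqa_sig t"
    using that
  proof (induction t)
    case (Seq s t)
    then have "ok (abs_arr (s \<Zsemi> t))" by (simp add: ok.abs_eq)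
    with Seq show ?case by (simp add: abs_arr_simps good_cmp)
  next
    case (Par s t)
    then show ?case by (simp add: abs_arr_simps good_ten)
  qed (simp_all add: abs_arr_simps good_gen good_linear linear_idn linear_sw)
  with ok show ?thesis by (simp add: f ok.abs_eq)
qed

lemma effect_normal_form: "eff p e \<Longrightarrow> \<exists>L. e = (idn p \<boxtimes> on) \<Zcomp> effs (Suc p) L"
proof -
  assume e: "eff p e"
  \<comment> \<open>The empty diagram is a normal form without rows, by \<open>one_discard\<close>;
    \<open>e\<close> is then pulled onto it as \<open>e \<Zcomp> idn 0\<close>.\<close>
  have "idn 0 = (idn 0 \<boxtimes> on) \<Zcomp> effs (Suc 0) []"
    by (simp add: ax_affine)
  then have "aff 0 (idn 0)" unfolding aff_def by blast
  moreover have "good e" using e by (simp add: good_all eff_def)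
  ultimately have "aff (0 + dm e + 0) (wh 0 e 0 \<Zcomp> idn 0)"
    using e unfolding good_def by (metis add_0 add.right_neutral effD(3))
  with e show ?thesis by (simp add: aff_def eff_def)
qed

declare numeral_2_eq_2 [simp del]

section \<open>Presented props\<close>

lemma (in prop_cat) eval_closed:
  assumes "\<And>g. v g \<in> p_hom P (fst (\<sigma> g)) (snd (\<sigma> g))" "composable \<sigma> t"
  shows "eval \<sigma> P v t \<in> p_hom P (src \<sigma> t) (tgt \<sigma> t)"
  using assms(2)
  by (induction t) (simp_all add: assms(1) id_closed sym_closed comp_closed tens_closed)

lemma (in prop_cat) eval_sound:
  assumes v: "\<And>g. v g \<in> p_hom P (fst (\<sigma> g)) (snd (\<sigma> g))"
    and E: "\<And>s t m n. E s t \<Longrightarrow> s \<in> diagrams \<sigma> m n \<Longrightarrow> t \<in> diagrams \<sigma> m n \<Longrightarrow> eval \<sigma> P v s = eval \<sigma> P v t"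
    and eq: "diag_eq \<sigma> E m n s t"
  shows "eval \<sigma> P v s = eval \<sigma> P v t"
proof -
  have hom: "eval \<sigma> P v t \<in> p_hom P m n" if "t \<in> diagrams \<sigma> m n" for t m n
    using eval_closed[OF v, where t = t] that by (auto simp: diagrams_def)
  have D: "composable \<sigma> t" "src \<sigma> t = m" "tgt \<sigma> t = n" if "t \<in> diagrams \<sigma> m n" for t m n
    using that by (auto simp: diagrams_def)
  have dg: "s \<in> diagrams \<sigma> m n \<and> t \<in> diagrams \<sigma> m n" if "diag_eq \<sigma> E m n s t" for m n s t
    using that by (induction rule: diag_eq.induct) (auto simp: diagrams_def)
  from eq show ?thesis
  proof (induction rule: diag_eq.induct)
    case (eq_axiom s t m n) then show ?case by (rule E)
  next
    case (eq_Seq l m s s' n t t')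
    then show ?case using dg[OF eq_Seq(1)] dg[OF eq_Seq(2)] by (simp add: diagrams_def)
  next
    case (eq_Par m n s s' m' n' t t')
    then show ?case using dg[OF eq_Par(1)] dg[OF eq_Par(2)] by (simp add: diagrams_def)
  next
    case (eq_id_left t m n) then show ?case by (simp add: D id_left hom)
  next
    case (eq_id_right t m n) then show ?case by (simp add: D id_right hom)
  next
    case (eq_Seq_assoc s k l t m u n) then show ?case by (simp add: D comp_assoc[of _ k l _ m _ n] hom)
  next
    case eq_Par_id then show ?case by (simp add: tens_id)
  next
    case (eq_interchange s l m t n s' l' m' t' n')
    then show ?case by (simp add: D interchange[of _ l m _ n _ l' m' _ n'] hom)
  next
    case (eq_unit_left t m n) then show ?case by (simp add: D unit_left hom)
  next
    case (eq_unit_right t m n) then show ?case by (simp add: D unit_right hom)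
  next
    case (eq_Par_assoc s m n t m' n' u m'' n'')
    then show ?case by (simp add: D tens_assoc[of _ m n _ m' n' _ m'' n''] hom)
  next
    case (eq_Swap_natural s m n t m' n') then show ?case by (simp add: D sym_natural hom)
  next
    case eq_Swap_inverse then show ?case by (simp add: sym_inverse)
  next
    case eq_Swap_unit then show ?case by (simp add: sym_unit)
  next
    case (eq_Swap_hexagon l m n) show ?case using sym_hexagon[of l m n] by (simp add: add_ac)
  qed simp_all
qed

section \<open>The ambient prop of all weighted relations\<close>

lemma append_vec_assoc: "(a @\<^sub>v b) @\<^sub>v c = a @\<^sub>v (b @\<^sub>v c)"
  by (induction a) simp_all

lemma vec_first_append [simp]: "x \<in> carrier_vec m \<Longrightarrow> vec_first (x @\<^sub>v y) m = x"
  by (auto simp: vec_first_def)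

lemma vec_last_append [simp]: "y \<in> carrier_vec n \<Longrightarrow> vec_last (x @\<^sub>v y) n = y"
  by (auto simp: vec_last_def)

lemma vec_first_self [simp]: "x \<in> carrier_vec m \<Longrightarrow> vec_first x m = x"
  by (auto simp: vec_first_def)

lemma vec_last_self [simp]: "x \<in> carrier_vec m \<Longrightarrow> vec_last x m = x"
  by (auto simp: vec_last_def)

lemma carrier_vec_0 [simp]: "x \<in> carrier_vec 0 \<longleftrightarrow> x = vNil"
  by (auto intro: eq_vecI)

lemma vec_first_0 [simp]: "vec_first x 0 = vNil" and vec_last_0 [simp]: "vec_last x 0 = vNil"
  by (auto intro: eq_vecI)

lemma carrier_vec_nonempty [simp]: "carrier_vec n \<noteq> ({} :: real vec set)"
  using zero_carrier_vec[of n] by blast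

lemma holds_simps [simp]: "holds True = 0" "holds False = \<infinity>"
  by (simp_all add: holds_def)

lemma holds_add: "holds P + holds Q = holds (P \<and> Q)"
  by (auto simp: holds_def)

lemma holds_cong: "P = Q \<Longrightarrow> holds P = holds Q" by simp

lemma INF_add_const:
  fixes f :: "'a \<Rightarrow> ennreal"
  assumes "I \<noteq> {}"
  shows "(INF i\<in>I. f i) + c = (INF i\<in>I. f i + c)"
proof (cases "c = \<infinity>")
  case True
  then show ?thesis using assms by simp
next
  case False
  then have c: "c < top_class.top" by (simp add: less_top[symmetric])
  have "(INF i\<in>I. f i + c) - c \<le> f i" if "i \<in> I" for i
    using that c by (auto simp: ennreal_minus_le_iff add.commute[of c] intro: INF_lower)
  then have "(INF i\<in>I. f i + c) - c \<le> (INF i\<in>I. f i)"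
    by (rule INF_greatest)
  then have "(INF i\<in>I. f i + c) \<le> (INF i\<in>I. f i) + c"
    using c by (auto simp: ennreal_minus_le_iff add.commute[of c])
  moreover have "(INF i\<in>I. f i) + c \<le> (INF i\<in>I. f i + c)"
    by (intro INF_greatest add_right_mono INF_lower)
  ultimately show ?thesis by (rule antisym[rotated])
qed

lemma INF_const_add:
  fixes f :: "'a \<Rightarrow> ennreal"
  shows "I \<noteq> {} \<Longrightarrow> c + (INF i\<in>I. f i) = (INF i\<in>I. c + f i)"
  using INF_add_const[of I f c] by (simp add: add.commute)

text \<open>An indicator that singles out one point makes all other candidates infinite. Composition
  with identities, symmetries and graphs of functions is computed this way.\<close>

lemma INF_holds:
  fixes f :: "'a \<Rightarrow> ennreal"
  assumes "a \<in> C" "\<And>y. y \<in> C \<Longrightarrow> P y \<longleftrightarrow> y = a"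
  shows "(INF y\<in>C. holds (P y) + f y) = f a" "(INF y\<in>C. f y + holds (P y)) = f a"
proof -
  show "(INF y\<in>C. holds (P y) + f y) = f a"
  proof (rule antisym)
    show "(INF y\<in>C. holds (P y) + f y) \<le> f a"
      using assms by (intro INF_lower2[of a]) (auto simp: holds_def)
    show "f a \<le> (INF y\<in>C. holds (P y) + f y)"
      using assms by (intro INF_greatest) (auto simp: holds_def)
  qed
  then show "(INF y\<in>C. f y + holds (P y)) = f a" by (simp add: add.commute)
qed

lemma INF_holds_holds: "(INF y\<in>C. holds (P y) + holds (Q y)) = holds (\<exists>y\<in>C. P y \<and> Q y)"
proof (cases "\<exists>y\<in>C. P y \<and> Q y")
  case True
  then obtain y where "y \<in> C" "P y" "Q y" by blast
  then have "(INF y\<in>C. holds (P y) + holds (Q y)) \<le> 0"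
    by (intro INF_lower2[of y]) auto
  with True show ?thesis by simp
next
  case False
  then have "(INF y\<in>C. holds (P y) + holds (Q y)) = \<infinity>"
    by (intro antisym INF_greatest) (auto simp: holds_add holds_def)
  also have "\<infinity> = holds (\<exists>y\<in>C. P y \<and> Q y)"
    using False by (simp add: holds_def)
  finally show ?thesis .
qed

lemma INF_append:
  fixes f :: "real vec \<Rightarrow> real vec \<Rightarrow> ennreal"
  shows "(INF w\<in>carrier_vec (m + n). f (vec_first w m) (vec_last w n)) =
    (INF a\<in>carrier_vec m. INF b\<in>carrier_vec n. f a b)"
proof (rule antisym)
  show "(INF w\<in>carrier_vec (m + n). f (vec_first w m) (vec_last w n)) \<le> (INF a\<in>carrier_vec m. INF b\<in>carrier_vec n. f a b)"
  proof (intro INF_greatest)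
    fix a b :: "real vec" assume "a \<in> carrier_vec m" "b \<in> carrier_vec n"
    then show "(INF w\<in>carrier_vec (m + n). f (vec_first w m) (vec_last w n)) \<le> f a b"
      by (intro INF_lower2[of "a @\<^sub>v b"]) auto
  qed
  show "(INF a\<in>carrier_vec m. INF b\<in>carrier_vec n. f a b) \<le> (INF w\<in>carrier_vec (m + n). f (vec_first w m) (vec_last w n))"
  proof (rule INF_greatest)
    fix w :: "real vec"
    show "(INF a\<in>carrier_vec m. INF b\<in>carrier_vec n. f a b) \<le> f (vec_first w m) (vec_last w n)"
      by (rule INF_lower2[of "vec_first w m"], simp, rule INF_lower2[of "vec_last w n"]) auto
  qed
qed

text \<open>All extensional functions, quadratic or not. The prop laws rest on infima commuting with
  each other and with the addition of a constant, so they hold here before any closure property is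
  known.\<close>

definition AllRel :: "qfun prop_struct" where
  "AllRel = QuadRel\<lparr>p_hom := \<lambda>m n. extensional (points m n)\<rparr>"

lemma AllRel_simps [simp]:
  "p_hom AllRel m n = extensional (points m n)" "p_id AllRel = p_id QuadRel" "p_comp AllRel = p_comp QuadRel"
  "p_tens AllRel = p_tens QuadRel" "p_sym AllRel = p_sym QuadRel"
  by (simp_all add: AllRel_def)

lemma QuadRel_ext [simp]:
  "p_id QuadRel n \<in> extensional (points n n)" "p_comp QuadRel l m n F G \<in> extensional (points l n)"
  "p_tens QuadRel m n m' n' F G \<in> extensional (points (m + m') (n + n'))"
  "p_sym QuadRel m n \<in> extensional (points (m + n) (n + m))"
  by (simp_all add: QuadRel_def)

lemma QuadRel_apply [simp]:
  "x \<in> carrier_vec n \<Longrightarrow> y \<in> carrier_vec n \<Longrightarrow> p_id QuadRel n (x, y) = holds (x = y)"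
  "x \<in> carrier_vec l \<Longrightarrow> z \<in> carrier_vec n \<Longrightarrow>
    p_comp QuadRel l m n F G (x, z) = (INF y\<in>carrier_vec m. F (x, y) + G (y, z))"
  "x \<in> carrier_vec (m + m') \<Longrightarrow> y \<in> carrier_vec (n + n') \<Longrightarrow> p_tens QuadRel m n m' n' F G (x, y) =
    F (vec_first x m, vec_first y n) + G (vec_last x m', vec_last y n')"
  "x \<in> carrier_vec (m + n) \<Longrightarrow> y \<in> carrier_vec (n + m) \<Longrightarrow>
    p_sym QuadRel m n (x, y) = holds (y = vec_last x n @\<^sub>v vec_first x m)"
  by (simp_all add: QuadRel_def)

lemma points_ext:
  assumes "F \<in> extensional (points m n)" "G \<in> extensional (points m n)"
    and "\<And>x y. x \<in> carrier_vec m \<Longrightarrow> y \<in> carrier_vec n \<Longrightarrow> F (x, y) = G (x, y)"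
  shows "F = G"
  using assms by (intro extensionalityI[of F "points m n" G]) auto

lemma split_eq_iff: "x \<in> carrier_vec (m + n) \<Longrightarrow> y \<in> carrier_vec (m + n) \<Longrightarrow>
    x = y \<longleftrightarrow> vec_first x m = vec_first y m \<and> vec_last x n = vec_last y n"
  by (metis vec_first_last_append)

lemma vec_first_first [simp]: "m \<le> n \<Longrightarrow> vec_first (vec_first x n) m = vec_first x m"
  by (auto simp: vec_first_def)

lemma vec_last_last [simp]: "m \<le> n \<Longrightarrow> n \<le> dim_vec x \<Longrightarrow> vec_last (vec_last x n) m = vec_last x m"
  by (auto simp: vec_last_def intro!: eq_vecI)

lemma vec_last_first: "dim_vec x = m + n + k \<Longrightarrow> vec_last (vec_first x (m + n)) n = vec_first (vec_last x (n + k)) n"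
  by (auto simp: vec_last_def vec_first_def intro!: eq_vecI)

lemma sym_comp_left:
  assumes "x \<in> carrier_vec (m + n)" "z \<in> carrier_vec k"
  shows "p_comp QuadRel (m + n) (n + m) k (p_sym QuadRel m n) F (x, z) = F (vec_last x n @\<^sub>v vec_first x m, z)"
proof -
  have "p_comp QuadRel (m + n) (n + m) k (p_sym QuadRel m n) F (x, z) =
      (INF y\<in>carrier_vec (n + m). holds (y = vec_last x n @\<^sub>v vec_first x m) + F (y, z))"
    using assms by (simp cong: INF_cong)
  also have "\<dots> = F (vec_last x n @\<^sub>v vec_first x m, z)"
    by (rule INF_holds(1)) auto
  finally show ?thesis .
qed

lemma sym_comp_right:
  assumes "x \<in> carrier_vec k" "z \<in> carrier_vec (n + m)"
  shows "p_comp QuadRel k (m + n) (n + m) F (p_sym QuadRel m n) (x, z) = F (x, vec_last z m @\<^sub>v vec_first z n)"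
proof -
  have "p_comp QuadRel k (m + n) (n + m) F (p_sym QuadRel m n) (x, z) =
      (INF y\<in>carrier_vec (m + n). F (x, y) + holds (z = vec_last y n @\<^sub>v vec_first y m))"
    using assms by (simp cong: INF_cong)
  also have "\<dots> = F (x, vec_last z m @\<^sub>v vec_first z n)"
  proof (rule INF_holds(2))
    fix y :: "real vec" assume y: "y \<in> carrier_vec (m + n)"
    then show "(z = vec_last y n @\<^sub>v vec_first y m) = (y = vec_last z m @\<^sub>v vec_first z n)"
      using assms(2) by (auto simp: vec_first_last_append[of _ m n] vec_first_last_append[of _ n m])
  qed auto
  finally show ?thesis .
qed

lemma AllRel_prop: "prop_cat AllRel"
proof
  fix f g h f' g' :: qfun and k l m n l' m' n' m'' n'' :: nat
  show "p_id AllRel n \<in> p_hom AllRel n n" by simp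
  show "p_comp AllRel l m n f g \<in> p_hom AllRel l n" by simp
  show "p_tens AllRel m n m' n' f g \<in> p_hom AllRel (m + m') (n + n')" by simp
  show "p_sym AllRel m n \<in> p_hom AllRel (m + n) (n + m)" by simp
  show "p_comp AllRel m m n (p_id AllRel m) f = f" if "f \<in> p_hom AllRel m n"
  proof (rule points_ext)
    fix x y :: "real vec" assume xy: "x \<in> carrier_vec m" "y \<in> carrier_vec n"
    then have "p_comp AllRel m m n (p_id AllRel m) f (x, y) = (INF w\<in>carrier_vec m. holds (x = w) + f (w, y))"
      by (simp cong: INF_cong)
    also have "\<dots> = f (x, y)" using xy by (intro INF_holds(1)) auto
    finally show "p_comp AllRel m m n (p_id AllRel m) f (x, y) = f (x, y)" .
  qed (use that in simp_all)
  show "p_comp AllRel m n n f (p_id AllRel n) = f" if "f \<in> p_hom AllRel m n"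
  proof (rule points_ext)
    fix x y :: "real vec" assume xy: "x \<in> carrier_vec m" "y \<in> carrier_vec n"
    then have "p_comp AllRel m n n f (p_id AllRel n) (x, y) = (INF w\<in>carrier_vec n. f (x, w) + holds (w = y))"
      by (simp cong: INF_cong)
    also have "\<dots> = f (x, y)" using xy by (intro INF_holds(2)) auto
    finally show "p_comp AllRel m n n f (p_id AllRel n) (x, y) = f (x, y)" .
  qed (use that in simp_all)
  show "p_comp AllRel k m n (p_comp AllRel k l m f g) h = p_comp AllRel k l n f (p_comp AllRel l m n g h)"
  proof (rule points_ext)
    fix x z :: "real vec" assume xz: "x \<in> carrier_vec k" "z \<in> carrier_vec n"
    have "p_comp AllRel k m n (p_comp AllRel k l m f g) h (x, z) =
        (INF y\<in>carrier_vec m. INF w\<in>carrier_vec l. f (x, w) + g (w, y) + h (y, z))"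
      using xz by (simp add: INF_add_const cong: INF_cong)
    also have "\<dots> = (INF w\<in>carrier_vec l. INF y\<in>carrier_vec m. f (x, w) + g (w, y) + h (y, z))"
      by (rule INF_commute)
    also have "\<dots> = p_comp AllRel k l n f (p_comp AllRel l m n g h) (x, z)"
      using xz by (simp add: INF_const_add add.assoc cong: INF_cong)
    finally show "p_comp AllRel k m n (p_comp AllRel k l m f g) h (x, z) = p_comp AllRel k l n f (p_comp AllRel l m n g h) (x, z)" .
  qed simp_all
  show "p_tens AllRel m m n n (p_id AllRel m) (p_id AllRel n) = p_id AllRel (m + n)"
    by (rule points_ext[where m = "m + n" and n = "m + n"]) (simp_all add: holds_add split_eq_iff)
  show "p_tens AllRel l n l' n' (p_comp AllRel l m n f g) (p_comp AllRel l' m' n' f' g') =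
          p_comp AllRel (l + l') (m + m') (n + n') (p_tens AllRel l m l' m' f f') (p_tens AllRel m n m' n' g g')"
  proof (rule points_ext)
    fix x z :: "real vec" assume xz: "x \<in> carrier_vec (l + l')" "z \<in> carrier_vec (n + n')"
    let ?x = "vec_first x l" and ?x' = "vec_last x l'" and ?z = "vec_first z n" and ?z' = "vec_last z n'"
    have "p_tens AllRel l n l' n' (p_comp AllRel l m n f g) (p_comp AllRel l' m' n' f' g') (x, z) =
      (INF a\<in>carrier_vec m. INF b\<in>carrier_vec m'. (f (?x, a) + f' (?x', b)) + (g (a, ?z) + g' (b, ?z')))"
      using xz by (simp add: INF_const_add INF_add_const add_ac cong: INF_cong)
    also have "\<dots> = (INF w\<in>carrier_vec (m + m'). (f (?x, vec_first w m) + f' (?x', vec_last w m')) +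
        (g (vec_first w m, ?z) + g' (vec_last w m', ?z')))"
      by (rule INF_append[symmetric])
    also have "\<dots> = p_comp AllRel (l + l') (m + m') (n + n') (p_tens AllRel l m l' m' f f') (p_tens AllRel m n m' n' g g') (x, z)"
      using xz by (simp cong: INF_cong)
    finally show "p_tens AllRel l n l' n' (p_comp AllRel l m n f g) (p_comp AllRel l' m' n' f' g') (x, z) =
      p_comp AllRel (l + l') (m + m') (n + n') (p_tens AllRel l m l' m' f f') (p_tens AllRel m n m' n' g g') (x, z)" .
  qed simp_all
  show "p_tens AllRel 0 0 m n (p_id AllRel 0) f = f" if "f \<in> p_hom AllRel m n"
  proof (rule points_ext)
    show "p_tens AllRel 0 0 m n (p_id AllRel 0) f \<in> extensional (points m n)"
      using QuadRel_ext(3)[of 0 0 m n "p_id QuadRel 0" f] by simp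
    fix x y :: "real vec" assume xy: "x \<in> carrier_vec m" "y \<in> carrier_vec n"
    then show "p_tens AllRel 0 0 m n (p_id AllRel 0) f (x, y) = f (x, y)"
      using QuadRel_apply(3)[of x 0 m y 0 n "p_id QuadRel 0" f] by simp
  qed (use that in simp)
  show "p_tens AllRel m n 0 0 f (p_id AllRel 0) = f" if "f \<in> p_hom AllRel m n"
  proof (rule points_ext)
    show "p_tens AllRel m n 0 0 f (p_id AllRel 0) \<in> extensional (points m n)"
      using QuadRel_ext(3)[of m n 0 0 f "p_id QuadRel 0"] by simp
    fix x y :: "real vec" assume xy: "x \<in> carrier_vec m" "y \<in> carrier_vec n"
    then show "p_tens AllRel m n 0 0 f (p_id AllRel 0) (x, y) = f (x, y)"
      using QuadRel_apply(3)[of x m 0 y n 0 f "p_id QuadRel 0"] by simp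
  qed (use that in simp)
  show "p_tens AllRel (m + m') (n + n') m'' n'' (p_tens AllRel m n m' n' f g) h =
          p_tens AllRel m n (m' + m'') (n' + n'') f (p_tens AllRel m' n' m'' n'' g h)"
  proof (rule points_ext)
    show "p_tens AllRel (m + m') (n + n') m'' n'' (p_tens AllRel m n m' n' f g) h
        \<in> extensional (points (m + m' + m'') (n + n' + n''))" by simp
    show "p_tens AllRel m n (m' + m'') (n' + n'') f (p_tens AllRel m' n' m'' n'' g h)
        \<in> extensional (points (m + m' + m'') (n + n' + n''))"
      unfolding add.assoc by simp
    fix x y :: "real vec"
    assume x: "x \<in> carrier_vec (m + m' + m'')" and y: "y \<in> carrier_vec (n + n' + n'')"
    then have x': "x \<in> carrier_vec (m + (m' + m''))" and y': "y \<in> carrier_vec (n + (n' + n''))"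
      by (simp_all add: add.assoc)
    have dims: "m' + m'' \<le> dim_vec x" "n' + n'' \<le> dim_vec y" using x y by auto
    have "vec_last (vec_first x (m + m')) m' = vec_first (vec_last x (m' + m'')) m'"
      "vec_last (vec_first y (n + n')) n' = vec_first (vec_last y (n' + n'')) n'"
      using x y by (auto intro!: vec_last_first)
    then show "p_tens AllRel (m + m') (n + n') m'' n'' (p_tens AllRel m n m' n' f g) h (x, y) =
        p_tens AllRel m n (m' + m'') (n' + n'') f (p_tens AllRel m' n' m'' n'' g h) (x, y)"
      by (simp add: x y x' y' dims add.assoc[where 'a = ennreal])
  qed
  show "p_comp AllRel (m + m') (n + n') (n' + n) (p_tens AllRel m n m' n' f g) (p_sym AllRel n n') =
          p_comp AllRel (m + m') (m' + m) (n' + n) (p_sym AllRel m m') (p_tens AllRel m' n' m n g f)"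
  proof (rule points_ext)
    fix x z :: "real vec" assume x: "x \<in> carrier_vec (m + m')" and z: "z \<in> carrier_vec (n' + n)"
    have "vec_last z n @\<^sub>v vec_first z n' \<in> carrier_vec (n + n')"
      "vec_last x m' @\<^sub>v vec_first x m \<in> carrier_vec (m' + m)"
      by (intro append_carrier_vec; simp)+
    then show "p_comp AllRel (m + m') (n + n') (n' + n) (p_tens AllRel m n m' n' f g) (p_sym AllRel n n') (x, z) =
        p_comp AllRel (m + m') (m' + m) (n' + n) (p_sym AllRel m m') (p_tens AllRel m' n' m n g f) (x, z)"
      using x z by (simp only: AllRel_simps sym_comp_left sym_comp_right QuadRel_apply(3)
          vec_first_append vec_last_append vec_first_carrier vec_last_carrier) (rule add.commute)
  qed simp_all
  show "p_comp AllRel (m + n) (n + m) (m + n) (p_sym AllRel m n) (p_sym AllRel n m) = p_id AllRel (m + n)"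
  proof (rule points_ext)
    fix x z :: "real vec" assume x: "x \<in> carrier_vec (m + n)" and z: "z \<in> carrier_vec (m + n)"
    have "vec_last x n @\<^sub>v vec_first x m \<in> carrier_vec (n + m)"
      by (intro append_carrier_vec; simp)
    then show "p_comp AllRel (m + n) (n + m) (m + n) (p_sym AllRel m n) (p_sym AllRel n m) (x, z) =
        p_id AllRel (m + n) (x, z)"
      using x z by (simp only: AllRel_simps sym_comp_left QuadRel_apply(1,4) vec_first_append vec_last_append
          vec_first_carrier vec_last_carrier vec_first_last_append) (rule holds_cong, blast)
  qed simp_all
  show "p_sym AllRel n 0 = p_id AllRel n"
  proof (rule points_ext)
    show "p_sym AllRel n 0 \<in> extensional (points n n)"
      using QuadRel_ext(4)[of n 0] by simp
    fix x z :: "real vec" assume x: "x \<in> carrier_vec n" and z: "z \<in> carrier_vec n"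
    then show "p_sym AllRel n 0 (x, z) = p_id AllRel n (x, z)"
      using QuadRel_apply(4)[of x n 0 z] by (auto intro!: holds_cong)
  qed simp
  show "p_sym AllRel (l + m) n = p_comp AllRel (l + m + n) (l + n + m) (n + l + m)
            (p_tens AllRel l l (m + n) (n + m) (p_id AllRel l) (p_sym AllRel m n))
            (p_tens AllRel (l + n) (n + l) m m (p_sym AllRel l n) (p_id AllRel m))"
    (is "_ = ?R")
  proof (rule points_ext[where m = "l + m + n" and n = "n + l + m"])
    show "p_sym AllRel (l + m) n \<in> extensional (points (l + m + n) (n + l + m))"
      using QuadRel_ext(4)[of "l + m" n] by (simp add: add.assoc)
    fix x z :: "real vec" assume x: "x \<in> carrier_vec (l + m + n)" and z: "z \<in> carrier_vec (n + l + m)"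
    define a b c where "a = vec_first x l" and "b = vec_first (vec_last x (m + n)) m" and "c = vec_last x n"
    have abc: "a \<in> carrier_vec l" "b \<in> carrier_vec m" "c \<in> carrier_vec n" by (simp_all add: a_def b_def c_def)
    have x_eq: "x = a @\<^sub>v (b @\<^sub>v c)"
      using x vec_first_last_append[of x l "m + n"] vec_first_last_append[of "vec_last x (m + n)" m n]
      by (simp add: a_def b_def c_def add.assoc carrier_vecD)
    have "?R (x, z) = (INF w\<in>carrier_vec (l + (n + m)). holds (w = a @\<^sub>v (c @\<^sub>v b)) +
        p_tens AllRel (l + n) (n + l) m m (p_sym AllRel l n) (p_id AllRel m) (w, z))"
      using x z abc x_eq by (simp add: add.assoc holds_add split_eq_iff[of _ l "n + m"] eq_commute[of a] cong: INF_cong)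
    also have "\<dots> = p_tens AllRel (l + n) (n + l) m m (p_sym AllRel l n) (p_id AllRel m) (a @\<^sub>v (c @\<^sub>v b), z)"
      by (rule INF_holds(1)) (use abc in auto)
    also have "a @\<^sub>v (c @\<^sub>v b) = (a @\<^sub>v c) @\<^sub>v b"
      using abc by (simp add: append_vec_assoc)
    also have "p_tens AllRel (l + n) (n + l) m m (p_sym AllRel l n) (p_id AllRel m) ((a @\<^sub>v c) @\<^sub>v b, z) =
       holds (vec_first z (n + l) = c @\<^sub>v a \<and> vec_last z m = b)"
    proof -
      have "(a @\<^sub>v c) @\<^sub>v b \<in> carrier_vec (l + n + m)" "a @\<^sub>v c \<in> carrier_vec (l + n)"
        using abc by (auto intro!: append_carrier_vec)
      then show ?thesis using abc z by (auto simp: holds_add intro!: holds_cong)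
    qed
    also have "\<dots> = holds (z = (c @\<^sub>v a) @\<^sub>v b)"
    proof -
      have "(c @\<^sub>v a) @\<^sub>v b \<in> carrier_vec (n + l + m)" "c @\<^sub>v a \<in> carrier_vec (n + l)"
        using abc by (auto intro!: append_carrier_vec)
      then show ?thesis using abc z by (simp add: split_eq_iff[of z "n + l" m])
    qed
    also have "(c @\<^sub>v a) @\<^sub>v b = c @\<^sub>v (a @\<^sub>v b)"
      using abc by (simp add: append_vec_assoc)
    also have "holds (z = c @\<^sub>v (a @\<^sub>v b)) = p_sym AllRel (l + m) n (x, z)"
    proof -
      have "x = (a @\<^sub>v b) @\<^sub>v c" using abc by (simp add: x_eq append_vec_assoc)
      moreover have "(a @\<^sub>v b) @\<^sub>v c \<in> carrier_vec (l + m + n)" "a @\<^sub>v b \<in> carrier_vec (l + m)"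
        using abc by (auto intro!: append_carrier_vec)
      moreover have "z \<in> carrier_vec (n + (l + m))" using z by (simp add: add.assoc)
      ultimately show ?thesis using abc QuadRel_apply(4)[of x "l + m" n z] by simp
    qed
    finally show "p_sym AllRel (l + m) n (x, z) = ?R (x, z)" by simp
  qed (simp add: add.assoc)
qed

section \<open>Soundness of the axioms\<close>

lemma eval_AllRel: "eval \<sigma> AllRel v t = eval \<sigma> QuadRel v t"
  by (induction t) simp_all

lemma gen_interp_ext: "gen_interp g \<in> extensional (points (fst (gqa_sig g)) (snd (gqa_sig g)))"
  by (cases g) simp_all

abbreviation "gev \<equiv> eval gqa_sig QuadRel gen_interp"

lemma gev_ext: "composable gqa_sig t \<Longrightarrow> gev t \<in> extensional (points (src gqa_sig t) (tgt gqa_sig t))"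
  using prop_cat.eval_closed[OF AllRel_prop, of gen_interp gqa_sig t] gen_interp_ext
  by (simp add: eval_AllRel)

text \<open>Lists in place of vectors: on explicit lists such as \<open>[a, b]\<close> the
  simplifier computes \<open>take\<close>, \<open>drop\<close> and append, which is how the axioms
  are checked.\<close>

definition wt :: "gqa_gen diagram \<Rightarrow> real list \<Rightarrow> real list \<Rightarrow> ennreal" where
  "wt t xs ys = gev t (vec_of_list xs, vec_of_list ys)"

lemma vec_of_list_carrier [simp]: "vec_of_list xs \<in> carrier_vec n \<longleftrightarrow> length xs = n"
  by (simp only: carrier_vec_def mem_Collect_eq dim_vec_of_list)

lemma vec_of_list_eq_iff [simp]: "vec_of_list xs = vec_of_list ys \<longleftrightarrow> xs = ys"
  by (metis list_vec)

lemma vec_of_list_append: "vec_of_list (xs @ ys) = vec_of_list xs @\<^sub>v vec_of_list ys"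
  by (induction xs) simp_all

lemma carrier_vec_image: "carrier_vec n = vec_of_list ` {xs. length xs = n}"
proof (rule equalityI; rule subsetI)
  fix x :: "'a vec" assume "x \<in> carrier_vec n"
  then show "x \<in> vec_of_list ` {xs. length xs = n}"
    by (intro image_eqI[of _ _ "list_of_vec x"]) (simp_all add: vec_list carrier_vecD)
qed auto

lemma gev_eqI:
  assumes "s \<in> diagrams gqa_sig m n" "t \<in> diagrams gqa_sig m n"
    and "\<And>xs ys. length xs = m \<Longrightarrow> length ys = n \<Longrightarrow> wt s xs ys = wt t xs ys"
  shows "gev s = gev t"
proof (rule points_ext)
  show "gev s \<in> extensional (points m n)" "gev t \<in> extensional (points m n)"
    using gev_ext[of s] gev_ext[of t] assms(1,2) by (auto simp: diagrams_def)
  fix x y :: "real vec" assume "x \<in> carrier_vec m" "y \<in> carrier_vec n"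
  then show "gev s (x, y) = gev t (x, y)"
    using assms(3)[of "list_of_vec x" "list_of_vec y"] by (simp add: wt_def vec_list)
qed

lemma vec_first_list: "length xs = m \<Longrightarrow> vec_first (vec_of_list (xs @ ys)) m = vec_of_list xs"
  by (simp add: vec_of_list_append)

lemma vec_last_list: "length ys = n \<Longrightarrow> vec_last (vec_of_list (xs @ ys)) n = vec_of_list ys"
  by (simp add: vec_of_list_append)

lemma wt_Seq:
  assumes "composable gqa_sig (s \<Zsemi> t)" "length xs = src gqa_sig s" "length zs = tgt gqa_sig t"
  shows "wt (s \<Zsemi> t) xs zs = (INF ys\<in>{ys. length ys = tgt gqa_sig s}. wt s xs ys + wt t ys zs)"
proof -
  have "wt (s \<Zsemi> t) xs zs =
      (INF y\<in>carrier_vec (tgt gqa_sig s). gev s (vec_of_list xs, y) + gev t (y, vec_of_list zs))"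
    unfolding wt_def eval.simps by (rule QuadRel_apply(2)) (use assms in simp_all)
  then show ?thesis
    unfolding carrier_vec_image image_image wt_def .
qed

lemma wt_Par:
  assumes "length xs = src gqa_sig s" "length ys = tgt gqa_sig s"
    "length xs' = src gqa_sig t" "length ys' = tgt gqa_sig t"
  shows "wt (s \<parallel> t) (xs @ xs') (ys @ ys') = wt s xs ys + wt t xs' ys'"
  unfolding wt_def eval.simps
  by (subst QuadRel_apply(3)) (use assms in \<open>simp_all only: vec_first_list vec_last_list vec_of_list_carrier length_append\<close>)

lemma wt_Wires: "length xs = n \<Longrightarrow> length ys = n \<Longrightarrow> wt (Wires n) xs ys = holds (xs = ys)"
  by (simp add: wt_def)

lemma wt_Swap: "length xs = m \<Longrightarrow> length xs' = n \<Longrightarrow> length ys = n + m \<Longrightarrow>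
    wt (Swap m n) (xs @ xs') ys = holds (ys = xs' @ xs)"
proof -
  assume len: "length xs = m" "length xs' = n" "length ys = n + m"
  then have "vec_last (vec_of_list (xs @ xs')) n @\<^sub>v vec_first (vec_of_list (xs @ xs')) m = vec_of_list (xs' @ xs)"
    by (simp only: vec_first_list vec_last_list vec_of_list_append[symmetric])
  with len show ?thesis
    unfolding wt_def eval.simps by (subst QuadRel_apply(4)) simp_all
qed

text \<open>The clause for \<open>Nu\<close> is a placeholder: \<open>nu\<close> takes finite
  nonzero weights and is not a relation, so \<open>wt_gen\<close> and \<open>wt_rel\<close> exclude
  it.\<close>

primrec gen_rel :: "gqa_gen \<Rightarrow> real list \<Rightarrow> real list \<Rightarrow> bool" where
  "gen_rel Copy xs ys \<longleftrightarrow> ys = [xs ! 0, xs ! 0]"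
| "gen_rel Discard xs ys \<longleftrightarrow> True"
| "gen_rel Add xs ys \<longleftrightarrow> ys = [xs ! 0 + xs ! 1]"
| "gen_rel Zero xs ys \<longleftrightarrow> ys = [0]"
| "gen_rel (Scalar k) xs ys \<longleftrightarrow> ys = [k * xs ! 0]"
| "gen_rel One xs ys \<longleftrightarrow> ys = [1]"
| "gen_rel Nu xs ys \<longleftrightarrow> False"
| "gen_rel CoCopy xs ys \<longleftrightarrow> xs = [ys ! 0, ys ! 0]"
| "gen_rel CoDiscard xs ys \<longleftrightarrow> True"
| "gen_rel CoAdd xs ys \<longleftrightarrow> xs = [ys ! 0 + ys ! 1]"
| "gen_rel CoZero xs ys \<longleftrightarrow> xs = [0]"

text \<open>Meaningful only for diagrams without \<open>nu\<close> and for inputs and outputs of the right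
  lengths; neither is checked by the clauses below.\<close>

primrec rel :: "gqa_gen diagram \<Rightarrow> real list \<Rightarrow> real list \<Rightarrow> bool" where
  "rel (Gen g) xs ys \<longleftrightarrow> gen_rel g xs ys"
| "rel (Wires n) xs ys \<longleftrightarrow> xs = ys"
| "rel (Swap m n) xs ys \<longleftrightarrow> ys = drop m xs @ take m xs"
| "rel (s \<Zsemi> t) xs zs \<longleftrightarrow> (\<exists>ys. length ys = tgt gqa_sig s \<and> rel s xs ys \<and> rel t ys zs)"
| "rel (s \<parallel> t) xs ys \<longleftrightarrow>
     rel s (take (src gqa_sig s) xs) (take (tgt gqa_sig s) ys) \<and>
     rel t (drop (src gqa_sig s) xs) (drop (tgt gqa_sig s) ys)"

primrec nu_free :: "gqa_gen diagram \<Rightarrow> bool" where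
  "nu_free (Gen g) \<longleftrightarrow> g \<noteq> Nu"
| "nu_free (Wires n) \<longleftrightarrow> True"
| "nu_free (Swap m n) \<longleftrightarrow> True"
| "nu_free (s \<Zsemi> t) \<longleftrightarrow> nu_free s \<and> nu_free t"
| "nu_free (s \<parallel> t) \<longleftrightarrow> nu_free s \<and> nu_free t"

lemma wt_gen:
  assumes "g \<noteq> Nu" "length xs = fst (gqa_sig g)" "length ys = snd (gqa_sig g)"
  shows "wt (Gen g) xs ys = holds (gen_rel g xs ys)"
  using assms
  by (cases g) (auto simp: wt_def length_Suc_conv numeral_2_eq_2 vec_of_list_index simp del: vec_of_list_Cons
      intro!: holds_cong)

lemma wt_rel:
  assumes "nu_free t" "composable gqa_sig t" "length xs = src gqa_sig t" "length ys = tgt gqa_sig t"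
  shows "wt t xs ys = holds (rel t xs ys)"
  using assms
proof (induction t arbitrary: xs ys)
  case (Gen g)
  then show ?case by (simp add: wt_gen)
next
  case (Wires n)
  then show ?case by (simp add: wt_Wires)
next
  case (Swap m n)
  then show ?case
    using wt_Swap[of "take m xs" m "drop m xs" n ys] by simp
next
  case (Seq s t)
  have "wt (s \<Zsemi> t) xs ys = (INF zs\<in>{zs. length zs = tgt gqa_sig s}. holds (rel s xs zs) + holds (rel t zs ys))"
    using Seq by (subst wt_Seq) (auto intro!: INF_cong)
  also have "\<dots> = holds (\<exists>zs\<in>{zs. length zs = tgt gqa_sig s}. rel s xs zs \<and> rel t zs ys)"
    by (rule INF_holds_holds)
  finally show ?case by (simp add: Bex_def)
next
  case (Par s t)
  define x1 x2 y1 y2 where "x1 = take (src gqa_sig s) xs" and "x2 = drop (src gqa_sig s) xs"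
    and "y1 = take (tgt gqa_sig s) ys" and "y2 = drop (tgt gqa_sig s) ys"
  have len: "length x1 = src gqa_sig s" "length x2 = src gqa_sig t" "length y1 = tgt gqa_sig s" "length y2 = tgt gqa_sig t"
    and eq: "xs = x1 @ x2" "ys = y1 @ y2"
    using Par by (auto simp: x1_def x2_def y1_def y2_def)
  show ?case
    using Par len unfolding eq by (simp add: wt_Par holds_add)
qed

lemma mirror_types:
  "composable gqa_sig t \<Longrightarrow>
    composable gqa_sig (mirror t) \<and> src gqa_sig (mirror t) = tgt gqa_sig t \<and> tgt gqa_sig (mirror t) = src gqa_sig t"
proof (induction t)
  case (Gen g)
  then show ?case by (cases g) (simp_all add: coscalar_def cup_def cap_def)
qed simp_all

lemma ex_length_Suc: "(\<exists>ys. length ys = Suc n \<and> P ys) \<longleftrightarrow> (\<exists>y ys. length ys = n \<and> P (y # ys))"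
  by (metis length_Suc_conv)

lemmas rel_eval = ex_length_Suc numeral_2_eq_2

lemma length_SucE: "length xs = Suc n \<Longrightarrow> (\<And>y ys. xs = y # ys \<Longrightarrow> length ys = n \<Longrightarrow> R) \<Longrightarrow> R"
  by (auto simp: length_Suc_conv)

lemma rel_cup: "rel cup [] [a, b] \<longleftrightarrow> a = b"
  by (simp add: cup_def rel_eval) auto

lemma rel_cap: "rel cap [a, b] [] \<longleftrightarrow> a = b"
  by (simp add: cap_def rel_eval) auto

lemma types_cup_cap [simp]:
  "src gqa_sig cup = 0" "tgt gqa_sig cup = 2" "src gqa_sig cap = 2" "tgt gqa_sig cap = 0"
  "src gqa_sig (coscalar k) = 1" "tgt gqa_sig (coscalar k) = 1"
  "composable gqa_sig cup" "composable gqa_sig cap" "composable gqa_sig (coscalar k)"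
  by (simp_all add: cup_def cap_def coscalar_def)

lemma rel_coscalar: "rel (coscalar k) [a] [b] \<longleftrightarrow> a = k * b"
  by (auto simp: coscalar_def rel_eval rel_cup rel_cap)

lemma nu_free_simps [simp]: "nu_free cup" "nu_free cap" "nu_free (coscalar k)"
  by (simp_all add: cup_def cap_def coscalar_def)

text \<open>Mirroring is the converse of relations, and so the soundness of the
  \<open>comatrix\<close> axioms is inherited from the \<open>matrix\<close> axioms.\<close>

lemma rel_mirror:
  assumes "nu_free t" "composable gqa_sig t" "length xs = src gqa_sig t" "length ys = tgt gqa_sig t"
  shows "rel (mirror t) ys xs \<longleftrightarrow> rel t xs ys"
  using assms
proof (induction t arbitrary: xs ys)
  case (Gen g)
  then show ?case
    by (cases g) (auto simp: rel_eval rel_cap rel_coscalar elim!: length_SucE)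
next
  case (Seq s t)
  then show ?case by (auto simp: mirror_types)
next
  case (Par s t)
  then show ?case by (simp add: mirror_types)
next
  case (Swap m n)
  then show ?case by (auto simp: append_eq_conv_conj)
qed auto

lemma nu_free_mirror: "nu_free t \<Longrightarrow> nu_free (mirror t)"
proof (induction t)
  case (Gen g)
  then show ?case by (cases g) auto
qed auto

lemma matrix_axiom_nu_free: "matrix_axiom s t \<Longrightarrow> nu_free s \<and> nu_free t"
  by (induction rule: matrix_axiom.induct) simp_all

lemma matrix_axiom_types:
  "matrix_axiom s t \<Longrightarrow> composable gqa_sig s \<and> composable gqa_sig t \<and>
    src gqa_sig s = src gqa_sig t \<and> tgt gqa_sig s = tgt gqa_sig t"
  by (induction rule: matrix_axiom.induct) simp_all

lemma matrix_axiom_rel: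
  "matrix_axiom s t \<Longrightarrow> length xs = src gqa_sig s \<Longrightarrow> length ys = tgt gqa_sig s \<Longrightarrow> rel s xs ys \<longleftrightarrow> rel t xs ys"
  by (induction rule: matrix_axiom.induct) (auto simp: rel_eval algebra_simps elim!: length_SucE)

lemma linear_axiom_rel:
  assumes "linear_axiom s t" "length xs = src gqa_sig s" "length ys = tgt gqa_sig s"
  shows "rel s xs ys \<longleftrightarrow> rel t xs ys"
  using assms
proof (induction rule: linear_axiom.induct)
  case (matrix s t)
  then show ?case by (rule matrix_axiom_rel)
next
  case (comatrix s t)
  have "composable gqa_sig s" "composable gqa_sig t" "src gqa_sig s = src gqa_sig t" "tgt gqa_sig s = tgt gqa_sig t"
    using matrix_axiom_types[OF comatrix(1)] by auto
  then show ?case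
    using comatrix matrix_axiom_nu_free[OF comatrix(1)] matrix_axiom_rel[OF comatrix(1), of ys xs]
    by (simp add: rel_mirror mirror_types)
next
  case copy_frobenius_left
  then show ?case by (auto simp: rel_eval elim!: length_SucE)
next
  case copy_frobenius_right
  then show ?case by (auto simp: rel_eval elim!: length_SucE)
next
  case copy_special
  then show ?case by (auto simp: rel_eval elim!: length_SucE)
next
  case copy_bone
  then show ?case by (auto simp: rel_eval Ex_list_of_length)
next
  case add_frobenius_left
  then obtain a b c d where [simp]: "xs = [a, b]" "ys = [c, d]" by (auto elim!: length_SucE simp: rel_eval)
  have "rel ((coadd\<^sub>g \<parallel> wire) \<Zsemi> (wire \<parallel> add\<^sub>g)) xs ys \<longleftrightarrow> (\<exists>v. a = c + v \<and> d = v + b)"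
    by (auto simp: rel_eval)
  moreover have "rel (add\<^sub>g \<Zsemi> coadd\<^sub>g) xs ys \<longleftrightarrow> a + b = c + d"
    by (auto simp: rel_eval)
  ultimately show ?case by (auto intro!: exI[of _ "d - b"])
next
  case add_frobenius_right
  then obtain a b c d where [simp]: "xs = [a, b]" "ys = [c, d]" by (auto elim!: length_SucE simp: rel_eval)
  have "rel ((wire \<parallel> coadd\<^sub>g) \<Zsemi> (add\<^sub>g \<parallel> wire)) xs ys \<longleftrightarrow> (\<exists>u. b = u + d \<and> c = a + u)"
    by (auto simp: rel_eval)
  moreover have "rel (add\<^sub>g \<Zsemi> coadd\<^sub>g) xs ys \<longleftrightarrow> a + b = c + d"
    by (auto simp: rel_eval)
  ultimately show ?case by (auto intro!: exI[of _ "c - a"])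
next
  case add_special
  then obtain a b where [simp]: "xs = [a]" "ys = [b]" by (auto elim!: length_SucE)
  have "rel (coadd\<^sub>g \<Zsemi> add\<^sub>g) xs ys \<longleftrightarrow> (\<exists>u v. a = u + v \<and> b = u + v)"
    by (auto simp: rel_eval)
  moreover have "rel wire xs ys \<longleftrightarrow> a = b"
    by simp
  moreover have "a = a + 0" by simp
  ultimately show ?case by blast
next
  case add_bone
  then show ?case by (auto simp: rel_eval elim!: length_SucE)
next
  case antipode_cup
  then show ?case by (auto simp: rel_eval rel_cup elim!: length_SucE)
next
  case antipode_cap
  then show ?case by (auto simp: rel_eval rel_cap elim!: length_SucE)
next
  case (scalar_inverse k)
  then show ?case by (auto simp: rel_eval rel_coscalar elim!: length_SucE)
next
  case (scalar_coinverse k)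
  then show ?case
    by (auto simp: rel_eval rel_coscalar elim!: length_SucE) (metis nonzero_mult_div_cancel_left times_divide_eq_right)
qed

lemma linear_axiom_nu_free: "linear_axiom s t \<Longrightarrow> nu_free s \<and> nu_free t"
  by (induction rule: linear_axiom.induct) (auto simp: matrix_axiom_nu_free nu_free_mirror)

lemma affine_axiom_nu_free: "affine_axiom s t \<Longrightarrow> nu_free s \<and> nu_free t"
  by (induction rule: affine_axiom.induct) (auto simp: linear_axiom_nu_free)

lemma affine_axiom_rel:
  assumes "affine_axiom s t" "length xs = src gqa_sig s" "length ys = tgt gqa_sig s"
  shows "rel s xs ys \<longleftrightarrow> rel t xs ys"
  using assms
proof (induction rule: affine_axiom.induct)
  case (linear s t)
  then show ?case by (rule linear_axiom_rel)
qed (auto simp: rel_eval elim!: length_SucE)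

lemma rel_rotation: "rel (rotation \<phi>) [a, b] [c, d] \<longleftrightarrow> c = cos \<phi> * a - sin \<phi> * b \<and> d = sin \<phi> * a + cos \<phi> * b"
  by (auto simp: rel_eval rotation_def)

lemma rotation_types: "nu_free (rotation \<phi>)" "composable gqa_sig (rotation \<phi>)"
  "src gqa_sig (rotation \<phi>) = 2" "tgt gqa_sig (rotation \<phi>) = 2"
  by (simp_all add: rotation_def)

section \<open>Soundness of the quadratic axioms\<close>

lemma wt_nu: "length xs = 0 \<Longrightarrow> wt nu\<^sub>g xs [a] = ennreal (1 / 2 * a\<^sup>2)"
  by (simp add: wt_def)

lemma wt_nu_nu: "wt (nu\<^sub>g \<parallel> nu\<^sub>g) [] [a, b] = ennreal (1 / 2 * (a\<^sup>2 + b\<^sup>2))"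
  using wt_Par[of "[]" "nu\<^sub>g" "[a]" "[]" "nu\<^sub>g" "[b]"] by (simp add: wt_nu add_divide_distrib)

lemma gqa_axiom_wt:
  assumes "gqa_axiom s t" "s \<in> diagrams gqa_sig m n" "t \<in> diagrams gqa_sig m n" "length xs = m" "length ys = n"
  shows "wt s xs ys = wt t xs ys"
  using assms
proof (induction rule: gqa_axiom.induct)
  case (affine s t)
  then show ?case
    using affine_axiom_nu_free[of s t] affine_axiom_rel[of s t xs ys]
    by (auto simp: wt_rel diagrams_def)
next
  case D
  then have [simp]: "xs = []" "ys = []" by (auto simp: diagrams_def)
  \<comment> \<open>Weights are nonnegative, so it is enough to exhibit the intermediate value 0,
    which costs nothing.\<close>
  have "wt (nu\<^sub>g \<Zsemi> discard\<^sub>g) xs ys \<le> wt nu\<^sub>g [] [0] + wt discard\<^sub>g [0] []"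
    by (subst wt_Seq) (auto intro!: INF_lower2[of "[0]"])
  also have "\<dots> = 0"
    using wt_gen[of Discard "[0]" "[]"] by (simp add: wt_nu)
  finally show ?case by (simp add: wt_Wires)
next
  case Z
  then have [simp]: "xs = []" "ys = []" by (auto simp: diagrams_def)
  have "wt (nu\<^sub>g \<Zsemi> cozero\<^sub>g) xs ys \<le> wt nu\<^sub>g [] [0] + wt cozero\<^sub>g [0] []"
    by (subst wt_Seq) (auto intro!: INF_lower2[of "[0]"])
  also have "\<dots> = 0"
    using wt_gen[of CoZero "[0]" "[]"] by (simp add: wt_nu)
  finally show ?case by (simp add: wt_Wires)
next
  case (RI \<phi>)
  then have "length xs = 0" "length ys = Suc (Suc 0)" by (auto simp: diagrams_def)
  then obtain c d where [simp]: "xs = []" "ys = [c, d]" by (auto elim!: length_SucE)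
  \<comment> \<open>The inverse rotation of the output, the only input that is sent to it; rotations
    preserve the sum of squares.\<close>
  define a b where "a = cos \<phi> * c + sin \<phi> * d" and "b = cos \<phi> * d - sin \<phi> * c"
  have "wt ((nu\<^sub>g \<parallel> nu\<^sub>g) \<Zsemi> rotation \<phi>) xs ys =
      (INF zs\<in>{zs. length zs = 2}. wt (nu\<^sub>g \<parallel> nu\<^sub>g) [] zs + holds (rel (rotation \<phi>) zs [c, d]))"
    by (subst wt_Seq) (auto simp: rotation_types wt_rel intro!: INF_cong)
  also have "\<dots> = wt (nu\<^sub>g \<parallel> nu\<^sub>g) [] [a, b]"
  proof (rule INF_holds(2))
    fix zs :: "real list" assume "zs \<in> {zs. length zs = 2}"
    then obtain u v where zs: "zs = [u, v]" by (auto simp: numeral_2_eq_2 elim!: length_SucE)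
    have sc: "cos \<phi> * cos \<phi> = 1 - sin \<phi> * sin \<phi>"
      using sin_cos_squared_add3[of \<phi>] by linarith
    show "rel (rotation \<phi>) zs [c, d] \<longleftrightarrow> zs = [a, b]"
      unfolding zs rel_rotation a_def b_def
    proof (rule iffI)
      assume "c = cos \<phi> * u - sin \<phi> * v \<and> d = sin \<phi> * u + cos \<phi> * v"
      then have cd: "c = cos \<phi> * u - sin \<phi> * v" "d = sin \<phi> * u + cos \<phi> * v" by simp_all
      have "cos \<phi> * c + sin \<phi> * d = (cos \<phi> * cos \<phi>) * u + (sin \<phi> * sin \<phi>) * u"
        by (simp add: cd algebra_simps)
      then show "[u, v] = [cos \<phi> * c + sin \<phi> * d, cos \<phi> * d - sin \<phi> * c]"
        by (simp add: sc cd algebra_simps)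
    next
      assume "[u, v] = [cos \<phi> * c + sin \<phi> * d, cos \<phi> * d - sin \<phi> * c]"
      then have uv: "u = cos \<phi> * c + sin \<phi> * d" "v = cos \<phi> * d - sin \<phi> * c" by simp_all
      have "cos \<phi> * u - sin \<phi> * v = (cos \<phi> * cos \<phi>) * c + (sin \<phi> * sin \<phi>) * c"
        "sin \<phi> * u + cos \<phi> * v = (cos \<phi> * cos \<phi>) * d + (sin \<phi> * sin \<phi>) * d"
        by (simp_all add: uv algebra_simps)
      then show "c = cos \<phi> * u - sin \<phi> * v \<and> d = sin \<phi> * u + cos \<phi> * v"
        by (simp_all add: sc algebra_simps)
    qed
  qed simp
  also have "\<dots> = wt (nu\<^sub>g \<parallel> nu\<^sub>g) xs ys"
  proof -
    have "a\<^sup>2 + b\<^sup>2 = (cos \<phi> * cos \<phi> + sin \<phi> * sin \<phi>) * (c\<^sup>2 + d\<^sup>2)"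
      by (simp add: a_def b_def power2_eq_square algebra_simps
          del: sin_cos_squared_add sin_cos_squared_add2 sin_cos_squared_add3)
    then show ?thesis by (simp add: wt_nu_nu)
  qed
  finally show ?case .
qed

theorem gev_sound: "diag_eq gqa_sig gqa_axiom m n s t \<Longrightarrow> gev s = gev t"
  using prop_cat.eval_sound[OF AllRel_prop, of gen_interp gqa_sig gqa_axiom m n s t] gen_interp_ext
  by (auto simp: eval_AllRel intro: gev_eqI gqa_axiom_wt)

section \<open>Weights of arrows\<close>

text \<open>All ill-typed diagrams form one arrow and so need a common value; the choice of 0 is
  arbitrary.\<close>

lift_definition aw :: "arr \<Rightarrow> real list \<Rightarrow> real list \<Rightarrow> ennreal" is
  "\<lambda>t xs ys. if composable gqa_sig t then wt t xs ys else 0"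
  by (auto simp: wt_def fun_eq_iff gev_sound elim!: arr_rel_cases)

lemma aw_cmp:
  "ok (f \<Zcomp> g) \<Longrightarrow> length xs = dm f \<Longrightarrow> length zs = cd g \<Longrightarrow>
    aw (f \<Zcomp> g) xs zs = (INF ys\<in>{ys. length ys = cd f}. aw f xs ys + aw g ys zs)"
  by transfer (auto simp: wt_Seq)

lemma aw_ten:
  "ok f \<Longrightarrow> ok g \<Longrightarrow> length xs = dm f \<Longrightarrow> length ys = cd f \<Longrightarrow> length xs' = dm g \<Longrightarrow> length ys' = cd g \<Longrightarrow>
    aw (f \<boxtimes> g) (xs @ xs') (ys @ ys') = aw f xs ys + aw g xs' ys'"
  by transfer (auto simp: wt_Par)

lemma aw_idn: "length xs = n \<Longrightarrow> length ys = n \<Longrightarrow> aw (idn n) xs ys = holds (xs = ys)"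
  by transfer (simp add: wt_Wires)

lemma aw_sw: "length xs = m + n \<Longrightarrow> length ys = n + m \<Longrightarrow>
    aw (sw m n) xs ys = holds (ys = drop m xs @ take m xs)"
  by transfer (use wt_Swap[of "take _ _" _ "drop _ _"] in \<open>simp add: wt_rel\<close>)

lemma aw_gen: "aw (gen g) xs ys = wt (Gen g) xs ys"
  by transfer simp

lemma aw_gen_rel: "g \<noteq> Nu \<Longrightarrow> length xs = fst (gqa_sig g) \<Longrightarrow> length ys = snd (gqa_sig g) \<Longrightarrow>
    aw (gen g) xs ys = holds (gen_rel g xs ys)"
  by (simp add: aw_gen wt_gen)

text \<open>For an arrow that denotes a function, the infimum in a composite collapses to evaluation
  (\<open>aw_graph_cmp\<close>). The function matters only on lists of the right length, whence
  \<open>graph_cong\<close>.\<close>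

definition graph :: "arr \<Rightarrow> (real list \<Rightarrow> real list) \<Rightarrow> bool" where
  "graph f \<phi> \<longleftrightarrow> ok f \<and> (\<forall>xs. length xs = dm f \<longrightarrow> length (\<phi> xs) = cd f \<and>
     (\<forall>ys. length ys = cd f \<longrightarrow> aw f xs ys = holds (ys = \<phi> xs)))"

lemma graph_cong: "graph f \<phi> \<Longrightarrow> (\<And>xs. length xs = dm f \<Longrightarrow> \<phi> xs = \<psi> xs) \<Longrightarrow> graph f \<psi>"
  by (simp add: graph_def)

lemma aw_graph_cmp:
  assumes "graph f \<phi>" "ok g" "cd f = dm g" "length xs = dm f" "length zs = cd g"
  shows "aw (f \<Zcomp> g) xs zs = aw g (\<phi> xs) zs"
proof -
  have "aw (f \<Zcomp> g) xs zs = (INF ys\<in>{ys. length ys = cd f}. holds (ys = \<phi> xs) + aw g ys zs)"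
    using assms by (subst aw_cmp) (auto simp: graph_def intro!: INF_cong)
  also have "\<dots> = aw g (\<phi> xs) zs"
    by (rule INF_holds(1)) (use assms in \<open>auto simp: graph_def\<close>)
  finally show ?thesis .
qed

lemma graph_cmp: "graph f \<phi> \<Longrightarrow> graph g \<psi> \<Longrightarrow> cd f = dm g \<Longrightarrow> graph (f \<Zcomp> g) (\<psi> \<circ> \<phi>)"
proof -
  assume *: "graph f \<phi>" "graph g \<psi>" "cd f = dm g"
  then have "aw (f \<Zcomp> g) xs zs = holds (zs = \<psi> (\<phi> xs))" if "length xs = dm f" "length zs = cd g" for xs zs
    using that by (subst aw_graph_cmp[OF *(1)]) (auto simp: graph_def)
  with * show ?thesis by (simp add: graph_def)
qed

lemma graph_ten:
  assumes "graph f \<phi>" "graph g \<psi>"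
  shows "graph (f \<boxtimes> g) (\<lambda>xs. \<phi> (take (dm f) xs) @ \<psi> (drop (dm f) xs))"
proof -
  have ok: "ok f" "ok g" using assms by (auto simp: graph_def)
  have "aw (f \<boxtimes> g) xs ys = holds (ys = \<phi> (take (dm f) xs) @ \<psi> (drop (dm f) xs))"
    if "length xs = dm f + dm g" "length ys = cd f + cd g" for xs ys
  proof -
    have "aw (f \<boxtimes> g) (take (dm f) xs @ drop (dm f) xs) (take (cd f) ys @ drop (cd f) ys) =
        aw f (take (dm f) xs) (take (cd f) ys) + aw g (drop (dm f) xs) (drop (cd f) ys)"
      by (rule aw_ten) (use that ok in auto)
    also have "\<dots> = holds (take (cd f) ys = \<phi> (take (dm f) xs) \<and> drop (cd f) ys = \<psi> (drop (dm f) xs))"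
      using that assms by (simp add: graph_def holds_add)
    also have "(take (cd f) ys = \<phi> (take (dm f) xs) \<and> drop (cd f) ys = \<psi> (drop (dm f) xs)) \<longleftrightarrow>
        ys = \<phi> (take (dm f) xs) @ \<psi> (drop (dm f) xs)"
    proof -
      have "length (\<phi> (take (dm f) xs)) = cd f" using that assms(1) by (simp add: graph_def)
      then show ?thesis
        using append_eq_conv_conj[of "\<phi> (take (dm f) xs)" "\<psi> (drop (dm f) xs)" ys] by auto
    qed
    finally show ?thesis by simp
  qed
  then show ?thesis using assms ok by (simp add: graph_def)
qed

lemma graph_idn: "graph (idn n) id"
  by (auto simp: graph_def aw_idn intro!: holds_cong)

lemma graph_sw: "graph (sw m n) (\<lambda>xs. drop m xs @ take m xs)"
  by (simp add: graph_def aw_sw)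

lemma graph_gen:
  "graph cp (\<lambda>xs. [xs ! 0, xs ! 0])" "graph dl (\<lambda>xs. [])" "graph ad (\<lambda>xs. [xs ! 0 + xs ! 1])"
  "graph ze (\<lambda>xs. [0])" "graph (sc k) (\<lambda>xs. [k * xs ! 0])" "graph on (\<lambda>xs. [1])"
  by (simp_all add: graph_def aw_gen_rel numeral_2_eq_2)

lemma graph_del: "graph (del n) (\<lambda>xs. [])"
proof (induction n)
  case 0
  show ?case using graph_idn[of 0] by (simp add: graph_def)
next
  case (Suc n)
  show ?case using graph_ten[OF Suc graph_gen(2)] by simp
qed

lemma graph_dup: "graph (dup n) (\<lambda>xs. xs @ xs)"
proof (induction n)
  case 0
  show ?case using graph_idn[of 0] by (simp add: graph_def)
next
  case (Suc n)
  note g = graph_cmp[OF graph_ten[OF Suc graph_gen(1)] graph_ten[OF graph_idn graph_ten[OF graph_sw graph_idn]], of n n 1 1]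
  have "graph (dup (Suc n)) ((\<lambda>xs. id (take n xs) @ (\<lambda>xs. drop n xs @ take n xs) (take (n + 1) (drop n xs)) @ id (drop (n + 1) (drop n xs))) \<circ>
     (\<lambda>xs. (\<lambda>xs. xs @ xs) (take n xs) @ (\<lambda>xs. [xs ! 0, xs ! 0]) (drop n xs)))"
    using g by (simp add: wh_def numeral_2_eq_2)
  then show ?case
  proof (rule graph_cong)
    fix xs :: "real list" assume "length xs = dm (dup (Suc n))"
    then have len: "length xs = Suc n" by (simp del: dup.simps)
    define ys a where "ys = take n xs" and "a = xs ! n"
    have xs: "xs = ys @ [a]" "length ys = n"
      using len by (auto simp: ys_def a_def take_Suc_conv_app_nth[symmetric])
    show "((\<lambda>xs. id (take n xs) @ (\<lambda>xs. drop n xs @ take n xs) (take (n + 1) (drop n xs)) @ id (drop (n + 1) (drop n xs))) \<circ>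
      (\<lambda>xs. (\<lambda>xs. xs @ xs) (take n xs) @ (\<lambda>xs. [xs ! 0, xs ! 0]) (drop n xs))) xs = xs @ xs"
      unfolding xs(1) using xs(2) by simp
  qed
qed

definition lf :: "nat \<Rightarrow> (nat \<Rightarrow> real) \<Rightarrow> real list \<Rightarrow> real" where
  "lf p r xs = (\<Sum>i<p. r i * xs ! i)"

lemma lf_snoc [simp]: "length xs = p \<Longrightarrow> lf (Suc p) r (xs @ [w]) = lf p r xs + r p * w"
  by (simp add: lf_def nth_append)

lemma graph_lin: "graph (lin p r) (\<lambda>xs. [lf p r xs])"
proof (induction p)
  case 0
  show ?case using graph_gen(4) by (simp add: lf_def)
next
  case (Suc p)
  have "graph (lin (Suc p) r) ((\<lambda>xs. [xs ! 0 + xs ! 1]) \<circ>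
      (\<lambda>xs. (\<lambda>xs. [lf p r xs]) (take p xs) @ (\<lambda>xs. [r p * xs ! 0]) (drop p xs)))"
    using graph_cmp[OF graph_ten[OF Suc graph_gen(5)] graph_gen(3)] by (simp add: numeral_2_eq_2)
  then show ?case
  proof (rule graph_cong)
    fix xs :: "real list" assume "length xs = dm (lin (Suc p) r)"
    then have len: "length xs = Suc p" by simp
    have "lf p r (take p xs) = lf p r xs" by (simp add: lf_def)
    then show "((\<lambda>xs. [xs ! 0 + xs ! 1]) \<circ> (\<lambda>xs. (\<lambda>xs. [lf p r xs]) (take p xs) @ (\<lambda>xs. [r p * xs ! 0]) (drop p xs))) xs
        = [lf (Suc p) r xs]"
      using len by (simp add: lf_def)
  qed
qed

section \<open>Weights of row lists\<close>

definition row_weight :: "nat \<Rightarrow> row \<Rightarrow> real list \<Rightarrow> ennreal" where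
  "row_weight p x xs = (if fst x then holds (lf p (snd x) xs = 0) else ennreal (1 / 2 * (lf p (snd x) xs)\<^sup>2))"

primrec weight :: "nat \<Rightarrow> row list \<Rightarrow> real list \<Rightarrow> ennreal" where
  "weight p [] xs = 0"
| "weight p (x # L) xs = row_weight p x xs + weight p L xs"

lemma aw_cap1: "aw cap1 [a, b] [] = holds (a = b)"
proof -
  have "aw cap1 [a, b] [] = (INF ys\<in>{ys. length ys = 1}. holds (gen_rel CoCopy [a, b] ys) + holds (gen_rel Discard ys []))"
    unfolding cap1_def by (subst aw_cmp) (auto simp: aw_gen_rel numeral_2_eq_2 intro!: INF_cong)
  also have "\<dots> = holds (\<exists>ys\<in>{ys. length ys = 1}. gen_rel CoCopy [a, b] ys \<and> gen_rel Discard ys [])"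
    by (rule INF_holds_holds)
  also have "(\<exists>ys\<in>{ys. length ys = 1}. gen_rel CoCopy [a, b] ys \<and> gen_rel Discard ys []) \<longleftrightarrow> a = b"
    by (auto intro!: exI[of _ "[b]"])
  finally show ?thesis .
qed

lemma aw_cnu: "aw cnu [a] [] = ennreal (1 / 2 * a\<^sup>2)"
proof -
  have "aw cnu [a] [] = (INF ys\<in>{ys. length ys = 2}. ennreal (1 / 2 * (ys ! 0)\<^sup>2) + holds (ys = [a, a]))"
    unfolding cnu_def
  proof (subst aw_cmp)
    show "(INF ys\<in>{ys. length ys = cd (nu \<boxtimes> W)}. aw (nu \<boxtimes> W) [a] ys + aw cap1 ys []) =
        (INF ys\<in>{ys. length ys = 2}. ennreal (1 / 2 * (ys ! 0)\<^sup>2) + holds (ys = [a, a]))"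
    proof (rule INF_cong)
      fix ys :: "real list" assume "ys \<in> {ys. length ys = 2}"
      then obtain u v where ys: "ys = [u, v]" by (auto simp: numeral_2_eq_2 elim!: length_SucE)
      have "aw (nu \<boxtimes> W) ([] @ [a]) ([u] @ [v]) = aw nu [] [u] + aw W [a] [v]"
        by (rule aw_ten) simp_all
      then show "aw (nu \<boxtimes> W) [a] ys + aw cap1 ys [] = ennreal (1 / 2 * (ys ! 0)\<^sup>2) + holds (ys = [a, a])"
        by (auto simp: ys aw_gen wt_nu aw_idn aw_cap1 add.assoc holds_add intro!: holds_cong)
    qed (simp add: numeral_2_eq_2)
  qed (simp_all add: numeral_2_eq_2)
  also have "\<dots> = ennreal (1 / 2 * ([a, a] ! 0)\<^sup>2)"
    by (rule INF_holds(2)) auto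
  finally show ?thesis by simp
qed

lemma aw_ef: "length xs = p \<Longrightarrow> aw (ef p x) xs [] = row_weight p x xs"
proof -
  assume xs: "length xs = p"
  have "aw (zr p r) xs [] = holds (lf p r xs = 0)" for r
    unfolding zr_def using xs by (subst aw_graph_cmp[OF graph_lin]) (auto simp: aw_gen_rel)
  moreover have "aw (nr p r) xs [] = ennreal (1 / 2 * (lf p r xs)\<^sup>2)" for r
    unfolding nr_def using xs by (subst aw_graph_cmp[OF graph_lin]) (auto simp: aw_cnu)
  ultimately show ?thesis by (simp add: ef_def row_weight_def)
qed

lemma aw_cnj: "eff p e \<Longrightarrow> eff p e' \<Longrightarrow> length xs = p \<Longrightarrow> aw (cnj p e e') xs [] = aw e xs [] + aw e' xs []"
  unfolding cnj_def
  by (subst aw_graph_cmp[OF graph_dup]) (use aw_ten[of e e' xs "[]" xs "[]"] in \<open>auto simp: eff_def\<close>)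

lemma aw_effs: "length xs = p \<Longrightarrow> aw (effs p L) xs [] = weight p L xs"
proof (induction L)
  case Nil
  then show ?case using graph_del[of p] by (simp add: graph_def)
next
  case (Cons x L)
  then show ?case by (simp add: aw_cnj aw_ef)
qed

lemma aw_effs_dl: "length xs = p \<Longrightarrow> aw (effs p L \<boxtimes> dl) (xs @ [w]) [] = weight p L xs"
  using aw_ten[of "effs p L" dl xs "[]" "[w]" "[]"] by (simp add: aw_effs aw_gen_rel)

lemma aw_plug_on: "eff (Suc p) e \<Longrightarrow> length xs = p \<Longrightarrow> aw ((idn p \<boxtimes> on) \<Zcomp> e) xs [] = aw e (xs @ [1]) []"
  by (subst aw_graph_cmp[OF graph_ten[OF graph_idn graph_gen(6)]]) (auto simp: eff_def)

lemma lf_map_mult: "length xs = p \<Longrightarrow> lf p r (map ((*) c) xs) = c * lf p r xs"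
  by (simp add: lf_def sum_distrib_left mult_ac)

lemma lf_map2_add: "length xs = p \<Longrightarrow> length ys = p \<Longrightarrow> lf p r (map2 (+) xs ys) = lf p r xs + lf p r ys"
  by (simp add: lf_def sum.distrib ring_distribs)

lemma lf_map2_diff: "length xs = p \<Longrightarrow> length ys = p \<Longrightarrow> lf p r (map2 (-) xs ys) = lf p r xs - lf p r ys"
  by (simp add: lf_def sum_subtractf ring_distribs)

lemma lf_zero: "lf p r (replicate p 0) = 0"
  by (simp add: lf_def)

lemma weight_scale:
  assumes "c \<noteq> 0" "length xs = p"
  shows "weight p L (map ((*) c) xs) = ennreal (c\<^sup>2) * weight p L xs"
proof (induction L)
  case (Cons x L)
  have "row_weight p x (map ((*) c) xs) = ennreal (c\<^sup>2) * row_weight p x xs"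
    using assms by (auto simp: row_weight_def lf_map_mult holds_def power_mult_distrib ennreal_mult[symmetric]
        ennreal_mult_top mult_ac)
  then show ?case using Cons by (simp add: ring_distribs)
qed simp

lemma weight_parallelogram:
  assumes "length xs = p" "length ys = p"
  shows "weight p L (map2 (+) xs ys) + weight p L (map2 (-) xs ys) = 2 * weight p L xs + 2 * weight p L ys"
proof (induction L)
  case (Cons x L)
  have "row_weight p x (map2 (+) xs ys) + row_weight p x (map2 (-) xs ys) = 2 * row_weight p x xs + 2 * row_weight p x ys"
  proof (cases "fst x")
    case True
    \<comment> \<open>A constraint holds at both the sum and the difference exactly when it holds at
      \<open>xs\<close> and at \<open>ys\<close>, and doubling changes neither 0 nor
      infinity.\<close>
    have h: "2 * holds P = holds P" for P by (simp add: holds_def ennreal_mult_top)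
    show ?thesis using assms True
      by (auto simp: row_weight_def lf_map2_add lf_map2_diff holds_add h intro!: holds_cong)
  next
    case False
    have two: "2 * ennreal u = ennreal (2 * u)" for u
      by (simp add: ennreal_mult')
    define u v where "u = lf p (snd x) xs" and "v = lf p (snd x) ys"
    have "ennreal (1 / 2 * (u + v)\<^sup>2) + ennreal (1 / 2 * (u - v)\<^sup>2) =
        ennreal (1 / 2 * (u + v)\<^sup>2 + 1 / 2 * (u - v)\<^sup>2)"
      by (rule ennreal_plus[symmetric]) simp_all
    also have "1 / 2 * (u + v)\<^sup>2 + 1 / 2 * (u - v)\<^sup>2 = 2 * (1 / 2 * u\<^sup>2) + 2 * (1 / 2 * v\<^sup>2)"
      by (simp add: power2_eq_square algebra_simps)
    also have "ennreal \<dots> = ennreal (2 * (1 / 2 * u\<^sup>2)) + ennreal (2 * (1 / 2 * v\<^sup>2))"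
      by (rule ennreal_plus) simp_all
    finally show ?thesis
      using assms False by (simp only: row_weight_def lf_map2_add lf_map2_diff if_False two u_def v_def)
  qed
  then have "weight p (x # L) (map2 (+) xs ys) + weight p (x # L) (map2 (-) xs ys) =
     (2 * row_weight p x xs + 2 * row_weight p x ys) + (2 * weight p L xs + 2 * weight p L ys)"
    using Cons by (simp add: add_ac)
  then show ?case by (simp add: ring_distribs add_ac)
qed simp

lemma weight_zero: "weight p L (replicate p 0) = 0"
  by (induction L) (simp_all add: row_weight_def lf_zero)

section \<open>Completeness\<close>

lemma effs_0: "effs 0 L = idn 0"
proof (induction L)
  case (Cons x L)
  have "ef 0 x = idn 0" by (simp add: ef_def zr_def nr_def ax_linear ze_cnu)
  with Cons show ?case by (simp add: cnj_def)
qed simp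

lemma ef_absorb:
  assumes "\<And>i. d i = r' i - r i"
  shows "cnj p (ef p (b, r)) (ef p (True, d)) = cnj p (ef p (b, r')) (ef p (True, d))"
proof -
  have r': "r' = (\<lambda>i. r i + 1 * d i)" using assms by auto
  have "cnj p (ef p (True, d)) (ef p (b, r')) = cnj p (ef p (True, d)) (ef p (b, r))"
    using zr_shear[of p d r 1] zr_nr_shear[of p d r 1] by (simp only: ef_def fst_conv snd_conv r' if_True) simp
  then show ?thesis by (simp add: cnj_comm[of p _ "ef p (True, d)"])
qed

text \<open>A row may be replaced by another one as soon as adding the constraint that the two agree
  does not change the remaining effect. This takes the place of all dimension arguments.\<close>

lemma ef_exchange:
  assumes "effs p L = effs p ((True, d) # L)" "\<And>i. d i = r' i - r i" "d p = 0"
  shows "cnj (Suc p) (ef (Suc p) (b, r)) (effs p L \<boxtimes> dl) = cnj (Suc p) (ef (Suc p) (b, r')) (effs p L \<boxtimes> dl)"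
proof -
  have e: "effs p L \<boxtimes> dl = cnj (Suc p) (ef (Suc p) (True, d)) (effs p L \<boxtimes> dl)"
    by (subst assms(1)) (simp add: ten_dl_cnj ef_pad assms(3))
  have "cnj (Suc p) (ef (Suc p) (b, r)) (effs p L \<boxtimes> dl) =
      cnj (Suc p) (cnj (Suc p) (ef (Suc p) (b, r)) (ef (Suc p) (True, d))) (effs p L \<boxtimes> dl)"
    by (subst e) (simp add: cnj_assoc)
  also have "\<dots> = cnj (Suc p) (ef (Suc p) (b, r')) (cnj (Suc p) (ef (Suc p) (True, d)) (effs p L \<boxtimes> dl))"
    by (simp add: ef_absorb[OF assms(2)] cnj_assoc)
  finally show ?thesis by (simp only: e[symmetric])
qed

lemma lf_diff: "(\<And>i. d i = r' i - r i) \<Longrightarrow> lf p d xs = lf p r' xs - lf p r xs"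
  by (simp add: lf_def sum_subtractf left_diff_distrib)

lemma holds_eq_0_iff [simp]: "holds P = 0 \<longleftrightarrow> P" "0 = holds P \<longleftrightarrow> P"
  by (auto simp: holds_def)

lemma holds_top_iff [simp]: "holds P = \<infinity> \<longleftrightarrow> \<not> P" "holds P = top_class.top \<longleftrightarrow> \<not> P"
  by (auto simp: holds_def)

text \<open>Each square is made to vanish in turn by the choice of \<open>w\<close>. This gives A =
  D + A' and A' = D + A, where D is half the squared difference of a and a'. Hence A = A', and D is
  0 unless A is infinite.\<close>

lemma quad_add_eq:
  fixes A A' :: ennreal
  assumes "\<beta> \<noteq> 0"
    and eq: "\<And>w. ennreal (1 / 2 * (a + \<beta> * w)\<^sup>2) + A = ennreal (1 / 2 * (a' + \<beta> * w)\<^sup>2) + A'"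
  shows "A = A' \<and> (A = \<infinity> \<or> a = a')"
proof -
  define D where "D = ennreal (1 / 2 * (a' - a)\<^sup>2)"
  have 1: "A = D + A'" using eq[of "- a / \<beta>"] assms(1) by (simp add: D_def)
  have 2: "D + A = A'" using eq[of "- a' / \<beta>"] assms(1) by (simp add: D_def power2_commute[of a a'])
  have "A' \<le> A" unfolding 1 by simp
  moreover have "A \<le> A'" unfolding 2[symmetric] by simp
  ultimately have A: "A = A'" by simp
  show ?thesis
  proof (cases "A = \<infinity>")
    case False
    then have "D = 0" using 1 A by (metis add.commute add_0 ennreal_add_left_cancel infinity_ennreal_def)
    then have "1 / 2 * (a' - a)\<^sup>2 \<le> 0" unfolding D_def by (simp only: ennreal_eq_0_iff)
    then show ?thesis using A by simp
  qed (use A in simp)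
qed

theorem effs_complete:
  assumes "\<And>xs. length xs = p \<Longrightarrow> weight p L xs = weight p M xs"
  shows "effs p L = effs p M"
  using assms
proof (induction p arbitrary: L M)
  case 0
  then show ?case by (simp add: effs_0)
next
  case (Suc p)
  obtain x L0 where x: "last_normal p x" and
    L: "effs (Suc p) L = cnj (Suc p) (ef (Suc p) x) (effs p L0 \<boxtimes> dl)" using effs_reduce by blast
  obtain y M0 where y: "last_normal p y" and
    M: "effs (Suc p) M = cnj (Suc p) (ef (Suc p) y) (effs p M0 \<boxtimes> dl)" using effs_reduce by blast
  obtain b r where xb: "x = (b, r)" by (cases x)
  obtain b' r' where yb: "y = (b', r')" by (cases y)
  have wL: "weight (Suc p) L (xs @ [w]) = row_weight (Suc p) x (xs @ [w]) + weight p L0 xs"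
    if "length xs = p" for xs w
    using that by (simp add: aw_effs[symmetric] L aw_cnj aw_ef) (simp add: aw_effs aw_effs_dl)
  have wM: "weight (Suc p) M (xs @ [w]) = row_weight (Suc p) y (xs @ [w]) + weight p M0 xs"
    if "length xs = p" for xs w
    using that by (simp add: aw_effs[symmetric] M aw_cnj aw_ef) (simp add: aw_effs aw_effs_dl)
  have eq: "row_weight (Suc p) x (xs @ [w]) + weight p L0 xs = row_weight (Suc p) y (xs @ [w]) + weight p M0 xs"
    if "length xs = p" for xs w
    using Suc.prems[of "xs @ [w]"] that by (simp add: wL wM)
  \<comment> \<open>At the last unit vector the remaining rows contribute nothing, so the pivots
    alone must have equal weight there. This decides whether they are constraints or costs, and it
    fixes the last coefficient of a cost.\<close>
  have eq0: "row_weight (Suc p) x (replicate p 0 @ [1]) = row_weight (Suc p) y (replicate p 0 @ [1])"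
    using eq[of "replicate p 0" 1] by (simp add: weight_zero)
  define d where "d = (\<lambda>i. r' i - r i)"
  have lfd: "lf p d xs = lf p r' xs - lf p r xs" for xs by (rule lf_diff) (simp add: d_def)
  \<comment> \<open>The difference \<open>d\<close> of the two forms vanishes wherever the remainder
    is finite, so as a constraint it is free by induction, and \<open>ef_exchange\<close> turns one
    pivot into the other.\<close>
  have finish: ?case if rp: "b = b'" "r p = r' p" and
    w: "\<And>xs. length xs = p \<Longrightarrow> weight p L0 xs = weight p M0 xs \<and> (weight p L0 xs = \<infinity> \<or> lf p r xs = lf p r' xs)"
  proof -
    have LM: "effs p L0 = effs p M0" using w by (intro Suc.IH) blast
    have "effs p L0 = effs p ((True, d) # L0)"
    proof (rule Suc.IH)
      fix xs :: "real list" assume "length xs = p"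
      with w[of xs] show "weight p L0 xs = weight p ((True, d) # L0) xs"
        by (auto simp: row_weight_def lfd)
    qed
    then show ?thesis
      unfolding L M xb yb rp(1) LM[symmetric] by (rule ef_exchange) (simp_all add: d_def rp(2))
  qed
  show ?case
  proof (cases b)
    case True
    then have rp: "r p = 1" using x by (simp add: xb last_normal_def)
    have b': "b'"
    proof (rule ccontr)
      assume "\<not> b'"
      then show False using eq0 True rp by (simp add: row_weight_def xb yb lf_zero)
    qed
    then have r'p: "r' p = 1" using y by (simp add: yb last_normal_def)
    show ?thesis
    proof (rule finish)
      fix xs :: "real list" assume len: "length xs = p"
      \<comment> \<open>The last coordinate is chosen to satisfy the constraint of one pivot, so
        that only the other pivot contributes.\<close>
      have 1: "weight p L0 xs = holds (lf p r' xs - lf p r xs = 0) + weight p M0 xs"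
        using eq[OF len, of "- lf p r xs"] len True b' rp r'p by (simp add: row_weight_def xb yb)
      have 2: "holds (lf p r xs - lf p r' xs = 0) + weight p L0 xs = weight p M0 xs"
        using eq[OF len, of "- lf p r' xs"] len True b' rp r'p by (simp add: row_weight_def xb yb)
      show "weight p L0 xs = weight p M0 xs \<and> (weight p L0 xs = \<infinity> \<or> lf p r xs = lf p r' xs)"
        using 1 2 by (cases "lf p r xs = lf p r' xs") auto
    qed (use True b' rp r'p in auto)
  next
    case False
    then have rp: "0 \<le> r p" using x by (simp add: xb last_normal_def)
    have b': "\<not> b'"
    proof
      assume "b'"
      then show False using eq0 False y by (simp add: row_weight_def xb yb lf_zero last_normal_def)
    qed
    then have r'p: "0 \<le> r' p" using y by (simp add: yb last_normal_def)
    have "ennreal (1 / 2 * (r p)\<^sup>2) = ennreal (1 / 2 * (r' p)\<^sup>2)"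
      using eq0 False b' by (simp add: row_weight_def xb yb lf_zero)
    then have rr: "r p = r' p"
      using rp r'p by (simp add: power2_eq_iff_nonneg)
    have q: "ennreal (1 / 2 * (lf p r xs + r p * w)\<^sup>2) + weight p L0 xs = ennreal (1 / 2 * (lf p r' xs + r p * w)\<^sup>2) + weight p M0 xs"
      if "length xs = p" for xs w
      using eq[OF that, of w] that False b' by (simp add: row_weight_def xb yb rr)
    show ?thesis
    proof (cases "r p = 0")
      case True
      \<comment> \<open>Weights cannot separate a pivot without the last variable from the remaining
        rows, so it is returned to them before the induction hypothesis is used.\<close>
      have "effs p (x # L0) = effs p (y # M0)"
      proof (rule Suc.IH)
        fix xs :: "real list" assume "length xs = p"
        from q[OF this, of 0] show "weight p (x # L0) xs = weight p (y # M0) xs"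
          using False b' by (simp add: row_weight_def xb yb)
      qed
      moreover have "effs (Suc p) L = effs p (x # L0) \<boxtimes> dl"
        using True unfolding L by (simp add: ef_pad xb ten_dl_cnj)
      moreover have "effs (Suc p) M = effs p (y # M0) \<boxtimes> dl"
        using True rr unfolding M by (simp add: ef_pad yb ten_dl_cnj)
      ultimately show ?thesis by simp
    next
      case nz: False
      show ?thesis
      proof (rule finish)
        fix xs :: "real list" assume "length xs = p"
        from quad_add_eq[OF nz q[OF this]]
        show "weight p L0 xs = weight p M0 xs \<and> (weight p L0 xs = \<infinity> \<or> lf p r xs = lf p r' xs)" .
      qed (use False b' rr in auto)
    qed
  qed
qed

subsection \<open>The affine case\<close>

lemma scalar_ten_comm: "ok s \<Longrightarrow> dm s = 0 \<Longrightarrow> cd s = 0 \<Longrightarrow> ok f \<Longrightarrow> s \<boxtimes> f = f \<boxtimes> s"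
  using sw_natural[of s 0 0 f "dm f" "cd f"] by simp

lemma cnj_scalar:
  assumes "ok s" "dm s = 0" "cd s = 0" "eff p e" "eff p e'"
  shows "cnj p (s \<boxtimes> e) e' = s \<boxtimes> cnj p e e'"
  using interchange[of "idn 0" s "dup p" "e \<boxtimes> e'"] assms by (simp add: cnj_def ten_assoc eff_def)

primrec cdel :: "nat \<Rightarrow> arr" where
  "cdel 0 = idn 0"
| "cdel (Suc n) = cdel n \<boxtimes> cdl"

lemma cdel_types [simp]: "ok (cdel n)" "dm (cdel n) = 0" "cd (cdel n) = n"
proof -
  have "ok (cdel n) \<and> dm (cdel n) = 0 \<and> cd (cdel n) = n" by (induction n) simp_all
  then show "ok (cdel n)" "dm (cdel n) = 0" "cd (cdel n) = n" by auto
qed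

text \<open>Homogeneous rows cost nothing at the origin, so hiding all variables never yields an
  inconsistency; diagrammatically this is iterated \<open>hide_effs\<close>.\<close>

lemma cdel_effs: "cdel n \<Zcomp> effs n L = idn 0"
proof (induction n arbitrary: L)
  case 0
  then show ?case by (simp add: effs_0)
next
  case (Suc n)
  obtain L' where L': "(idn n \<boxtimes> cdl) \<Zcomp> effs (Suc n) L = effs n L'" using hide_effs by blast
  have "cdel (Suc n) \<Zcomp> effs (Suc n) L = cdel n \<Zcomp> ((idn n \<boxtimes> cdl) \<Zcomp> effs (Suc n) L)"
    using ten_wh[of "cdel n" cdl] by (simp add: wh_def cmp_assoc)
  then show ?case by (simp add: L' Suc)
qed

abbreviation "falsum \<equiv> on \<Zcomp> cze"

text \<open>\<open>falsum\<close> is the constraint 1 = 0. The axiom \<open>one_cozero\<close> lets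
  it cut one wire; since it commutes with every arrow in a tensor, it can travel and cut them
  all.\<close>

lemma falsum_idn: "falsum \<boxtimes> idn n = falsum \<boxtimes> (del n \<Zcomp> cdel n)"
proof (induction n)
  case (Suc n)
  have "falsum \<boxtimes> idn (Suc n) = (falsum \<boxtimes> idn n) \<boxtimes> W"
    by (simp add: ten_assoc idn_ten_idn)
  also have "\<dots> = falsum \<boxtimes> ((del n \<Zcomp> cdel n) \<boxtimes> W)"
    by (simp only: Suc ten_assoc)
  also have "\<dots> = (del n \<Zcomp> cdel n) \<boxtimes> (falsum \<boxtimes> W)"
    using scalar_ten_comm[of falsum "(del n \<Zcomp> cdel n)"] by (simp add: ten_assoc[symmetric])
  also have "\<dots> = (del n \<Zcomp> cdel n) \<boxtimes> (falsum \<boxtimes> (dl \<Zcomp> cdl))"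
    by (simp only: ax_affine(3))
  also have "\<dots> = falsum \<boxtimes> ((del n \<Zcomp> cdel n) \<boxtimes> (dl \<Zcomp> cdl))"
    using scalar_ten_comm[of falsum "(del n \<Zcomp> cdel n)"] by (simp add: ten_assoc[symmetric])
  also have "(del n \<Zcomp> cdel n) \<boxtimes> (dl \<Zcomp> cdl) = del (Suc n) \<Zcomp> cdel (Suc n)"
    by (simp add: interchange)
  finally show ?case .
qed simp

lemma falsum_on: "falsum \<boxtimes> on = falsum \<boxtimes> cdl"
proof -
  have "falsum \<boxtimes> on = on \<Zcomp> (falsum \<boxtimes> W)"
    using ten_wh'[of falsum on] scalar_ten_comm[of falsum on] interchange[of "idn 0" falsum on W] by simp
  also have "\<dots> = on \<Zcomp> (falsum \<boxtimes> (dl \<Zcomp> cdl))" by (simp only: ax_affine(3))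
  also have "\<dots> = falsum \<boxtimes> (on \<Zcomp> (dl \<Zcomp> cdl))"
    using interchange[of "idn 0" falsum on "dl \<Zcomp> cdl"] by simp
  also have "on \<Zcomp> (dl \<Zcomp> cdl) = cdl"
    by (simp add: cmp_assoc[symmetric] ax_affine)
  finally show ?thesis .
qed

text \<open>Once \<open>falsum\<close> has cut every wire into the effect, including that of the
  constant, the effect is fed by \<open>cdel\<close> alone and disappears by
  \<open>cdel_effs\<close>.\<close>

lemma falsum_effect: "falsum \<boxtimes> ((idn p \<boxtimes> on) \<Zcomp> effs (Suc p) L) = falsum \<boxtimes> del p"
proof -
  have "falsum \<boxtimes> ((idn p \<boxtimes> on) \<Zcomp> effs (Suc p) L) = (falsum \<boxtimes> idn p \<boxtimes> on) \<Zcomp> effs (Suc p) L"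
    using interchange[of falsum "idn 0" "idn p \<boxtimes> on" "effs (Suc p) L"] by simp
  also have "falsum \<boxtimes> idn p \<boxtimes> on = (falsum \<boxtimes> idn p) \<boxtimes> on" by (simp add: ten_assoc)
  also have "\<dots> = falsum \<boxtimes> (del p \<Zcomp> cdel p) \<boxtimes> on" by (simp only: falsum_idn ten_assoc)
  also have "\<dots> = (del p \<Zcomp> cdel p) \<boxtimes> (falsum \<boxtimes> on)"
    using scalar_ten_comm[of falsum "del p \<Zcomp> cdel p"] by (simp add: ten_assoc[symmetric])
  also have "\<dots> = (del p \<Zcomp> cdel p) \<boxtimes> (falsum \<boxtimes> cdl)" by (simp only: falsum_on)
  also have "\<dots> = falsum \<boxtimes> ((del p \<Zcomp> cdel p) \<boxtimes> cdl)"
    using scalar_ten_comm[of falsum "del p \<Zcomp> cdel p"] by (simp add: ten_assoc[symmetric])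
  also have "(del p \<Zcomp> cdel p) \<boxtimes> cdl = del p \<Zcomp> cdel (Suc p)"
    using interchange[of "del p" "cdel p" "idn 0" cdl] by simp
  also have "(falsum \<boxtimes> (del p \<Zcomp> cdel (Suc p))) \<Zcomp> effs (Suc p) L = falsum \<boxtimes> (del p \<Zcomp> (cdel (Suc p) \<Zcomp> effs (Suc p) L))"
    using interchange[of falsum "idn 0" "del p \<Zcomp> cdel (Suc p)" "effs (Suc p) L"]
    by (simp add: cmp_assoc del: cdel.simps effs.simps)
  also have "cdel (Suc p) \<Zcomp> effs (Suc p) L = idn 0" by (rule cdel_effs)
  finally show ?thesis by simp
qed

text \<open>By scaling, the weight is infinite at every nonzero height, so by
  \<open>effs_complete\<close> the constraint that the last coordinate is 0 can be added without
  changing the effect. Plugging in the constant turns that constraint into \<open>falsum\<close>,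
  which absorbs the rest.\<close>

lemma inconsistent_effect:
  assumes "\<And>xs. length xs = p \<Longrightarrow> weight (Suc p) L (xs @ [1]) = \<infinity>"
  shows "(idn p \<boxtimes> on) \<Zcomp> effs (Suc p) L = falsum \<boxtimes> del p"
proof -
  define u where "u = (\<lambda>i. if i = p then 1 else (0::real))"
  have lfu: "lf (Suc p) u (xs @ [w]) = w" if "length xs = p" for xs w
  proof -
    have "lf p u xs = 0" by (simp add: lf_def u_def)
    then show ?thesis using that by (simp add: u_def)
  qed
  have "effs (Suc p) L = effs (Suc p) ((True, u) # L)"
  proof (rule effs_complete)
    fix zs :: "real list" assume "length zs = Suc p"
    then obtain xs w where zs: "zs = xs @ [w]" "length xs = p"
      by (metis append_butlast_last_id length_0_conv length_butlast diff_Suc_1 nat.distinct(1))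
    show "weight (Suc p) L zs = weight (Suc p) ((True, u) # L) zs"
    proof (cases "w = 0")
      case True
      have "lf (Suc p) u zs = w" unfolding zs(1) by (rule lfu[OF zs(2)])
      with True show ?thesis by (simp add: row_weight_def)
    next
      case False
      have "zs = map ((*) w) (map ((*) (1 / w)) xs @ [1])"
        using False by (simp add: zs o_def)
      moreover have "weight (Suc p) L (map ((*) w) (map ((*) (1 / w)) xs @ [1])) = ennreal (w\<^sup>2) * \<infinity>"
        using False zs(2) by (subst weight_scale) (simp_all add: assms)
      ultimately have "weight (Suc p) L zs = \<infinity>"
        using False by (simp add: ennreal_mult_top)
      then show ?thesis by simp
    qed
  qed
  also have "\<dots> = cnj (Suc p) (del p \<boxtimes> cze) (effs (Suc p) L)"
    using interchange[of "del p" "idn 0" W cze] by (simp add: ef_def zr_def u_def lin_unit del: lin.simps)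
  finally have "(idn p \<boxtimes> on) \<Zcomp> effs (Suc p) L = (idn p \<boxtimes> on) \<Zcomp> cnj (Suc p) (del p \<boxtimes> cze) (effs (Suc p) L)"
    by (rule arg_cong)
  also have "\<dots> = cnj p ((idn p \<boxtimes> on) \<Zcomp> (del p \<boxtimes> cze)) ((idn p \<boxtimes> on) \<Zcomp> effs (Suc p) L)"
    using cart_cnj[of "idn p \<boxtimes> on" "Suc p" "del p \<boxtimes> cze" "effs (Suc p) L"]
    by (simp add: cart_ten eff_def del: effs.simps)
  also have "(idn p \<boxtimes> on) \<Zcomp> (del p \<boxtimes> cze) = falsum \<boxtimes> del p"
    using scalar_ten_comm[of falsum "del p"] by (simp add: interchange)
  also have "cnj p (falsum \<boxtimes> del p) ((idn p \<boxtimes> on) \<Zcomp> effs (Suc p) L) = falsum \<boxtimes> ((idn p \<boxtimes> on) \<Zcomp> effs (Suc p) L)"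
    by (subst cnj_scalar) (simp_all add: eff_def del: effs.simps)
  finally show ?thesis by (simp only: falsum_effect)
qed

lemma affine_complete:
  assumes eq: "\<And>xs. length xs = p \<Longrightarrow> weight (Suc p) L (xs @ [1]) = weight (Suc p) M (xs @ [1])"
  shows "(idn p \<boxtimes> on) \<Zcomp> effs (Suc p) L = (idn p \<boxtimes> on) \<Zcomp> effs (Suc p) M"
proof (cases "\<forall>xs. length xs = p \<longrightarrow> weight (Suc p) L (xs @ [1]) = \<infinity>")
  case True
  with eq show ?thesis by (simp add: inconsistent_effect del: effs.simps)
next
  case False
  then obtain x0 where x0: "length x0 = p" "weight (Suc p) L (x0 @ [1]) \<noteq> \<infinity>" by blast
  have "effs (Suc p) L = effs (Suc p) M"
  proof (rule effs_complete)
    fix zs :: "real list" assume zlen: "length zs = Suc p"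
    then obtain xs w where zs: "zs = xs @ [w]" "length xs = p"
      by (metis append_butlast_last_id length_0_conv length_butlast diff_Suc_1 nat.distinct(1))
    show "weight (Suc p) L zs = weight (Suc p) M zs"
    proof (cases "w = 0")
      case False
      have "zs = map ((*) w) (map ((*) (1 / w)) xs @ [1])"
        using False by (simp add: zs o_def)
      moreover have "weight (Suc p) N (map ((*) w) (map ((*) (1 / w)) xs @ [1])) =
          ennreal (w\<^sup>2) * weight (Suc p) N (map ((*) (1 / w)) xs @ [1])" for N
        using False zs(2) by (intro weight_scale) simp_all
      ultimately show ?thesis using eq[of "map ((*) (1 / w)) xs"] zs(2) by simp
    next
      case True
      \<comment> \<open>Adding or subtracting a vector of height 0 keeps \<open>z0\<close> at height
        one, where the weights agree. In the parallelogram law the weight at \<open>z0\<close> can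
        be cancelled because it is finite, which leaves the weights at \<open>zs\<close>.\<close>
      define z0 where "z0 = x0 @ [1::real]"
      have len: "length z0 = Suc p" using x0 by (simp add: z0_def)
      have plus: "map2 (+) z0 zs = map2 (+) x0 xs @ [1]" and minus: "map2 (-) z0 zs = map2 (-) x0 xs @ [1]"
        using x0 zs True by (simp_all add: z0_def)
      have "2 * weight (Suc p) L z0 + 2 * weight (Suc p) L zs = 2 * weight (Suc p) M z0 + 2 * weight (Suc p) M zs"
        unfolding weight_parallelogram[OF len zlen, symmetric] plus minus
        using eq[of "map2 (+) x0 xs"] eq[of "map2 (-) x0 xs"] x0 zs(2) by simp
      moreover have "weight (Suc p) M z0 = weight (Suc p) L z0" "weight (Suc p) L z0 \<noteq> \<infinity>"
        using eq[of x0] x0 by (simp_all add: z0_def)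
      ultimately have "2 * weight (Suc p) L zs = 2 * weight (Suc p) M zs"
        by (simp add: ennreal_add_left_cancel ennreal_mult_eq_top_iff)
      then show ?thesis
        by (subst (asm) ennreal_mult_cancel_left) auto
    qed
  qed
  then show ?thesis by simp
qed

subsection \<open>Bending outputs into inputs\<close>

text \<open>The snake equation makes bending injective, which lets \<open>complete\<close> trade
  outputs for inputs.\<close>

lemma unbend:
  assumes "ok f" "dm f = m" "cd f = Suc n"
  shows "(idn m \<boxtimes> cup1) \<Zcomp> (((f \<boxtimes> W) \<Zcomp> (idn n \<boxtimes> cap1)) \<boxtimes> W) = f"
proof -
  have "(idn m \<boxtimes> cup1) \<Zcomp> (((f \<boxtimes> W) \<Zcomp> (idn n \<boxtimes> cap1)) \<boxtimes> W) =
      ((idn m \<boxtimes> cup1) \<Zcomp> (f \<boxtimes> idn 2)) \<Zcomp> (idn n \<boxtimes> cap1 \<boxtimes> W)"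
    using assms by (simp add: ten_cmp_right cmp_assoc ten_assoc idn_ten_idn numeral_2_eq_2)
  also have "(idn m \<boxtimes> cup1) \<Zcomp> (f \<boxtimes> idn 2) = f \<boxtimes> cup1"
    using assms by (simp add: interchange)
  also have "\<dots> = f \<Zcomp> (idn (Suc n) \<boxtimes> cup1)"
    using assms ten_wh[of f cup1] by (simp add: wh_def)
  also have "\<dots> \<Zcomp> (idn n \<boxtimes> cap1 \<boxtimes> W) = f \<Zcomp> ((idn n \<boxtimes> (W \<boxtimes> cup1)) \<Zcomp> (idn n \<boxtimes> (cap1 \<boxtimes> W)))"
    by (simp add: cmp_assoc ten_assoc[symmetric] idn_ten_idn)
  also have "(idn n \<boxtimes> (W \<boxtimes> cup1)) \<Zcomp> (idn n \<boxtimes> (cap1 \<boxtimes> W)) = idn (Suc n)"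
    by (simp add: interchange snake idn_ten_idn numeral_2_eq_2)
  finally show ?thesis using assms by simp
qed

theorem complete:
  assumes "ok f" "ok g" "dm f = m" "dm g = m" "cd f = n" "cd g = n"
    and "\<And>xs ys. length xs = m \<Longrightarrow> length ys = n \<Longrightarrow> aw f xs ys = aw g xs ys"
  shows "f = g"
  using assms
proof (induction n arbitrary: m f g)
  case 0
  then have "eff m f" "eff m g" by (simp_all add: eff_def)
  then obtain L M where L: "f = (idn m \<boxtimes> on) \<Zcomp> effs (Suc m) L" and M: "g = (idn m \<boxtimes> on) \<Zcomp> effs (Suc m) M"
    using effect_normal_form by metis
  show ?case unfolding L M
  proof (rule affine_complete)
    fix xs :: "real list" assume "length xs = m"
    with 0(7)[of xs "[]"] show "weight (Suc m) L (xs @ [1]) = weight (Suc m) M (xs @ [1])"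
      by (simp add: L M aw_plug_on aw_effs del: effs.simps weight.simps)
  qed
next
  case (Suc n)
  let ?b = "\<lambda>f. (f \<boxtimes> W) \<Zcomp> (idn n \<boxtimes> cap1)"
  have "?b f = ?b g"
  proof (rule Suc.IH)
    fix xs ys :: "real list" assume len: "length xs = Suc m" "length ys = n"
    have "aw (f \<boxtimes> W) xs zs = aw (g \<boxtimes> W) xs zs" if "length zs = Suc (Suc n)" for zs
    proof -
      have "aw (h \<boxtimes> W) (take m xs @ drop m xs) (take (Suc n) zs @ drop (Suc n) zs) =
          aw h (take m xs) (take (Suc n) zs) + aw W (drop m xs) (drop (Suc n) zs)"
        if "h = f \<or> h = g" for h
        using Suc.prems \<open>h = f \<or> h = g\<close> \<open>length zs = _\<close> len by (intro aw_ten) auto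
      then show ?thesis
        using Suc.prems(7)[of "take m xs" "take (Suc n) zs"] that len by simp
    qed
    then show "aw (?b f) xs ys = aw (?b g) xs ys"
      using Suc.prems len by (subst (1 2) aw_cmp) (auto simp: numeral_2_eq_2 intro!: INF_cong)
  qed (use Suc.prems in \<open>simp_all add: numeral_2_eq_2\<close>)
  then show ?case
    using unbend[of f m n] unbend[of g m n] Suc.prems by metis
qed

section \<open>Quadratic forms as row lists\<close>

text \<open>Any array is allowed, symmetric or not, so that forms can be changed entry by entry and
  a linear part can later be stored in a single row (\<open>T\<close> in
  \<open>affine_subspace_rows\<close>).\<close>

definition qf :: "nat \<Rightarrow> (nat \<Rightarrow> nat \<Rightarrow> real) \<Rightarrow> real list \<Rightarrow> real" where
  "qf p S xs = (\<Sum>i<p. \<Sum>j<p. S i j * xs ! i * xs ! j)"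

lemma qf_prod: "lf p r xs * lf p s xs = qf p (\<lambda>i j. r i * s j) xs"
  unfolding lf_def qf_def sum_product by (intro sum.cong refl) (simp add: mult_ac)

lemma qf_add: "qf p (\<lambda>i j. S i j + T i j) xs = qf p S xs + qf p T xs"
  by (simp add: qf_def ring_distribs sum.distrib)

lemma qf_scale: "qf p (\<lambda>i j. c * S i j) xs = c * qf p S xs"
  by (simp add: qf_def sum_distrib_left mult_ac)

lemma qf_zero: "qf p S (replicate p 0) = 0"
  by (simp add: qf_def)

lemma qf_snoc:
  assumes "length xs = p"
  shows "qf (Suc p) S (xs @ [w]) = qf p S xs + w * lf p (\<lambda>i. S i p + S p i) xs + S p p * w\<^sup>2"
proof -
  have "qf (Suc p) S (xs @ [w]) =
      (\<Sum>i<p. (\<Sum>j<p. S i j * xs ! i * xs ! j) + S i p * xs ! i * w) + ((\<Sum>j<p. S p j * w * xs ! j) + S p p * w * w)"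
    using assms by (simp add: qf_def nth_append)
  then show ?thesis
    by (simp add: qf_def lf_def sum.distrib ring_distribs sum_distrib_left sum_distrib_right power2_eq_square mult_ac)
qed

section \<open>Linear subspaces and nonnegative forms on them\<close>

definition comb :: "real \<Rightarrow> real list \<Rightarrow> real list \<Rightarrow> real list" where
  "comb c xs ys = map2 (\<lambda>a b. a + c * b) xs ys"

lemma length_comb [simp]: "length (comb c xs ys) = min (length xs) (length ys)"
  by (simp add: comb_def)

lemma comb_snoc [simp]: "length xs = length ys \<Longrightarrow> comb c (xs @ [a]) (ys @ [b]) = comb c xs ys @ [a + c * b]"
  by (simp add: comb_def)

lemma comb_snoc2 [simp]: "length xs = length ys \<Longrightarrow>
    comb c (xs @ [a, a']) (ys @ [b, b']) = comb c xs ys @ [a + c * b, a' + c * b']"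
  by (simp add: comb_def)

lemma lf_comb: "length xs = p \<Longrightarrow> length ys = p \<Longrightarrow> lf p r (comb c xs ys) = lf p r xs + c * lf p r ys"
  by (simp add: lf_def comb_def sum.distrib ring_distribs sum_distrib_left mult_ac)

definition subsp :: "nat \<Rightarrow> real list set \<Rightarrow> bool" where
  "subsp p V \<longleftrightarrow> (\<forall>x\<in>V. length x = p) \<and> replicate p 0 \<in> V \<and> (\<forall>x\<in>V. \<forall>y\<in>V. \<forall>c. comb c x y \<in> V)"

lemma subsp_length: "subsp p V \<Longrightarrow> x \<in> V \<Longrightarrow> length x = p"
  by (simp add: subsp_def)

lemma subsp_comb: "subsp p V \<Longrightarrow> x \<in> V \<Longrightarrow> y \<in> V \<Longrightarrow> comb c x y \<in> V"
  by (simp add: subsp_def)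

lemma subsp_zero: "subsp p V \<Longrightarrow> replicate p 0 \<in> V"
  by (simp add: subsp_def)

lemma replicate_snoc: "replicate (Suc p) x = replicate p x @ [x]"
  by (simp add: replicate_append_same)

lemma comb_replicate: "length ys = p \<Longrightarrow> comb c (replicate p 0) ys = map ((*) c) ys"
  by (rule nth_equalityI) (simp_all add: comb_def)

lemma subsp_scale: "subsp p V \<Longrightarrow> x \<in> V \<Longrightarrow> map ((*) c) x \<in> V"
  using subsp_comb[of p V "replicate p 0" x c] comb_replicate[of x p c] by (simp add: subsp_length subsp_zero)

text \<open>Linear algebra without bases: induction is applied to the vectors whose last argument
  coordinate is 0. If some vector of \<open>G\<close> has 1 in that coordinate, it fixes the missing
  coefficient; if none has, scaling shows that the coordinate is always 0.\<close>

lemma subsp_graph: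
  assumes "subsp (Suc p) G" "replicate p 0 @ [1] \<notin> G"
  shows "\<exists>r. \<forall>xs w. length xs = p \<longrightarrow> xs @ [w] \<in> G \<longrightarrow> w = lf p r xs"
  using assms
proof (induction p arbitrary: G)
  case 0
  have "w = 0" if "[w] \<in> G" for w
  proof (rule ccontr)
    assume "w \<noteq> 0"
    then show False using subsp_scale[OF 0(1) that, of "1 / w"] 0(2) by simp
  qed
  then show ?case by (auto simp: lf_def)
next
  case (Suc p)
  define G0 where "G0 = {xs @ [w] | xs w. length xs = p \<and> xs @ [0] @ [w] \<in> G}"
  have mem: "xs @ [w] \<in> G0 \<longleftrightarrow> xs @ [0] @ [w] \<in> G" if "length xs = p" for xs w
    using that by (auto simp: G0_def)
  have sub: "subsp (Suc p) G0"
    unfolding subsp_def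
  proof (intro conjI ballI allI)
    show "length x = Suc p" if "x \<in> G0" for x using that by (auto simp: G0_def)
    have "replicate (Suc (Suc p)) 0 = replicate p 0 @ [0] @ [0::real]" by (simp only: replicate_snoc) simp
    then show "replicate (Suc p) 0 \<in> G0"
      unfolding replicate_snoc[of p] by (subst mem) (use subsp_zero[OF Suc(2)] in auto)
    fix x y c assume "x \<in> G0" "y \<in> G0"
    then obtain xs w ys v where xy: "x = xs @ [w]" "y = ys @ [v]" "length xs = p" "length ys = p"
      "xs @ [0] @ [w] \<in> G" "ys @ [0] @ [v] \<in> G" by (auto simp: G0_def)
    have "comb c ((xs @ [0]) @ [w]) ((ys @ [0]) @ [v]) \<in> G"
      using subsp_comb[OF Suc(2) xy(5,6), of c] by simp
    then show "comb c x y \<in> G0"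
      using xy(3,4) unfolding xy(1,2) by (simp add: mem)
  qed
  have "replicate p 0 @ [1] \<notin> G0"
    using Suc(3) by (simp add: mem replicate_append_same[symmetric])
  from Suc.IH[OF sub this] obtain r0 where
    r0: "w = lf p r0 xs" if "length xs = p" "xs @ [0] @ [w] \<in> G" for xs w
    using mem by metis
  show ?case
  proof (cases "\<exists>xs w. length xs = p \<and> xs @ [1] @ [w] \<in> G")
    case True
    then obtain xs1 w1 where x1: "length xs1 = p" "xs1 @ [1] @ [w1] \<in> G" by blast
    \<comment> \<open>The coefficient for which the extended form takes the value \<open>w1\<close>
      at the chosen vector.\<close>
    define r where "r = r0(p := w1 - lf p r0 xs1)"
    have lfr: "lf p r xs = lf p r0 xs" for xs by (simp add: lf_def r_def)
    have rp: "r p = w1 - lf p r0 xs1" by (simp add: r_def)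
    have "w = lf (Suc p) r zs" if len: "length zs = Suc p" and zw: "zs @ [w] \<in> G" for zs w
    proof -
      obtain xs a where zs: "zs = xs @ [a]" "length xs = p"
        using len by (metis append_butlast_last_id length_0_conv length_butlast diff_Suc_1 nat.distinct(1))
      have "comb (- a) ((xs @ [a]) @ [w]) ((xs1 @ [1]) @ [w1]) \<in> G"
        using subsp_comb[OF Suc(2) zw x1(2), of "- a"] by (simp add: zs)
      then have "comb (- a) xs xs1 @ [0] @ [w - a * w1] \<in> G"
        using zs(2) x1(1) by simp
      then have "w - a * w1 = lf p r0 (comb (- a) xs xs1)"
        using zs(2) x1(1) by (intro r0) simp_all
      then show ?thesis
        using zs(2) x1(1) unfolding zs(1) by (simp add: lf_comb lfr rp algebra_simps)
    qed
    then show ?thesis by blast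
  next
    case False
    have "w = lf (Suc p) r0 zs" if len: "length zs = Suc p" and zw: "zs @ [w] \<in> G" for zs w
    proof -
      obtain xs a where zs: "zs = xs @ [a]" "length xs = p"
        using len by (metis append_butlast_last_id length_0_conv length_butlast diff_Suc_1 nat.distinct(1))
      have a: "a = 0"
      proof (rule ccontr)
        assume a: "a \<noteq> 0"
        have "map ((*) (1 / a)) xs @ [1] @ [w / a] \<in> G"
          using subsp_scale[OF Suc(2) zw, of "1 / a"] a by (simp add: zs)
        then show False using False zs(2) by (metis length_map)
      qed
      show ?thesis using r0[OF zs(2)] zw zs a by simp
    qed
    then show ?thesis by blast
  qed
qed

lemma nonneg_linear_zero:
  fixes a b :: real
  assumes "\<And>w. 0 \<le> a + w * b"
  shows "b = 0"
proof (rule ccontr)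
  assume "b \<noteq> 0"
  then show False using assms[of "- (a + 1) / b"] by simp
qed

definition pad_row :: "nat \<Rightarrow> row \<Rightarrow> row" where
  "pad_row p x = (fst x, (snd x)(p := 0))"

lemma weight_pad: "length xs = p \<Longrightarrow> weight (Suc p) (map (pad_row p) L) (xs @ [w]) = weight p L xs"
proof (induction L)
  case (Cons x L)
  have "lf p ((snd x)(p := 0)) xs = lf p (snd x) xs" by (simp add: lf_def)
  with Cons show ?case by (simp add: row_weight_def pad_row_def)
qed simp

text \<open>On \<open>V\<close> the last variable is in one of three situations: it is determined by
  the others, which gives a constraint; it is free and enters the form quadratically, which gives a
  cost by completing the square; or it is free and cannot enter at all, because the form is
  nonnegative.\<close>

lemma ex_rows:
  assumes "subsp p V" "\<And>xs. xs \<in> V \<Longrightarrow> 0 \<le> qf p S xs"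
  shows "\<exists>L. \<forall>xs. length xs = p \<longrightarrow> weight p L xs = (if xs \<in> V then ennreal (qf p S xs) else \<infinity>)"
  using assms
proof (induction p arbitrary: V S)
  case 0
  then have "[] \<in> V" using subsp_zero[OF 0(1)] by simp
  then show ?case by (auto simp: qf_def intro!: exI[of _ "[]"])
next
  case (Suc p)
  note V = Suc.prems(1) and nonneg = Suc.prems(2)
  \<comment> \<open>Half the symmetrised cross coefficients, so that the form reads q + 2 w l +
    \<beta> w^2 in the last variable w.\<close>
  define l where "l = (\<lambda>i. (S i p + S p i) / 2)"
  define \<beta> where "\<beta> = S p p"
  have lS: "lf p (\<lambda>i. S i p + S p i) xs = 2 * lf p l xs" for xs
    unfolding lf_def l_def sum_distrib_left by (intro sum.cong refl) (simp add: field_simps)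
  have q: "qf (Suc p) S (xs @ [w]) = qf p S xs + 2 * w * lf p l xs + \<beta> * w\<^sup>2" if "length xs = p" for xs w
    using that by (simp add: qf_snoc lS \<beta>_def)
  have snoc: "\<exists>xs w. zs = xs @ [w] \<and> length xs = p" if "length zs = Suc p" for zs :: "real list"
    using that by (metis append_butlast_last_id length_0_conv length_butlast diff_Suc_1 nat.distinct(1))
  show ?case
  proof (cases "replicate p 0 @ [1] \<in> V")
    case True
    define V0 where "V0 = {xs. length xs = p \<and> xs @ [0] \<in> V}"
    have mem: "xs @ [w] \<in> V \<longleftrightarrow> xs \<in> V0" if "length xs = p" for xs w
    proof -
      have c: "comb c (xs @ [v]) (replicate p 0 @ [1]) = xs @ [v + c]" for c v
        using that by (simp add: comb_def) (rule nth_equalityI, simp_all)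
      have "xs @ [w] \<in> V \<Longrightarrow> xs @ [0] \<in> V" using subsp_comb[OF V _ True, of "xs @ [w]" "- w"] c[of "- w" w] by simp
      moreover have "xs @ [0] \<in> V \<Longrightarrow> xs @ [w] \<in> V" using subsp_comb[OF V _ True, of "xs @ [0]" w] c[of w 0] by simp
      ultimately show ?thesis using that by (auto simp: V0_def)
    qed
    have sub: "subsp p V0"
      unfolding subsp_def
    proof (intro conjI ballI allI)
      show "length x = p" if "x \<in> V0" for x using that by (simp add: V0_def)
      show "replicate p 0 \<in> V0" using subsp_zero[OF V] by (simp add: V0_def replicate_append_same)
      fix x y c assume "x \<in> V0" "y \<in> V0"
      then show "comb c x y \<in> V0"
        using subsp_comb[OF V, of "x @ [0]" "y @ [0]" c] by (simp add: V0_def)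
    qed
    have n: "0 \<le> qf p S xs + 2 * w * lf p l xs + \<beta> * w\<^sup>2" if "xs \<in> V0" for xs w
      using that nonneg[of "xs @ [w]"] mem[of xs w] q[of xs w] by (simp add: V0_def)
    have \<beta>0: "0 \<le> \<beta>"
      using n[OF subsp_zero[OF sub], of 1] by (simp add: qf_zero lf_zero)
    show ?thesis
    proof (cases "\<beta> = 0")
      case b0: True
      \<comment> \<open>Without a square term, a nonzero cross term would make the form negative for
        some w.\<close>
      have l0: "lf p l xs = 0" if "xs \<in> V0" for xs
      proof (rule nonneg_linear_zero)
        show "0 \<le> qf p S xs + w * lf p l xs" for w using n[OF that, of "w / 2"] b0 by simp
      qed
      have "0 \<le> qf p S xs" if "xs \<in> V0" for xs using n[OF that, of 0] by simp
      from Suc.IH[OF sub this] obtain L where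
        L: "weight p L xs = (if xs \<in> V0 then ennreal (qf p S xs) else \<infinity>)" if "length xs = p" for xs
        by blast
      have "weight (Suc p) (map (pad_row p) L) zs = (if zs \<in> V then ennreal (qf (Suc p) S zs) else \<infinity>)"
        if zl: "length zs = Suc p" for zs
      proof -
        obtain xs w where zs: "zs = xs @ [w]" "length xs = p" using snoc[OF zl] by blast
        show ?thesis
          by (cases "xs \<in> V0") (simp_all add: zs weight_pad L mem q l0 b0)
      qed
      then show ?thesis by blast
    next
      case False
      with \<beta>0 have b: "0 < \<beta>" by simp
      \<comment> \<open>The Schur complement, which remains after the square is split off. It is the
        minimum of the form over the last variable and hence nonnegative.\<close>
      define T where "T = (\<lambda>i j. S i j + (- 1 / \<beta>) * (l i * l j))"
      have T: "qf p T xs = qf p S xs - (lf p l xs)\<^sup>2 / \<beta>" for xs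
        unfolding T_def qf_add qf_scale qf_prod[symmetric] by (simp add: power2_eq_square)
      have "0 \<le> qf p T xs" if "xs \<in> V0" for xs
        using n[OF that, of "- lf p l xs / \<beta>"] b by (simp add: T power2_eq_square field_simps)
      from Suc.IH[OF sub this] obtain L where
        L: "weight p L xs = (if xs \<in> V0 then ennreal (qf p T xs) else \<infinity>)" if "length xs = p" for xs
        by blast
      \<comment> \<open>A cost is half a square, so the last coefficient has to be sqrt (2 \<beta>);
        the factor 2 / k on the other coefficients reproduces the cross term.\<close>
      define k where "k = sqrt (2 * \<beta>)"
      have "k\<^sup>2 = 2 * \<beta>" using b unfolding k_def by (intro real_sqrt_pow2) simp
      then have k2: "k * k = 2 * \<beta>" by (simp only: power2_eq_square)
      have k0: "k \<noteq> 0" using b by (simp add: k_def)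
      define r where "r = (\<lambda>i. if i = p then k else (2 / k) * l i)"
      have lr: "lf p r xs = (2 / k) * lf p l xs" for xs
        by (simp add: lf_def r_def sum_distrib_left mult_ac)
      have sq: "1 / 2 * ((2 / k) * u + k * w)\<^sup>2 = u\<^sup>2 / \<beta> + 2 * w * u + \<beta> * w\<^sup>2" for u w
      proof -
        have "1 / 2 * ((2 / k) * u + k * w)\<^sup>2 = 2 * u\<^sup>2 / (k * k) + 2 * w * u + (k * k) * w\<^sup>2 / 2"
          using k0 by (simp add: power2_eq_square field_simps)
        then show ?thesis by (simp add: k2)
      qed
      have "weight (Suc p) ((False, r) # map (pad_row p) L) zs = (if zs \<in> V then ennreal (qf (Suc p) S zs) else \<infinity>)"
        if zl: "length zs = Suc p" for zs
      proof -
        obtain xs w where zs: "zs = xs @ [w]" "length xs = p" using snoc[OF zl] by blast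
        have rw: "row_weight (Suc p) (False, r) zs = ennreal ((lf p l xs)\<^sup>2 / \<beta> + 2 * w * lf p l xs + \<beta> * w\<^sup>2)"
          unfolding sq[symmetric] using zs(2) by (simp add: row_weight_def zs(1) lr) (simp add: r_def mult.commute)
        show ?thesis
        proof (cases "xs \<in> V0")
          case True
          have "0 \<le> (lf p l xs)\<^sup>2 / \<beta> + 2 * w * lf p l xs + \<beta> * w\<^sup>2"
            unfolding sq[symmetric] by simp
          moreover have "0 \<le> qf p T xs" using True \<open>\<And>xs. xs \<in> V0 \<Longrightarrow> 0 \<le> qf p T xs\<close> by blast
          ultimately have "row_weight (Suc p) (False, r) zs + ennreal (qf p T xs) =
              ennreal ((lf p l xs)\<^sup>2 / \<beta> + 2 * w * lf p l xs + \<beta> * w\<^sup>2 + qf p T xs)"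
            unfolding rw by (rule ennreal_plus[symmetric])
          also have "(lf p l xs)\<^sup>2 / \<beta> + 2 * w * lf p l xs + \<beta> * w\<^sup>2 + qf p T xs = qf (Suc p) S zs"
            using zs by (simp add: T q)
          finally show ?thesis using zs True by (simp add: weight_pad L mem)
        next
          case False
          then show ?thesis using zs by (simp add: weight_pad L mem)
        qed
      qed
      then show ?thesis by blast
    qed
  next
    case False
    from subsp_graph[OF V False] obtain r where
      r: "w = lf p r xs" if "length xs = p" "xs @ [w] \<in> V" for xs w by blast
    define V0 where "V0 = {xs. length xs = p \<and> xs @ [lf p r xs] \<in> V}"
    have mem: "xs @ [w] \<in> V \<longleftrightarrow> xs \<in> V0 \<and> w = lf p r xs" if "length xs = p" for xs w
      using r[of xs w] that by (auto simp: V0_def)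
    have sub: "subsp p V0"
      unfolding subsp_def
    proof (intro conjI ballI allI)
      show "length x = p" if "x \<in> V0" for x using that by (simp add: V0_def)
      show "replicate p 0 \<in> V0" using subsp_zero[OF V] by (simp add: V0_def replicate_append_same lf_zero)
      fix x y c assume "x \<in> V0" "y \<in> V0"
      then show "comb c x y \<in> V0"
        using subsp_comb[OF V, of "x @ [lf p r x]" "y @ [lf p r y]" c] by (simp add: V0_def lf_comb)
    qed
    \<comment> \<open>The form \<open>S\<close> with the last variable replaced by the linear form
      \<open>lf p r\<close>.\<close>
    define T where "T = (\<lambda>i j. S i j + (2 * (r i * l j) + \<beta> * (r i * r j)))"
    have T: "qf p T xs = qf (Suc p) S (xs @ [lf p r xs])" if "length xs = p" for xs
      unfolding q[OF that] T_def qf_add qf_scale qf_prod[symmetric] by (simp add: power2_eq_square)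
    have "0 \<le> qf p T xs" if "xs \<in> V0" for xs
      using that nonneg[of "xs @ [lf p r xs]"] by (simp add: T V0_def)
    from Suc.IH[OF sub this] obtain L where
      L: "weight p L xs = (if xs \<in> V0 then ennreal (qf p T xs) else \<infinity>)" if "length xs = p" for xs
      by blast
    have "weight (Suc p) ((True, r(p := - 1)) # map (pad_row p) L) zs = (if zs \<in> V then ennreal (qf (Suc p) S zs) else \<infinity>)"
      if zl: "length zs = Suc p" for zs
    proof -
      obtain xs w where zs: "zs = xs @ [w]" "length xs = p" using snoc[OF zl] by blast
      have "lf p (r(p := - 1)) xs = lf p r xs" by (simp add: lf_def)
      then have "row_weight (Suc p) (True, r(p := - 1)) zs = holds (w = lf p r xs)"
        using zs(2) by (auto simp: row_weight_def zs(1) intro!: holds_cong)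
      then show ?thesis using zs by (simp add: weight_pad L mem T)
    qed
    then show ?thesis by blast
  qed
qed

section \<open>Homogenising polynomials on affine subspaces\<close>

lemma qf_map_mult: "length xs = p \<Longrightarrow> qf p S (map ((*) c) xs) = c\<^sup>2 * qf p S xs"
  by (simp add: qf_def sum_distrib_left power2_eq_square mult_ac)

lemma qf_comb:
  assumes "length xs = p" "length ys = p"
  shows "\<exists>k. \<forall>t. qf p S (comb t xs ys) = qf p S xs + t * k + t\<^sup>2 * qf p S ys"
proof (intro exI allI)
  fix t
  show "qf p S (comb t xs ys) = qf p S xs + t * (\<Sum>i<p. \<Sum>j<p. S i j * (xs ! i * ys ! j + ys ! i * xs ! j)) + t\<^sup>2 * qf p S ys"
    using assms unfolding qf_def comb_def
    by (simp add: sum.distrib sum_distrib_left algebra_simps power2_eq_square)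
qed

lemma nonneg_quad:
  fixes A k C :: real
  assumes "\<And>t. 0 \<le> A + t * k + t\<^sup>2 * C"
  shows "0 \<le> C"
proof (rule ccontr)
  assume "\<not> 0 \<le> C"
  then have C: "C < 0" by simp
  have A: "0 \<le> A" using assms[of 0] by simp
  \<comment> \<open>Chosen so that t^2 C = - (A + 1); adding the bounds at t and - t removes the
    linear term.\<close>
  define t where "t = sqrt ((A + 1) / (- C))"
  have t2: "t\<^sup>2 = (A + 1) / (- C)" using A C by (simp add: t_def divide_nonneg_neg)
  have "t\<^sup>2 * C = - (A + 1)" using C by (simp add: t2)
  moreover have "0 \<le> 2 * A + 2 * (t\<^sup>2 * C)" using assms[of t] assms[of "- t"] by simp
  ultimately show False using A by simp
qed

lemma enn2ereal_eq_ereal: "enn2ereal x = ereal r \<Longrightarrow> x = ennreal r \<and> 0 \<le> r"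
proof -
  assume x: "enn2ereal x = ereal r"
  have "0 \<le> r" using enn2ereal_nonneg[of x] x by simp
  with x have "enn2ereal x = enn2ereal (ennreal r)" by (simp add: enn2ereal_ennreal)
  then have "x = ennreal r" by (simp only: enn2ereal_inject)
  with \<open>0 \<le> r\<close> show ?thesis by simp
qed

lemma vec_of_list_eq: "length xs = p \<Longrightarrow> vec_of_list xs = vec p (\<lambda>i. xs ! i)"
  by (intro eq_vecI) (simp_all add: vec_of_list_index)

text \<open>The affine data become linear data with one more coordinate, the height:
  \<open>M\<close> is the slice at height one of a subspace \<open>V\<close>, and the polynomial is
  the restriction of a quadratic form \<open>T\<close>. Nonnegativity has to be extended from that
  slice to all of \<open>V\<close> before \<open>ex_rows\<close> applies.\<close>

lemma affine_subspace_rows: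
  fixes S :: "real mat" and b :: "real vec"
  assumes M: "affine_subspace p M" and S: "S \<in> carrier_mat p p" and b: "b \<in> carrier_vec p"
    and nonneg: "\<And>z. z \<in> M \<Longrightarrow> 0 \<le> z \<bullet> (S *\<^sub>v z) + b \<bullet> z + c"
  shows "\<exists>L. \<forall>xs. length xs = p \<longrightarrow> weight (Suc p) L (xs @ [1]) =
    (if vec_of_list xs \<in> M then ennreal (vec_of_list xs \<bullet> (S *\<^sub>v vec_of_list xs) + b \<bullet> vec_of_list xs + c) else \<infinity>)"
proof (cases "M = {}")
  case True
  \<comment> \<open>The empty domain is given by the constraint that the height is 0, which fails at
    height one.\<close>
  have "lf p (\<lambda>i. if i = p then 1 else 0) xs = 0" for xs by (simp add: lf_def)
  then have "weight (Suc p) [(True, \<lambda>i. if i = p then 1 else 0)] (xs @ [1]) = \<infinity>" if "length xs = p" for xs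
    using that by (simp add: row_weight_def)
  with True show ?thesis by (auto intro!: exI[of _ "[(True, \<lambda>i. if i = p then 1 else 0)]"])
next
  case False
  \<comment> \<open>Membership is phrased for coordinate functions, so that points are combined by
    arithmetic on functions without carrying dimensions.\<close>
  define Mf where "Mf = (\<lambda>f. vec p f \<in> M)"
  have Mf_cong: "Mf f \<longleftrightarrow> Mf g" if "\<And>i. i < p \<Longrightarrow> f i = g i" for f g
  proof -
    have "vec p f = vec p g" using that by (intro eq_vecI) simp_all
    then show ?thesis by (simp add: Mf_def)
  qed
  have Mf_list: "Mf (\<lambda>i. xs ! i) \<longleftrightarrow> vec_of_list xs \<in> M" if "length xs = p" for xs
    using that by (simp add: Mf_def vec_of_list_eq)
  obtain v where v: "v \<in> M" using False by blast
  define x0 where "x0 = (\<lambda>i. v $ i)"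
  have "v \<in> carrier_vec p" using v M by (auto simp: affine_subspace_def)
  then have "vec p x0 = v" by (intro eq_vecI) (simp_all add: x0_def)
  then have x0: "Mf x0" using v by (simp add: Mf_def)
  have aff: "Mf (\<lambda>i. a * f i + a' * g i)" if "Mf f" "Mf g" "a + a' = 1" for f g a a'
  proof -
    have "a \<cdot>\<^sub>v vec p f + a' \<cdot>\<^sub>v vec p g \<in> M" using M that by (simp add: affine_subspace_def Mf_def)
    also have "a \<cdot>\<^sub>v vec p f + a' \<cdot>\<^sub>v vec p g = vec p (\<lambda>i. a * f i + a' * g i)"
      by (intro eq_vecI) simp_all
    finally show ?thesis by (simp add: Mf_def)
  qed
  have dir: "Mf (\<lambda>i. x0 i + (d i + k * e i))" if d: "Mf (\<lambda>i. x0 i + d i)" and e: "Mf (\<lambda>i. x0 i + e i)" for d e k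
  proof -
    \<comment> \<open>Only affine combinations are available: stretch x0 + e from x0 by the factor
      k, take the midpoint with x0 + d, and double its distance from x0.\<close>
    have 1: "Mf (\<lambda>i. k * (x0 i + e i) + (1 - k) * x0 i)" by (rule aff[OF e x0]) simp
    have 2: "Mf (\<lambda>i. 1 / 2 * (x0 i + d i) + 1 / 2 * (k * (x0 i + e i) + (1 - k) * x0 i))"
      by (rule aff[OF d 1]) simp
    have 3: "Mf (\<lambda>i. 2 * (1 / 2 * (x0 i + d i) + 1 / 2 * (k * (x0 i + e i) + (1 - k) * x0 i)) + (- 1) * x0 i)"
      by (rule aff[OF 2 x0]) simp
    show ?thesis by (rule iffD1[OF Mf_cong 3]) (simp add: algebra_simps)
  qed
  \<comment> \<open>A vector y at height s belongs to \<open>V\<close> when y - s x0 is a direction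
    of \<open>M\<close>; the vectors at height 0 are the directions themselves.\<close>
  define V where "V = {zs. length zs = Suc p \<and> Mf (\<lambda>i. x0 i + (zs ! i - zs ! p * x0 i))}"
  \<comment> \<open>The linear coefficients go into the last row and the constant into the corner,
    so that the form is the given polynomial at height one.\<close>
  define T where "T = (\<lambda>i j. if i = p then (if j = p then c else b $ j) else if j = p then 0 else S $$ (i, j))"
  have T: "qf (Suc p) T (xs @ [1]) = vec_of_list xs \<bullet> (S *\<^sub>v vec_of_list xs) + b \<bullet> vec_of_list xs + c" if len: "length xs = p" for xs
  proof -
    have "qf p T xs = vec_of_list xs \<bullet> (S *\<^sub>v vec_of_list xs)"
      using S len by (auto simp: qf_def T_def scalar_prod_def vec_of_list_index sum_distrib_left atLeast0LessThan mult_ac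
          intro!: sum.cong)
    moreover have "lf p (\<lambda>i. T i p + T p i) xs = b \<bullet> vec_of_list xs"
      using b len by (auto simp: lf_def T_def scalar_prod_def vec_of_list_index atLeast0LessThan intro!: sum.cong)
    ultimately show ?thesis using len by (simp add: qf_snoc) (simp add: T_def)
  qed
  have T_nonneg: "0 \<le> qf (Suc p) T (xs @ [1])" if "length xs = p" "Mf (\<lambda>i. xs ! i)" for xs
    using nonneg[of "vec_of_list xs"] that by (simp add: T Mf_list)
  have sub: "subsp (Suc p) V"
    unfolding subsp_def
  proof (intro conjI ballI allI)
    show "length x = Suc p" if "x \<in> V" for x using that by (simp add: V_def)
    have "Mf (\<lambda>i. x0 i + (replicate (Suc p) 0 ! i - replicate (Suc p) 0 ! p * x0 i))"
      by (rule iffD1[OF Mf_cong x0]) (simp del: replicate_Suc)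
    then show "replicate (Suc p) 0 \<in> V" by (simp add: V_def del: replicate_Suc)
    fix x y k assume x: "x \<in> V" and y: "y \<in> V"
    have "Mf (\<lambda>i. x0 i + ((x ! i - x ! p * x0 i) + k * (y ! i - y ! p * x0 i)))"
      by (rule dir) (use x y in \<open>simp_all add: V_def\<close>)
    moreover have "comb k x y ! i = x ! i + k * y ! i" if "i \<le> p" for i
      using x y that by (simp add: comb_def V_def)
    ultimately have "Mf (\<lambda>i. x0 i + (comb k x y ! i - comb k x y ! p * x0 i))"
      by (elim iffD1[OF Mf_cong, rotated]) (simp add: algebra_simps)
    then show "comb k x y \<in> V" using x y by (simp add: V_def)
  qed
  have "0 \<le> qf (Suc p) T zs" if z: "zs \<in> V" for zs
  proof -
    have "length zs = Suc p" using z by (simp add: V_def)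
    then obtain xs s where zs: "zs = xs @ [s]" "length xs = p"
      by (metis append_butlast_last_id length_0_conv length_butlast diff_Suc_1 nat.distinct(1))
    have "zs ! p = s" by (simp add: zs(1) zs(2)[symmetric])
    then have zd: "Mf (\<lambda>i. x0 i + (zs ! i - s * x0 i))" using z by (simp add: V_def)
    show ?thesis
    proof (cases "s = 0")
      case False
      let ?y = "map ((*) (1 / s)) xs"
      have "Mf (\<lambda>i. x0 i + (0 + 1 / s * (zs ! i - s * x0 i)))"
        by (rule dir) (use zd x0 in simp_all)
      then have "Mf (\<lambda>i. ?y ! i)"
        by (elim iffD1[OF Mf_cong, rotated]) (use zs False in \<open>simp add: nth_append field_simps\<close>)
      then have "0 \<le> qf (Suc p) T (?y @ [1])" using zs(2) by (intro T_nonneg) simp_all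
      moreover have "zs = map ((*) s) (?y @ [1])" using False by (simp add: zs o_def)
      moreover have "qf (Suc p) T (map ((*) s) (?y @ [1])) = s\<^sup>2 * qf (Suc p) T (?y @ [1])"
        using zs(2) by (intro qf_map_mult) simp
      ultimately show ?thesis by simp
    next
      case True
      \<comment> \<open>At height 0 the vector is a direction. Along the line through x0 in that
        direction the form is a nonnegative quadratic polynomial in t, whose leading coefficient is
        the value in question.\<close>
      define y where "y = map x0 [0..<p]"
      have ylen: "length y = p" by (simp add: y_def)
      obtain k where k: "qf (Suc p) T (comb t (y @ [1]) zs) = qf (Suc p) T (y @ [1]) + t * k + t\<^sup>2 * qf (Suc p) T zs" for t
        using qf_comb[of "y @ [1]" "Suc p" zs T] ylen zs by auto
      show ?thesis
      proof (rule nonneg_quad)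
        fix t
        have "Mf (\<lambda>i. x0 i + (0 + t * (zs ! i - s * x0 i)))"
          by (rule dir) (use zd x0 in simp_all)
        then have "Mf (\<lambda>i. comb t y xs ! i)"
          by (elim iffD1[OF Mf_cong, rotated]) (use zs True in \<open>simp add: nth_append comb_def y_def\<close>)
        then have "0 \<le> qf (Suc p) T (comb t y xs @ [1])"
          using zs(2) ylen by (intro T_nonneg) simp_all
        then show "0 \<le> qf (Suc p) T (y @ [1]) + t * k + t\<^sup>2 * qf (Suc p) T zs"
          unfolding k[symmetric] using zs ylen True by simp
      qed
    qed
  qed
  from ex_rows[OF sub this] obtain L where
    L: "\<And>zs. length zs = Suc p \<Longrightarrow> weight (Suc p) L zs = (if zs \<in> V then ennreal (qf (Suc p) T zs) else \<infinity>)"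
    by blast
  have mem: "xs @ [1] \<in> V \<longleftrightarrow> vec_of_list xs \<in> M" if len: "length xs = p" for xs
  proof -
    have "Mf (\<lambda>i. x0 i + ((xs @ [1]) ! i - (xs @ [1]) ! p * x0 i)) \<longleftrightarrow> Mf (\<lambda>i. xs ! i)"
      by (rule Mf_cong) (use len in \<open>simp add: nth_append\<close>)
    then show ?thesis using len by (simp add: V_def Mf_list)
  qed
  show ?thesis by (rule exI[of _ L]) (simp add: L mem T)
qed

lemma quad_hom_rows:
  assumes "F \<in> quad_hom m n"
  shows "\<exists>L. \<forall>xs ys. length xs = m \<longrightarrow> length ys = n \<longrightarrow>
    F (vec_of_list xs, vec_of_list ys) = weight (Suc (m + n)) L (xs @ ys @ [1])"
proof -
  from assms obtain S b c M where S: "S \<in> carrier_mat (m + n) (m + n)" and b: "b \<in> carrier_vec (m + n)"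
    and M: "affine_subspace (m + n) M"
    and F: "\<And>z. z \<in> carrier_vec (m + n) \<Longrightarrow> enn2ereal (F (vec_first z m, vec_last z n)) =
      ereal (z \<bullet> (S *\<^sub>v z) + b \<bullet> z + c) + enn2ereal (holds (z \<in> M))"
    unfolding quad_hom_def partial_quadratic_def by blast
  define Q where "Q = (\<lambda>z. z \<bullet> (S *\<^sub>v z) + b \<bullet> z + c)"
  have inM: "F (vec_first z m, vec_last z n) = ennreal (Q z) \<and> 0 \<le> Q z" if "z \<in> M" for z
  proof (rule enn2ereal_eq_ereal)
    have "z \<in> carrier_vec (m + n)" using M that by (auto simp: affine_subspace_def)
    from F[OF this] that show "enn2ereal (F (vec_first z m, vec_last z n)) = ereal (Q z)"
      by (simp add: Q_def zero_ennreal.rep_eq)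
  qed
  have notM: "F (vec_first z m, vec_last z n) = \<infinity>" if "z \<in> carrier_vec (m + n)" "z \<notin> M" for z
  proof -
    have "enn2ereal (F (vec_first z m, vec_last z n)) = enn2ereal \<infinity>"
      using F[OF that(1)] that(2) by (simp add: top_ennreal.rep_eq top_ereal_def infinity_ennreal_def)
    then show ?thesis by (simp only: enn2ereal_inject)
  qed
  obtain L where L: "\<And>zs. length zs = m + n \<Longrightarrow> weight (Suc (m + n)) L (zs @ [1]) =
    (if vec_of_list zs \<in> M then ennreal (Q (vec_of_list zs)) else \<infinity>)"
    using affine_subspace_rows[OF M S b, of c] inM unfolding Q_def by blast
  have "F (vec_of_list xs, vec_of_list ys) = weight (Suc (m + n)) L (xs @ ys @ [1])"
    if len: "length xs = m" "length ys = n" for xs ys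
  proof -
    define z where "z = vec_of_list (xs @ ys)"
    have z: "z \<in> carrier_vec (m + n)" "vec_first z m = vec_of_list xs" "vec_last z n = vec_of_list ys"
      using len by (simp_all add: z_def vec_first_list vec_last_list)
    have "F (vec_of_list xs, vec_of_list ys) = (if z \<in> M then ennreal (Q z) else \<infinity>)"
      using inM[of z] notM[of z] z by auto
    also have "\<dots> = weight (Suc (m + n)) L ((xs @ ys) @ [1])"
      using len by (subst L) (simp_all add: z_def)
    finally show ?thesis by simp
  qed
  then show ?thesis by blast
qed

subsection \<open>Row lists define partial quadratic functions\<close>

lemma partial_quadratic_add:
  assumes "partial_quadratic n f" "partial_quadratic n g"
  shows "partial_quadratic n (\<lambda>z. f z + g z)"
proof -
  from assms(1) obtain S b c M where 1: "S \<in> carrier_mat n n" "b \<in> carrier_vec n" "transpose_mat S = S" "affine_subspace n M"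
    "\<And>x. x \<in> carrier_vec n \<Longrightarrow> f x = ereal (x \<bullet> (S *\<^sub>v x) + b \<bullet> x + c) + enn2ereal (holds (x \<in> M))"
    unfolding partial_quadratic_def by blast
  from assms(2) obtain S' b' c' M' where 2: "S' \<in> carrier_mat n n" "b' \<in> carrier_vec n" "transpose_mat S' = S'" "affine_subspace n M'"
    "\<And>x. x \<in> carrier_vec n \<Longrightarrow> g x = ereal (x \<bullet> (S' *\<^sub>v x) + b' \<bullet> x + c') + enn2ereal (holds (x \<in> M'))"
    unfolding partial_quadratic_def by blast
  show ?thesis
    unfolding partial_quadratic_def
  proof (intro bexI exI conjI ballI)
    show "S + S' \<in> carrier_mat n n" "b + b' \<in> carrier_vec n" using 1 2 by simp_all
    show "transpose_mat (S + S') = S + S'" using 1 2 by (simp add: transpose_add)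
    show "affine_subspace n (M \<inter> M')" using 1(4) 2(4) by (auto simp: affine_subspace_def)
    fix x :: "real vec" assume x: "x \<in> carrier_vec n"
    have h: "enn2ereal (holds (x \<in> M \<inter> M')) = enn2ereal (holds (x \<in> M)) + enn2ereal (holds (x \<in> M'))"
      by (simp add: plus_ennreal.rep_eq[symmetric] holds_add)
    have "x \<bullet> ((S + S') *\<^sub>v x) + (b + b') \<bullet> x + (c + c') = (x \<bullet> (S *\<^sub>v x) + b \<bullet> x + c) + (x \<bullet> (S' *\<^sub>v x) + b' \<bullet> x + c')"
      using 1 2 x by (simp add: add_mult_distrib_mat_vec[of _ n n] scalar_prod_add_distrib[of _ n] add_scalar_prod_distrib[of _ n])
    then show "f x + g x = ereal (x \<bullet> ((S + S') *\<^sub>v x) + (b + b') \<bullet> x + (c + c')) + enn2ereal (holds (x \<in> M \<inter> M'))"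
      unfolding h by (simp only: 1(5)[OF x] 2(5)[OF x] plus_ereal.simps(1)[symmetric] add_ac)
  qed
qed

lemma partial_quadratic_cong:
  "partial_quadratic n f \<Longrightarrow> (\<And>z. z \<in> carrier_vec n \<Longrightarrow> f z = g z) \<Longrightarrow> partial_quadratic n g"
  unfolding partial_quadratic_def by (metis (no_types, lifting))

lemma partial_quadratic_row:
  "partial_quadratic p (\<lambda>z. enn2ereal (row_weight (Suc p) x (list_of_vec z @ [1])))"
proof -
  obtain bb r where x: "x = (bb, r)" by (cases x)
  define v where "v = vec p r"
  have v: "v \<in> carrier_vec p" by (simp add: v_def)
  have lf: "lf (Suc p) r (list_of_vec z @ [1]) = v \<bullet> z + r p" if "z \<in> carrier_vec p" for z
    using that by (simp add: lf_snoc) (simp add: lf_def v_def scalar_prod_def list_of_vec_index atLeast0LessThan)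
  show ?thesis
  proof (cases bb)
    case True
    show ?thesis
      unfolding partial_quadratic_def
    proof (intro bexI exI conjI ballI)
      show "0\<^sub>m p p \<in> carrier_mat p p" "0\<^sub>v p \<in> carrier_vec p" "transpose_mat (0\<^sub>m p p) = 0\<^sub>m p p" by simp_all
      show "affine_subspace p {z \<in> carrier_vec p. v \<bullet> z + r p = 0}"
        unfolding affine_subspace_def
      proof (intro conjI ballI allI impI)
        fix y z a b assume y: "y \<in> {z \<in> carrier_vec p. v \<bullet> z + r p = 0}" and z: "z \<in> {z \<in> carrier_vec p. v \<bullet> z + r p = 0}"
          and ab: "a + b = (1::real)"
        have "v \<bullet> (a \<cdot>\<^sub>v y + b \<cdot>\<^sub>v z) = a * (v \<bullet> y) + b * (v \<bullet> z)"
          using y z v by (simp add: scalar_prod_add_distrib[of _ p])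
        also have "\<dots> = - (a + b) * r p" using y z by (simp add: algebra_simps eq_neg_iff_add_eq_0[symmetric])
        finally show "a \<cdot>\<^sub>v y + b \<cdot>\<^sub>v z \<in> {z \<in> carrier_vec p. v \<bullet> z + r p = 0}" using y z ab by simp
      qed auto
      fix z :: "real vec" assume z: "z \<in> carrier_vec p"
      have "0\<^sub>m p p *\<^sub>v z = 0\<^sub>v p" using z by (intro eq_vecI) simp_all
      then show "enn2ereal (row_weight (Suc p) x (list_of_vec z @ [1])) =
          ereal (z \<bullet> (0\<^sub>m p p *\<^sub>v z) + 0\<^sub>v p \<bullet> z + 0) + enn2ereal (holds (z \<in> {z \<in> carrier_vec p. v \<bullet> z + r p = 0}))"
        using True z unfolding row_weight_def x snd_conv fst_conv lf[OF z] by (simp add: zero_ereal_def[symmetric])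
    qed
  next
    case False
    define S where "S = mat p p (\<lambda>(i, j). 1 / 2 * (r i * r j))"
    show ?thesis
      unfolding partial_quadratic_def
    proof (intro bexI exI conjI ballI)
      show "S \<in> carrier_mat p p" "r p \<cdot>\<^sub>v v \<in> carrier_vec p" by (simp_all add: S_def v)
      show "transpose_mat S = S" by (rule eq_matI) (simp_all add: S_def)
      show "affine_subspace p (carrier_vec p)" by (simp add: affine_subspace_def)
      fix z :: "real vec" assume z: "z \<in> carrier_vec p"
      have "S *\<^sub>v z = (1 / 2 * (v \<bullet> z)) \<cdot>\<^sub>v v"
        using z by (intro eq_vecI) (simp_all add: S_def v_def scalar_prod_def sum_distrib_left sum_distrib_right mult_ac)
      then have "z \<bullet> (S *\<^sub>v z) = 1 / 2 * (v \<bullet> z) * (v \<bullet> z)"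
        using z v by (simp add: comm_scalar_prod[of z p v])
      then have "z \<bullet> (S *\<^sub>v z) + (r p \<cdot>\<^sub>v v) \<bullet> z + 1 / 2 * (r p)\<^sup>2 = 1 / 2 * (v \<bullet> z + r p)\<^sup>2"
        using z v by (simp add: power2_eq_square algebra_simps)
      then show "enn2ereal (row_weight (Suc p) x (list_of_vec z @ [1])) =
          ereal (z \<bullet> (S *\<^sub>v z) + (r p \<cdot>\<^sub>v v) \<bullet> z + 1 / 2 * (r p)\<^sup>2) + enn2ereal (holds (z \<in> carrier_vec p))"
        using False z unfolding row_weight_def x snd_conv fst_conv lf[OF z]
        by (simp add: enn2ereal_ennreal zero_ennreal.rep_eq)
    qed
  qed
qed

lemma partial_quadratic_zero: "partial_quadratic p (\<lambda>z. 0)"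
proof -
  have "row_weight (Suc p) (True, \<lambda>_. 0) zs = 0" for zs by (simp add: row_weight_def lf_def)
  then show ?thesis
    using partial_quadratic_row[of p "(True, \<lambda>_. 0)"] by (simp add: zero_ennreal.rep_eq)
qed

lemma partial_quadratic_weight:
  "partial_quadratic p (\<lambda>z. enn2ereal (weight (Suc p) L (list_of_vec z @ [1])))"
proof (induction L)
  case Nil
  show ?case using partial_quadratic_zero by (simp add: zero_ennreal.rep_eq)
next
  case (Cons x L)
  show ?case using partial_quadratic_add[OF partial_quadratic_row Cons] by (simp add: plus_ennreal.rep_eq)
qed

section \<open>Fullness\<close>

lemma length_add_2:
  assumes "length zs = n + 2" shows "\<exists>us c d. zs = us @ [c, d] \<and> length us = n"
proof -
  have "length (drop n zs) = Suc (Suc 0)" using assms by simp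
  then have "\<exists>c d. drop n zs = [c, d]" by (auto simp: length_Suc_conv simp del: length_drop)
  then obtain c d where "drop n zs = [c, d]" by blast
  then have "zs = take n zs @ [c, d]" by (metis append_take_drop_id)
  moreover have "length (take n zs) = n" using assms by simp
  ultimately show ?thesis by metis
qed

lemma aw_bend:
  assumes "ok f" "dm f = m" "cd f = Suc n" "length xs = m" "length ys = n"
  shows "aw ((f \<boxtimes> W) \<Zcomp> (idn n \<boxtimes> cap1)) (xs @ [b]) ys = aw f xs (ys @ [b])"
proof -
  have "aw ((f \<boxtimes> W) \<Zcomp> (idn n \<boxtimes> cap1)) (xs @ [b]) ys =
      (INF zs\<in>{zs. length zs = n + 2}. aw (f \<boxtimes> W) (xs @ [b]) zs + aw (idn n \<boxtimes> cap1) zs ys)"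
    using assms by (subst aw_cmp) (simp_all add: numeral_2_eq_2)
  also have "\<dots> = (INF zs\<in>{zs. length zs = n + 2}. aw f xs (take (Suc n) zs) + holds (zs = ys @ [b, b]))"
  proof (rule INF_cong)
    fix zs :: "real list" assume "zs \<in> {zs. length zs = n + 2}"
    then obtain us c d where zs: "zs = us @ [c, d]" and us: "length us = n"
      using length_add_2[of zs n] by auto
    have "aw (f \<boxtimes> W) (xs @ [b]) ((us @ [c]) @ [d]) = aw f xs (us @ [c]) + aw W [b] [d]"
      using assms us by (intro aw_ten) simp_all
    moreover have "aw (idn n \<boxtimes> cap1) (us @ [c, d]) (ys @ []) = aw (idn n) us ys + aw cap1 [c, d] []"
      using assms us by (intro aw_ten) (simp_all add: numeral_2_eq_2)
    ultimately show "aw (f \<boxtimes> W) (xs @ [b]) zs + aw (idn n \<boxtimes> cap1) zs ys =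
        aw f xs (take (Suc n) zs) + holds (zs = ys @ [b, b])"
      using assms us by (auto simp: zs aw_idn aw_cap1 add.assoc holds_add take_Suc_conv_app_nth intro!: holds_cong)
  qed simp
  also have "\<dots> = aw f xs (take (Suc n) (ys @ [b, b]))"
    by (rule INF_holds(2)) (use assms in auto)
  finally show ?thesis using assms by simp
qed

lemma bend_all:
  assumes "ok f" "dm f = m" "cd f = n"
  shows "\<exists>e. eff (m + n) e \<and> (\<forall>xs ys. length xs = m \<longrightarrow> length ys = n \<longrightarrow> aw f xs ys = aw e (xs @ ys) [])"
  using assms
proof (induction n arbitrary: m f)
  case 0
  then show ?case by (intro exI[of _ f]) (simp add: eff_def)
next
  case (Suc n)
  let ?g = "(f \<boxtimes> W) \<Zcomp> (idn n \<boxtimes> cap1)"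
  have "ok ?g" "dm ?g = Suc m" "cd ?g = n" using Suc.prems by (simp_all add: numeral_2_eq_2)
  from Suc.IH[OF this] obtain e where e: "eff (Suc m + n) e"
    and ae: "\<And>xs ys. length xs = Suc m \<Longrightarrow> length ys = n \<Longrightarrow> aw ?g xs ys = aw e (xs @ ys) []" by blast
  \<comment> \<open>The bent output stands directly after the inputs, ahead of the other outputs;
    the crossing restores the original order.\<close>
  have gr: "graph (idn m \<boxtimes> sw n 1) (\<lambda>xs. take m xs @ (\<lambda>ys. drop n ys @ take n ys) (drop m xs))"
    using graph_ten[OF graph_idn[of m] graph_sw[of n 1]] by simp
  have "aw f xs ys = aw ((idn m \<boxtimes> sw n 1) \<Zcomp> e) (xs @ ys) []" if "length xs = m" "length ys = Suc n" for xs ys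
  proof -
    define zs b where "zs = take n ys" and "b = ys ! n"
    have ys: "ys = zs @ [b]" "length zs = n" using that by (auto simp: zs_def b_def take_Suc_conv_app_nth[symmetric])
    have "aw f xs ys = aw ?g (xs @ [b]) zs" using aw_bend[of f m n xs zs b] Suc.prems that ys by simp
    also have "\<dots> = aw e (xs @ [b] @ zs) []" using ae[of "xs @ [b]" zs] that ys by simp
    also have "\<dots> = aw ((idn m \<boxtimes> sw n 1) \<Zcomp> e) (xs @ ys) []"
      using that ys e by (subst aw_graph_cmp[OF gr]) (auto simp: eff_def)
    finally show ?thesis .
  qed
  moreover have "eff (m + Suc n) ((idn m \<boxtimes> sw n 1) \<Zcomp> e)" using e by (simp add: eff_def)
  ultimately show ?case by blast
qed

lemma aw_unbend:
  assumes "ok g" "dm g = Suc m" "cd g = n" "length xs = m" "length ys = n"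
  shows "aw ((idn m \<boxtimes> cup1) \<Zcomp> (g \<boxtimes> W)) xs (ys @ [b]) = aw g (xs @ [b]) ys"
proof -
  have cup: "aw cup1 [] [c, d] = holds (c = d)" for c d
  proof -
    have "aw cup1 [] [c, d] = (INF zs\<in>{zs. length zs = 1}. holds (gen_rel CoDiscard [] zs) + holds (gen_rel Copy zs [c, d]))"
      unfolding cup1_def by (subst aw_cmp) (auto simp: aw_gen_rel numeral_2_eq_2 intro!: INF_cong)
    also have "\<dots> = holds (\<exists>zs\<in>{zs. length zs = 1}. gen_rel CoDiscard [] zs \<and> gen_rel Copy zs [c, d])"
      by (rule INF_holds_holds)
    also have "(\<exists>zs\<in>{zs. length zs = 1}. gen_rel CoDiscard [] zs \<and> gen_rel Copy zs [c, d]) \<longleftrightarrow> c = d"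
      by (auto intro!: exI[of _ "[d]"])
    finally show ?thesis .
  qed
  have "aw ((idn m \<boxtimes> cup1) \<Zcomp> (g \<boxtimes> W)) xs (ys @ [b]) =
      (INF zs\<in>{zs. length zs = m + 2}. aw (idn m \<boxtimes> cup1) xs zs + aw (g \<boxtimes> W) zs (ys @ [b]))"
    using assms by (subst aw_cmp) (simp_all add: numeral_2_eq_2)
  also have "\<dots> = (INF zs\<in>{zs. length zs = m + 2}. holds (zs = xs @ [b, b]) + aw g (take (Suc m) zs) ys)"
  proof (rule INF_cong)
    fix zs :: "real list" assume "zs \<in> {zs. length zs = m + 2}"
    then obtain us c d where zs: "zs = us @ [c, d]" and us: "length us = m"
      using length_add_2[of zs m] by auto
    have "aw (idn m \<boxtimes> cup1) (xs @ []) (us @ [c, d]) = aw (idn m) xs us + aw cup1 [] [c, d]"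
      using assms us by (intro aw_ten) (simp_all add: numeral_2_eq_2)
    moreover have "aw (g \<boxtimes> W) ((us @ [c]) @ [d]) (ys @ [b]) = aw g (us @ [c]) ys + aw W [d] [b]"
      using assms us by (intro aw_ten) simp_all
    moreover have "us = xs \<and> c = d \<and> d = b \<longleftrightarrow> zs = xs @ [b, b]" using assms us by (auto simp: zs)
    ultimately show "aw (idn m \<boxtimes> cup1) xs zs + aw (g \<boxtimes> W) zs (ys @ [b]) =
        holds (zs = xs @ [b, b]) + aw g (take (Suc m) zs) ys"
      using assms us by (simp add: zs aw_idn cup add_ac holds_add[symmetric] eq_commute[of xs us])
  qed simp
  also have "\<dots> = aw g (take (Suc m) (xs @ [b, b])) ys"
    by (rule INF_holds(1)) (use assms in auto)
  finally show ?thesis using assms by simp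
qed

lemma unbend_all:
  assumes "eff (m + n) e"
  shows "\<exists>f. ok f \<and> dm f = m \<and> cd f = n \<and>
    (\<forall>xs ys. length xs = m \<longrightarrow> length ys = n \<longrightarrow> aw f xs ys = aw e (xs @ ys) [])"
  using assms
proof (induction n arbitrary: m e)
  case 0
  then show ?case by (intro exI[of _ e]) (simp add: eff_def)
next
  case (Suc n)
  let ?e = "(idn m \<boxtimes> sw 1 n) \<Zcomp> e"
  have e: "ok e" "dm e = m + Suc n" "cd e = 0" using Suc.prems by (simp_all add: eff_def)
  then have "eff (Suc m + n) ?e" by (simp add: eff_def)
  from Suc.IH[OF this] obtain g where g: "ok g" "dm g = Suc m" "cd g = n"
    and ag: "\<And>xs ys. length xs = Suc m \<Longrightarrow> length ys = n \<Longrightarrow> aw g xs ys = aw ?e (xs @ ys) []" by blast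
  have gr: "graph (idn m \<boxtimes> sw 1 n) (\<lambda>xs. take m xs @ (\<lambda>ys. drop 1 ys @ take 1 ys) (drop m xs))"
    using graph_ten[OF graph_idn[of m] graph_sw[of 1 n]] by simp
  have "aw ((idn m \<boxtimes> cup1) \<Zcomp> (g \<boxtimes> W)) xs ys = aw e (xs @ ys) []" if "length xs = m" "length ys = Suc n" for xs ys
  proof -
    define zs b where "zs = take n ys" and "b = ys ! n"
    have ys: "ys = zs @ [b]" "length zs = n" using that by (auto simp: zs_def b_def take_Suc_conv_app_nth[symmetric])
    have "aw ((idn m \<boxtimes> cup1) \<Zcomp> (g \<boxtimes> W)) xs ys = aw ?e ((xs @ [b]) @ zs) []"
      using aw_unbend[OF g, of xs zs b] ag[of "xs @ [b]" zs] that ys by simp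
    also have "\<dots> = aw e (xs @ ys) []"
      using that ys e by (subst aw_graph_cmp[OF gr]) auto
    finally show ?thesis .
  qed
  moreover have "ok ((idn m \<boxtimes> cup1) \<Zcomp> (g \<boxtimes> W))" "dm ((idn m \<boxtimes> cup1) \<Zcomp> (g \<boxtimes> W)) = m"
    "cd ((idn m \<boxtimes> cup1) \<Zcomp> (g \<boxtimes> W)) = Suc n" using g by (simp_all add: numeral_2_eq_2)
  ultimately show ?case by blast
qed

section \<open>Diagrams present exactly the nonnegative partial quadratic functions\<close>

lemma ok_abs_arr: "ok (abs_arr t) \<longleftrightarrow> composable gqa_sig t"
  by (rule ok.abs_eq)

lemma dm_cd_abs_arr: "composable gqa_sig t \<Longrightarrow> dm (abs_arr t) = src gqa_sig t"
  "composable gqa_sig t \<Longrightarrow> cd (abs_arr t) = tgt gqa_sig t"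
  by (simp_all add: dm.abs_eq cd.abs_eq)

lemma aw_abs_arr: "composable gqa_sig t \<Longrightarrow> aw (abs_arr t) xs ys = wt t xs ys"
  by (simp add: aw.abs_eq)

lemma arr_obtain:
  assumes "ok f" obtains t where "f = abs_arr t" "t \<in> diagrams gqa_sig (dm f) (cd f)"
proof -
  have f: "f = abs_arr (rep_arr f)" by (simp add: Quotient3_abs_rep[OF Quotient3_arr])
  with assms have "composable gqa_sig (rep_arr f)" by (metis ok_abs_arr)
  with f show ?thesis by (intro that[of "rep_arr f"]) (auto simp: diagrams_def dm_cd_abs_arr[symmetric])
qed

text \<open>No infimum over hidden variables is ever computed: the bent diagram has a normal form,
  and the weights of its rows are visibly quadratic.\<close>

lemma gev_quad_hom:
  assumes "t \<in> diagrams gqa_sig m n" shows "gev t \<in> quad_hom m n"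
proof -
  have t: "composable gqa_sig t" "src gqa_sig t = m" "tgt gqa_sig t = n" using assms by (auto simp: diagrams_def)
  then have "ok (abs_arr t)" "dm (abs_arr t) = m" "cd (abs_arr t) = n" by (simp_all add: ok_abs_arr dm_cd_abs_arr)
  from bend_all[OF this] obtain e where e: "eff (m + n) e" and
    ae: "\<And>xs ys. length xs = m \<Longrightarrow> length ys = n \<Longrightarrow> aw (abs_arr t) xs ys = aw e (xs @ ys) []" by blast
  from effect_normal_form[OF e] obtain L where L: "e = (idn (m + n) \<boxtimes> on) \<Zcomp> effs (Suc (m + n)) L" by blast
  have "partial_quadratic (m + n) (\<lambda>z. enn2ereal (gev t (vec_first z m, vec_last z n)))"
  proof (rule partial_quadratic_cong[OF partial_quadratic_weight[of _ L]])
    fix z :: "real vec" assume z: "z \<in> carrier_vec (m + n)"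
    define xs ys where "xs = list_of_vec (vec_first z m)" and "ys = list_of_vec (vec_last z n)"
    have len: "length xs = m" "length ys = n" by (simp_all add: xs_def ys_def)
    have "list_of_vec z = xs @ ys"
      unfolding xs_def ys_def list_of_vec_append[symmetric] using z by simp
    then have "weight (Suc (m + n)) L (list_of_vec z @ [1]) = aw e (xs @ ys) []"
      using len by (simp add: L aw_plug_on aw_effs del: effs.simps weight.simps)
    also have "\<dots> = wt t xs ys" using ae[OF len] t by (simp add: aw_abs_arr)
    finally show "enn2ereal (weight (Suc (m + n)) L (list_of_vec z @ [1])) = enn2ereal (gev t (vec_first z m, vec_last z n))"
      by (simp add: wt_def xs_def ys_def vec_list)
  qed
  then show ?thesis using gev_ext[OF t(1)] t by (simp add: quad_hom_def)
qed

lemma quad_hom_gev: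
  assumes F: "F \<in> quad_hom m n" shows "\<exists>t\<in>diagrams gqa_sig m n. gev t = F"
proof -
  obtain L where L: "\<And>xs ys. length xs = m \<Longrightarrow> length ys = n \<Longrightarrow>
      F (vec_of_list xs, vec_of_list ys) = weight (Suc (m + n)) L (xs @ ys @ [1])"
    using quad_hom_rows[OF F] by blast
  define e where "e = (idn (m + n) \<boxtimes> on) \<Zcomp> effs (Suc (m + n)) L"
  have "eff (m + n) e" by (simp add: e_def eff_def del: effs.simps)
  from unbend_all[OF this] obtain f where f: "ok f" "dm f = m" "cd f = n" and
    af: "\<And>xs ys. length xs = m \<Longrightarrow> length ys = n \<Longrightarrow> aw f xs ys = aw e (xs @ ys) []" by blast
  obtain t where t: "f = abs_arr t" "t \<in> diagrams gqa_sig m n" using arr_obtain[OF f(1)] f by metis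
  have "gev t = F"
  proof (rule points_ext)
    show "gev t \<in> extensional (points m n)" using gev_ext[of t] t(2) by (auto simp: diagrams_def)
    show "F \<in> extensional (points m n)" using F by (simp add: quad_hom_def)
    fix x y :: "real vec" assume xy: "x \<in> carrier_vec m" "y \<in> carrier_vec n"
    define xs ys where "xs = list_of_vec x" and "ys = list_of_vec y"
    have v: "x = vec_of_list xs" "y = vec_of_list ys" by (simp_all add: xs_def ys_def vec_list)
    have len: "length xs = m" "length ys = n" using xy by (simp_all add: xs_def ys_def)
    have "gev t (x, y) = aw f xs ys" using t(2) by (simp add: t(1) v wt_def[symmetric] aw_abs_arr diagrams_def)
    also have "\<dots> = weight (Suc (m + n)) L (xs @ ys @ [1])"
      using len by (simp add: af e_def aw_plug_on aw_effs del: effs.simps weight.simps)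
    also have "\<dots> = F (x, y)" using L[OF len] by (simp add: v)
    finally show "gev t (x, y) = F (x, y)" .
  qed
  with t(2) show ?thesis by blast
qed

lemma gev_complete:
  assumes "s \<in> diagrams gqa_sig m n" "t \<in> diagrams gqa_sig m n" "gev s = gev t"
  shows "gqa_eq m n s t"
proof -
  have s: "composable gqa_sig s" "src gqa_sig s = m" "tgt gqa_sig s = n" using assms by (auto simp: diagrams_def)
  have t: "composable gqa_sig t" "src gqa_sig t = m" "tgt gqa_sig t = n" using assms by (auto simp: diagrams_def)
  have "abs_arr s = abs_arr t"
    by (rule complete) (use s t assms(3) in \<open>simp_all add: ok_abs_arr dm_cd_abs_arr aw_abs_arr wt_def\<close>)
  then show ?thesis using s t by (auto simp: arr.abs_eq_iff arr_rel_def)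
qed

section \<open>The isomorphism\<close>

lemma prop_isomorphismI:
  assumes "prop_morphism P Q \<phi>" "\<And>m n. bij_betw (\<phi> m n) (p_hom P m n) (p_hom Q m n)"
  shows "prop_isomorphism P Q \<phi>"
proof -
  interpret prop_morphism P Q \<phi> by fact
  define \<psi> where "\<psi> = (\<lambda>m n. the_inv_into (p_hom P m n) (\<phi> m n))"
  have left: "\<psi> m n (\<phi> m n f) = f" if "f \<in> p_hom P m n" for m n f
    using assms(2)[of m n] that by (simp add: \<psi>_def the_inv_into_f_f bij_betw_def)
  have right: "\<phi> m n (\<psi> m n g) = g" if "g \<in> p_hom Q m n" for m n g
    using assms(2)[of m n] that by (simp add: \<psi>_def f_the_inv_into_f bij_betw_def)
  have closed: "\<psi> m n g \<in> p_hom P m n" if "g \<in> p_hom Q m n" for m n g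
    using assms(2)[of m n] that unfolding \<psi>_def bij_betw_def by (metis the_inv_into_into order_refl)
  have "prop_morphism Q P \<psi>"
  proof
    show "\<psi> n n (p_id Q n) = p_id P n" for n
      using left[OF dom.id_closed, of n] by (simp add: map_id)
    show "\<psi> l n (p_comp Q l m n f g) = p_comp P l m n (\<psi> l m f) (\<psi> m n g)"
      if "f \<in> p_hom Q l m" "g \<in> p_hom Q m n" for f l m g n
      using left[OF dom.comp_closed[OF closed[OF that(1)] closed[OF that(2)]]] that
      by (simp add: map_comp[OF closed closed] right)
    show "\<psi> (m + m') (n + n') (p_tens Q m n m' n' f g) = p_tens P m n m' n' (\<psi> m n f) (\<psi> m' n' g)"
      if "f \<in> p_hom Q m n" "g \<in> p_hom Q m' n'" for f m n g m' n'
      using left[OF dom.tens_closed[OF closed[OF that(1)] closed[OF that(2)]]] that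
      by (simp add: map_tens[OF closed closed] right)
    show "\<psi> (m + n) (n + m) (p_sym Q m n) = p_sym P m n" for m n
      using left[OF dom.sym_closed, of m n] by (simp add: map_sym)
  qed (rule closed)
  then show ?thesis
    unfolding prop_isomorphism_def using assms(1) left right by blast
qed

lemma gev_simps: "gev (Wires n) = p_id QuadRel n" "gev (Swap m n) = p_sym QuadRel m n"
  "s \<in> diagrams gqa_sig l m \<Longrightarrow> t \<in> diagrams gqa_sig m n \<Longrightarrow> gev (s \<Zsemi> t) = p_comp QuadRel l m n (gev s) (gev t)"
  "s \<in> diagrams gqa_sig m n \<Longrightarrow> t \<in> diagrams gqa_sig m' n' \<Longrightarrow> gev (s \<parallel> t) = p_tens QuadRel m n m' n' (gev s) (gev t)"
  by (simp_all add: diagrams_def)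

lemma p_hom_QuadRel: "p_hom QuadRel = quad_hom"
  by (simp add: QuadRel_def)

lemma diagrams_intros:
  "Wires n \<in> diagrams \<sigma> n n" "Swap m n \<in> diagrams \<sigma> (m + n) (n + m)"
  "s \<in> diagrams \<sigma> l m \<Longrightarrow> t \<in> diagrams \<sigma> m n \<Longrightarrow> s \<Zsemi> t \<in> diagrams \<sigma> l n"
  "s \<in> diagrams \<sigma> m n \<Longrightarrow> t \<in> diagrams \<sigma> m' n' \<Longrightarrow> s \<parallel> t \<in> diagrams \<sigma> (m + m') (n + n')"
  by (simp_all add: diagrams_def)

text \<open>The laws are those of \<open>AllRel\<close>. Closure under composition and tensor comes
  from syntax: both arguments are values of diagrams by \<open>quad_hom_gev\<close>, and
  \<open>gev_quad_hom\<close> applies to the combined diagram.\<close>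

lemma QuadRel_prop: "prop_cat QuadRel"
proof -
  interpret A: prop_cat AllRel by (rule AllRel_prop)
  have ext: "f \<in> extensional (points m n)" if "f \<in> quad_hom m n" for f m n
    using that by (simp add: quad_hom_def)
  show ?thesis
  proof (unfold_locales, unfold p_hom_QuadRel)
    fix f g h f' g' :: qfun and k l m n l' m' n' m'' n'' :: nat
    show "p_id QuadRel n \<in> quad_hom n n"
      using gev_quad_hom[OF diagrams_intros(1)] by simp
    show "p_sym QuadRel m n \<in> quad_hom (m + n) (n + m)"
      using gev_quad_hom[OF diagrams_intros(2)] by simp
    show "p_comp QuadRel l m n f g \<in> quad_hom l n" if fg: "f \<in> quad_hom l m" "g \<in> quad_hom m n"
    proof -
      obtain s t where s: "s \<in> diagrams gqa_sig l m" "gev s = f" and t: "t \<in> diagrams gqa_sig m n" "gev t = g"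
        using quad_hom_gev[OF fg(1)] quad_hom_gev[OF fg(2)] by blast
      show ?thesis
        using gev_quad_hom[OF diagrams_intros(3)[OF s(1) t(1)]] by (simp only: gev_simps(3)[OF s(1) t(1)] s(2) t(2))
    qed
    show "p_tens QuadRel m n m' n' f g \<in> quad_hom (m + m') (n + n')" if fg: "f \<in> quad_hom m n" "g \<in> quad_hom m' n'"
    proof -
      obtain s t where s: "s \<in> diagrams gqa_sig m n" "gev s = f" and t: "t \<in> diagrams gqa_sig m' n'" "gev t = g"
        using quad_hom_gev[OF fg(1)] quad_hom_gev[OF fg(2)] by blast
      show ?thesis
        using gev_quad_hom[OF diagrams_intros(4)[OF s(1) t(1)]] by (simp only: gev_simps(4)[OF s(1) t(1)] s(2) t(2))
    qed
    show "p_comp QuadRel m m n (p_id QuadRel m) f = f" if "f \<in> quad_hom m n"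
      using A.id_left[of f m n] ext[OF that] by simp
    show "p_comp QuadRel m n n f (p_id QuadRel n) = f" if "f \<in> quad_hom m n"
      using A.id_right[of f m n] ext[OF that] by simp
    show "p_comp QuadRel k m n (p_comp QuadRel k l m f g) h = p_comp QuadRel k l n f (p_comp QuadRel l m n g h)"
      if "f \<in> quad_hom k l" "g \<in> quad_hom l m" "h \<in> quad_hom m n"
      using A.comp_assoc[of f k l g m h n] that by (simp add: ext)
    show "p_tens QuadRel m m n n (p_id QuadRel m) (p_id QuadRel n) = p_id QuadRel (m + n)"
      using A.tens_id by simp
    show "p_tens QuadRel l n l' n' (p_comp QuadRel l m n f g) (p_comp QuadRel l' m' n' f' g') =
        p_comp QuadRel (l + l') (m + m') (n + n') (p_tens QuadRel l m l' m' f f') (p_tens QuadRel m n m' n' g g')"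
      if "f \<in> quad_hom l m" "g \<in> quad_hom m n" "f' \<in> quad_hom l' m'" "g' \<in> quad_hom m' n'"
      using A.interchange[of f l m g n f' l' m' g' n'] that by (simp only: AllRel_simps ext)
    show "p_tens QuadRel 0 0 m n (p_id QuadRel 0) f = f" if "f \<in> quad_hom m n"
      using A.unit_left[of f m n] ext[OF that] by simp
    show "p_tens QuadRel m n 0 0 f (p_id QuadRel 0) = f" if "f \<in> quad_hom m n"
      using A.unit_right[of f m n] ext[OF that] by simp
    show "p_tens QuadRel (m + m') (n + n') m'' n'' (p_tens QuadRel m n m' n' f g) h =
        p_tens QuadRel m n (m' + m'') (n' + n'') f (p_tens QuadRel m' n' m'' n'' g h)"
      if "f \<in> quad_hom m n" "g \<in> quad_hom m' n'" "h \<in> quad_hom m'' n''"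
      using A.tens_assoc[of f m n g m' n' h m'' n''] that by (simp only: AllRel_simps ext)
    show "p_comp QuadRel (m + m') (n + n') (n' + n) (p_tens QuadRel m n m' n' f g) (p_sym QuadRel n n') =
        p_comp QuadRel (m + m') (m' + m) (n' + n) (p_sym QuadRel m m') (p_tens QuadRel m' n' m n g f)"
      if "f \<in> quad_hom m n" "g \<in> quad_hom m' n'"
      using A.sym_natural[of f m n g m' n'] that by (simp only: AllRel_simps ext)
    show "p_comp QuadRel (m + n) (n + m) (m + n) (p_sym QuadRel m n) (p_sym QuadRel n m) = p_id QuadRel (m + n)"
      using A.sym_inverse by (simp only: AllRel_simps)
    show "p_sym QuadRel n 0 = p_id QuadRel n"
      using A.sym_unit by (simp only: AllRel_simps)
    show "p_sym QuadRel (l + m) n = p_comp QuadRel (l + m + n) (l + n + m) (n + l + m)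
        (p_tens QuadRel l l (m + n) (n + m) (p_id QuadRel l) (p_sym QuadRel m n))
        (p_tens QuadRel (l + n) (n + l) m m (p_sym QuadRel l n) (p_id QuadRel m))"
      using A.sym_hexagon[of l m n] by (simp only: AllRel_simps)
  qed
qed

section \<open>The presented prop and the interpretation\<close>

definition dcls :: "('g \<Rightarrow> nat \<times> nat) \<Rightarrow> ('g diagram \<Rightarrow> 'g diagram \<Rightarrow> bool) \<Rightarrow> nat \<Rightarrow> nat \<Rightarrow> 'g diagram \<Rightarrow> 'g diagram set" where
  "dcls \<sigma> E m n t = diag_rel \<sigma> E m n `` {t}"

lemma mem_dcls: "s \<in> dcls \<sigma> E m n t \<longleftrightarrow> diag_eq \<sigma> E m n t s"
  by (simp add: dcls_def diag_rel_def)

lemma dcls_eqI: "diag_eq \<sigma> E m n s t \<Longrightarrow> dcls \<sigma> E m n s = dcls \<sigma> E m n t"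
  by (auto simp: mem_dcls intro: eq_trans eq_trans[OF eq_sym])

lemma presented_simps:
  "p_hom (presented_prop \<sigma> E) m n = dcls \<sigma> E m n ` diagrams \<sigma> m n"
  "p_id (presented_prop \<sigma> E) n = dcls \<sigma> E n n (Wires n)"
  "p_sym (presented_prop \<sigma> E) m n = dcls \<sigma> E (m + n) (n + m) (Swap m n)"
  by (auto simp: presented_prop_def dcls_def quotient_def)

text \<open>The operations of \<open>presented_prop\<close> are unions over all pairs of
  representatives; congruence makes every member of such a union the same class.\<close>

lemma UN_UN_const: "(\<And>x y. x \<in> A \<Longrightarrow> y \<in> B \<Longrightarrow> f x y = C) \<Longrightarrow> a \<in> A \<Longrightarrow> b \<in> B \<Longrightarrow> (\<Union>x\<in>A. \<Union>y\<in>B. f x y) = C"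
  by blast

lemma presented_comp:
  assumes "s \<in> diagrams \<sigma> l m" "t \<in> diagrams \<sigma> m n"
  shows "p_comp (presented_prop \<sigma> E) l m n (dcls \<sigma> E l m s) (dcls \<sigma> E m n t) = dcls \<sigma> E l n (s \<Zsemi> t)"
proof -
  have "p_comp (presented_prop \<sigma> E) l m n (dcls \<sigma> E l m s) (dcls \<sigma> E m n t) =
      (\<Union>s'\<in>dcls \<sigma> E l m s. \<Union>t'\<in>dcls \<sigma> E m n t. dcls \<sigma> E l n (s' \<Zsemi> t'))"
    by (simp add: presented_prop_def dcls_def)
  also have "\<dots> = dcls \<sigma> E l n (s \<Zsemi> t)"
  proof (rule UN_UN_const)
    show "s \<in> dcls \<sigma> E l m s" "t \<in> dcls \<sigma> E m n t" using assms by (simp_all add: mem_dcls eq_refl)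
    show "dcls \<sigma> E l n (s' \<Zsemi> t') = dcls \<sigma> E l n (s \<Zsemi> t)"
      if "s' \<in> dcls \<sigma> E l m s" "t' \<in> dcls \<sigma> E m n t" for s' t'
      using that by (intro dcls_eqI[symmetric] eq_Seq[of _ _ l m]) (simp_all add: mem_dcls)
  qed
  finally show ?thesis .
qed

lemma presented_tens:
  assumes "s \<in> diagrams \<sigma> m n" "t \<in> diagrams \<sigma> m' n'"
  shows "p_tens (presented_prop \<sigma> E) m n m' n' (dcls \<sigma> E m n s) (dcls \<sigma> E m' n' t) = dcls \<sigma> E (m + m') (n + n') (s \<parallel> t)"
proof -
  have "p_tens (presented_prop \<sigma> E) m n m' n' (dcls \<sigma> E m n s) (dcls \<sigma> E m' n' t) =
      (\<Union>s'\<in>dcls \<sigma> E m n s. \<Union>t'\<in>dcls \<sigma> E m' n' t. dcls \<sigma> E (m + m') (n + n') (s' \<parallel> t'))"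
    by (simp add: presented_prop_def dcls_def)
  also have "\<dots> = dcls \<sigma> E (m + m') (n + n') (s \<parallel> t)"
  proof (rule UN_UN_const)
    show "s \<in> dcls \<sigma> E m n s" "t \<in> dcls \<sigma> E m' n' t" using assms by (simp_all add: mem_dcls eq_refl)
    show "dcls \<sigma> E (m + m') (n + n') (s' \<parallel> t') = dcls \<sigma> E (m + m') (n + n') (s \<parallel> t)"
      if "s' \<in> dcls \<sigma> E m n s" "t' \<in> dcls \<sigma> E m' n' t" for s' t'
      using that by (intro dcls_eqI[symmetric] eq_Par) (simp_all add: mem_dcls)
  qed
  finally show ?thesis .
qed

lemma presented_prop_cat: "prop_cat (presented_prop \<sigma> E)"
proof (unfold_locales, unfold presented_simps, goal_cases)
  case (1 n)
  show ?case by (intro imageI diagrams_intros)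
next
  case (2 f l m g n)
  then obtain s t where "s \<in> diagrams \<sigma> l m" "f = dcls \<sigma> E l m s" "t \<in> diagrams \<sigma> m n" "g = dcls \<sigma> E m n t" by blast
  then show ?case by (simp add: presented_comp diagrams_intros(3))
next
  case (3 f m n g m' n')
  then obtain s t where "s \<in> diagrams \<sigma> m n" "f = dcls \<sigma> E m n s" "t \<in> diagrams \<sigma> m' n'" "g = dcls \<sigma> E m' n' t" by blast
  then show ?case by (simp add: presented_tens diagrams_intros(4))
next
  case (4 m n)
  show ?case by (intro imageI diagrams_intros)
next
  case (5 f m n)
  then obtain s where s: "s \<in> diagrams \<sigma> m n" "f = dcls \<sigma> E m n s" by blast
  show ?case unfolding s(2) presented_comp[OF diagrams_intros(1) s(1)] by (rule dcls_eqI[OF eq_id_left[OF s(1)]])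
next
  case (6 f m n)
  then obtain s where s: "s \<in> diagrams \<sigma> m n" "f = dcls \<sigma> E m n s" by blast
  show ?case unfolding s(2) presented_comp[OF s(1) diagrams_intros(1)] by (rule dcls_eqI[OF eq_id_right[OF s(1)]])
next
  case (7 f k l g m h n)
  then obtain s t u where s: "s \<in> diagrams \<sigma> k l" "f = dcls \<sigma> E k l s" and t: "t \<in> diagrams \<sigma> l m" "g = dcls \<sigma> E l m t"
    and u: "u \<in> diagrams \<sigma> m n" "h = dcls \<sigma> E m n u" by blast
  show ?case
    unfolding s(2) t(2) u(2) presented_comp[OF s(1) t(1)] presented_comp[OF t(1) u(1)]
      presented_comp[OF diagrams_intros(3)[OF s(1) t(1)] u(1)] presented_comp[OF s(1) diagrams_intros(3)[OF t(1) u(1)]]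
    by (rule dcls_eqI[OF eq_Seq_assoc[OF s(1) t(1) u(1)]])
next
  case (8 m n)
  show ?case unfolding presented_tens[OF diagrams_intros(1) diagrams_intros(1)] by (rule dcls_eqI[OF eq_Par_id])
next
  case (9 f l m g n f' l' m' g' n')
  then obtain s t s' t' where s: "s \<in> diagrams \<sigma> l m" "f = dcls \<sigma> E l m s" and t: "t \<in> diagrams \<sigma> m n" "g = dcls \<sigma> E m n t"
    and s': "s' \<in> diagrams \<sigma> l' m'" "f' = dcls \<sigma> E l' m' s'" and t': "t' \<in> diagrams \<sigma> m' n'" "g' = dcls \<sigma> E m' n' t'" by blast
  show ?case
    unfolding s(2) t(2) s'(2) t'(2) presented_comp[OF s(1) t(1)] presented_comp[OF s'(1) t'(1)]
      presented_tens[OF s(1) s'(1)] presented_tens[OF t(1) t'(1)]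
      presented_tens[OF diagrams_intros(3)[OF s(1) t(1)] diagrams_intros(3)[OF s'(1) t'(1)]]
      presented_comp[OF diagrams_intros(4)[OF s(1) s'(1)] diagrams_intros(4)[OF t(1) t'(1)]]
    by (rule dcls_eqI[OF eq_interchange[OF s(1) t(1) s'(1) t'(1)]])
next
  case (10 f m n)
  then obtain s where s: "s \<in> diagrams \<sigma> m n" "f = dcls \<sigma> E m n s" by blast
  show ?case
    unfolding s(2) presented_tens[OF diagrams_intros(1) s(1)] using dcls_eqI[OF eq_unit_left[OF s(1)]] by simp
next
  case (11 f m n)
  then obtain s where s: "s \<in> diagrams \<sigma> m n" "f = dcls \<sigma> E m n s" by blast
  show ?case
    unfolding s(2) presented_tens[OF s(1) diagrams_intros(1)] using dcls_eqI[OF eq_unit_right[OF s(1)]] by simp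
next
  case (12 f m n g m' n' h m'' n'')
  then obtain s t u where s: "s \<in> diagrams \<sigma> m n" "f = dcls \<sigma> E m n s" and t: "t \<in> diagrams \<sigma> m' n'" "g = dcls \<sigma> E m' n' t"
    and u: "u \<in> diagrams \<sigma> m'' n''" "h = dcls \<sigma> E m'' n'' u" by blast
  show ?case
    unfolding s(2) t(2) u(2) presented_tens[OF s(1) t(1)] presented_tens[OF t(1) u(1)]
      presented_tens[OF diagrams_intros(4)[OF s(1) t(1)] u(1)] presented_tens[OF s(1) diagrams_intros(4)[OF t(1) u(1)]]
      add.assoc[symmetric]
    by (rule dcls_eqI[OF eq_Par_assoc[OF s(1) t(1) u(1)]])
next
  case (13 f m n g m' n')
  then obtain s t where s: "s \<in> diagrams \<sigma> m n" "f = dcls \<sigma> E m n s" and t: "t \<in> diagrams \<sigma> m' n'" "g = dcls \<sigma> E m' n' t" by blast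
  show ?case
    unfolding s(2) t(2) presented_tens[OF s(1) t(1)] presented_tens[OF t(1) s(1)]
      presented_comp[OF diagrams_intros(4)[OF s(1) t(1)] diagrams_intros(2)]
      presented_comp[OF diagrams_intros(2) diagrams_intros(4)[OF t(1) s(1)]]
    by (rule dcls_eqI[OF eq_Swap_natural[OF s(1) t(1)]])
next
  case (14 m n)
  show ?case unfolding presented_comp[OF diagrams_intros(2) diagrams_intros(2)] by (rule dcls_eqI[OF eq_Swap_inverse])
next
  case (15 n)
  show ?case using dcls_eqI[OF eq_Swap_unit[where \<sigma> = \<sigma> and E = E and n = n]] by simp
next
  case (16 l m n)
  have i: "Wires l \<parallel> Swap m n \<in> diagrams \<sigma> (l + m + n) (l + n + m)"
    "Swap l n \<parallel> Wires m \<in> diagrams \<sigma> (l + n + m) (n + l + m)"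
    by (simp_all add: diagrams_def)
  have 1: "p_tens (presented_prop \<sigma> E) l l (m + n) (n + m) (dcls \<sigma> E l l (Wires l)) (dcls \<sigma> E (m + n) (n + m) (Swap m n)) =
      dcls \<sigma> E (l + m + n) (l + n + m) (Wires l \<parallel> Swap m n)"
    using presented_tens[OF diagrams_intros(1)[where n = l] diagrams_intros(2)[where m = m and n = n],
        where E = E and \<sigma> = \<sigma>] by (simp add: add.assoc)
  have 2: "p_tens (presented_prop \<sigma> E) (l + n) (n + l) m m (dcls \<sigma> E (l + n) (n + l) (Swap l n)) (dcls \<sigma> E m m (Wires m)) =
      dcls \<sigma> E (l + n + m) (n + l + m) (Swap l n \<parallel> Wires m)"
    by (rule presented_tens) (rule diagrams_intros)+
  have "dcls \<sigma> E (l + m + n) (n + (l + m)) (Swap (l + m) n) =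
      dcls \<sigma> E (l + m + n) (n + l + m) ((Wires l \<parallel> Swap m n) \<Zsemi> (Swap l n \<parallel> Wires m))"
    unfolding add.assoc[symmetric] by (rule dcls_eqI) (rule eq_Swap_hexagon)
  then show ?case unfolding 1 2 presented_comp[OF i] by (simp only: add.assoc)
qed

lemma gqa_interp_dcls:
  assumes "t \<in> diagrams gqa_sig m n"
  shows "gqa_interp k k' (dcls gqa_sig gqa_axiom m n t) = gev t"
proof -
  have "t \<in> dcls gqa_sig gqa_axiom m n t"
    using assms by (simp add: mem_dcls eq_refl)
  moreover have "gev s = gev t" if "s \<in> dcls gqa_sig gqa_axiom m n t" for s
    using that gev_sound[of m n t s] by (simp add: mem_dcls)
  ultimately have "gev ` dcls gqa_sig gqa_axiom m n t = {gev t}" by blast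
  then show ?thesis by (simp add: gqa_interp_def interpretation_map_def)
qed

lemma gqa_interp_morphism: "prop_morphism GQA QuadRel gqa_interp"
  unfolding GQA_def
proof (rule prop_morphism.intro[OF presented_prop_cat QuadRel_prop], unfold_locales,
    unfold presented_simps p_hom_QuadRel, goal_cases)
  case (1 f m n)
  then show ?case by (auto simp: gqa_interp_dcls gev_quad_hom)
next
  case (2 n)
  show ?case by (simp add: gqa_interp_dcls diagrams_intros)
next
  case (3 f l m g n)
  then obtain s t where "f = dcls gqa_sig gqa_axiom l m s" "s \<in> diagrams gqa_sig l m"
    "g = dcls gqa_sig gqa_axiom m n t" "t \<in> diagrams gqa_sig m n" by auto
  then show ?case
    by (simp add: presented_comp gqa_interp_dcls[OF diagrams_intros(3)[of s gqa_sig l m t n]] gqa_interp_dcls gev_simps(3) del: eval.simps)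
next
  case (4 f m n g m' n')
  then obtain s t where "f = dcls gqa_sig gqa_axiom m n s" "s \<in> diagrams gqa_sig m n"
    "g = dcls gqa_sig gqa_axiom m' n' t" "t \<in> diagrams gqa_sig m' n'" by auto
  then show ?case
    by (simp add: presented_tens gqa_interp_dcls[OF diagrams_intros(4)[of s gqa_sig m n t m' n']] gqa_interp_dcls gev_simps(4) del: eval.simps)
next
  case (5 m n)
  show ?case by (simp add: gqa_interp_dcls diagrams_intros)
qed

lemma gqa_interp_bij: "bij_betw (gqa_interp m n) (p_hom GQA m n) (p_hom QuadRel m n)"
  unfolding bij_betw_def
proof
  show "inj_on (gqa_interp m n) (p_hom GQA m n)"
    unfolding GQA_def presented_simps
    by (rule inj_onI) (auto simp: gqa_interp_dcls intro!: dcls_eqI gev_complete)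
  have "gqa_interp m n ` p_hom GQA m n = gev ` diagrams gqa_sig m n"
    unfolding GQA_def presented_simps by (auto simp: gqa_interp_dcls image_iff)
  also have "\<dots> = quad_hom m n"
    using gev_quad_hom quad_hom_gev by (auto simp: image_iff) metis
  finally show "gqa_interp m n ` p_hom GQA m n = p_hom QuadRel m n"
    by (simp add: p_hom_QuadRel)
qed

theorem theorem3:
  shows "prop_isomorphism GQA QuadRel gqa_interp \<and>
         (\<forall>g. gqa_interp (fst (gqa_sig g)) (snd (gqa_sig g)) (gqa_class (Gen g)) = gen_interp g)"
proof (intro conjI allI)
  show "prop_isomorphism GQA QuadRel gqa_interp"
    by (rule prop_isomorphismI[OF gqa_interp_morphism gqa_interp_bij])
  show "gqa_interp (fst (gqa_sig g)) (snd (gqa_sig g)) (gqa_class (Gen g)) = gen_interp g" for g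
    unfolding gqa_class_def dcls_def[symmetric]
    by (subst gqa_interp_dcls) (simp_all add: diagrams_def)
qed

end
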